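(* Let $G \in \mathcal{F}_n$. Let $d_n(W(G)) = \prod_{j=1}^m p_j^{k_j}$ be the prime factorization of the last invariant factor of the walk matrix $W(G)$ (with $p_1,\dots,p_m$ distinct primes and each $k_j\ge 1$). Then $G$ can have at most $\left(\prod_{j=1}^m k_j\right)-1$ generalized cospectral mates.
   Context: All graphs are simple (finite, undirected, no loops or multiple edges). For a graph $G$ on $n$ vertices, $A(G)$ is its adjacency matrix, and $\overline{G}$ is its complement. $\operatorname{Spec}(G)$ is the multiset of eigenvalues of $A(G)$. The generalized spectrum of $G$ is the pair $(\operatorname{Spec}(G), \operatorname{Spec}(\overline{G}))$; two graphs are generalized cospectral if they have the same generalized spectrum. A set of pairwise non-isomorphic graphs that are generalized cospectral are called generalized cospectral mates of each other; thus the number of generalized cospectral mates of $G$ is the number of isomorphism classes of graphs that are generalized cospectral to $G$ but not isomorphic to $G$. Let $e$ be the all-ones column vector of length $n$. The walk matrix $W(G)$ is the $n\times n$ matrix with columns $e, A(G)e, \dots, A(G)^{n-1}e$. $G$ is controllable if $W(G)$ is non-singular. For a full-rank integral $n \times n$ matrix $M$, $d_1(M)\mid d_2(M)\mid\cdots\mid d_n(M)$ denote the (positive) invariant factors of its Smith Normal Form. $\mathcal{F}_n$ is the family of controllable graphs $G$ on $n$ vertices with $d_{\lceil n/2\rceil}(W(G)) = 1$ and $d_{n-1}(W(G)) = 2$. *)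

theory Defs
  imports "Jordan_Normal_Form.Char_Poly"
begin

text \<open>
  A graph of order \<open>n\<close> has vertex set \<open>{..<n}\<close> and is given by its adjacency relation.
  Every finite graph is isomorphic to such a graph, and generalized cospectral graphs have
  the same order (the number of eigenvalues), so isomorphism classes of mates can be counted
  among the graphs on \<open>{..<n}\<close>.
\<close>

type_synonym graph = "(nat \<times> nat) set"

definition simple_graphs :: "nat \<Rightarrow> graph set" where
  "simple_graphs n = {G. G \<subseteq> {..<n} \<times> {..<n} \<and> sym G \<and> irrefl G}"

definition complement :: "nat \<Rightarrow> graph \<Rightarrow> graph" where
  "complement n G = {(i, j). i < n \<and> j < n \<and> i \<noteq> j \<and> (i, j) \<notin> G}"

definition graph_iso :: "nat \<Rightarrow> (graph \<times> graph) set" where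
  "graph_iso n = {(G, H). G \<in> simple_graphs n \<and> H \<in> simple_graphs n \<and>
     (\<exists>f. bij_betw f {..<n} {..<n} \<and>
          (\<forall>i<n. \<forall>j<n. (i, j) \<in> G \<longleftrightarrow> (f i, f j) \<in> H))}"

definition adjacency_matrix :: "nat \<Rightarrow> graph \<Rightarrow> int mat" where
  "adjacency_matrix n G = mat n n (\<lambda>(i, j). if (i, j) \<in> G then 1 else 0)"

definition Spec :: "nat \<Rightarrow> graph \<Rightarrow> complex multiset" where
  "Spec n G = proots (char_poly (map_mat of_int (adjacency_matrix n G)))"

definition generalized_spectrum :: "nat \<Rightarrow> graph \<Rightarrow> complex multiset \<times> complex multiset" where
  "generalized_spectrum n G = (Spec n G, Spec n (complement n G))"

definition generalized_cospectral :: "nat \<Rightarrow> graph \<Rightarrow> graph \<Rightarrow> bool" where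
  "generalized_cospectral n G H \<longleftrightarrow> generalized_spectrum n G = generalized_spectrum n H"

definition mate_classes :: "nat \<Rightarrow> graph \<Rightarrow> graph set set" where
  "mate_classes n G =
     {H \<in> simple_graphs n. generalized_cospectral n G H \<and> (G, H) \<notin> graph_iso n} // graph_iso n"

definition number_of_mates :: "nat \<Rightarrow> graph \<Rightarrow> nat" where
  "number_of_mates n G = card (mate_classes n G)"

definition all_ones :: "nat \<Rightarrow> int vec" where
  "all_ones n = vec n (\<lambda>_. 1)"

definition walk_matrix :: "nat \<Rightarrow> graph \<Rightarrow> int mat" where
  "walk_matrix n G =
     mat_of_cols n (map (\<lambda>k. (adjacency_matrix n G ^\<^sub>m k) *\<^sub>v all_ones n) [0..<n])"

definition controllable :: "nat \<Rightarrow> graph \<Rightarrow> bool" where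
  "controllable n G \<longleftrightarrow> det (walk_matrix n G) \<noteq> 0"

text \<open>
  \<open>invertible_mat\<close> is taken over the integers, so \<open>U\<close> and \<open>V\<close> are unimodular. The diagonal
  entries are \<open>d 1, \<dots>, d n\<close>; other values of \<open>d\<close> are irrelevant. Positivity of
  the entries restricts the notion to full-rank matrices.
\<close>

definition is_smith_diagonal :: "int mat \<Rightarrow> (nat \<Rightarrow> nat) \<Rightarrow> bool" where
  "is_smith_diagonal M d \<longleftrightarrow>
     (let n = dim_row M in
       (\<exists>U V. U \<in> carrier_mat n n \<and> V \<in> carrier_mat n n \<and>
              invertible_mat U \<and> invertible_mat V \<and>
              U * M * V = mat_diag n (\<lambda>i. int (d (Suc i)))) \<and>
       (\<forall>k\<in>{1..n}. 0 < d k) \<and>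
       (\<forall>k\<in>{1..<n}. d k dvd d (Suc k)))"

text \<open>
  The Smith normal form of a full-rank square integer matrix exists and is unique, so the
  choice below does not affect \<open>invariant_factor M k\<close> for \<open>1 \<le> k \<le> n\<close>.
\<close>

definition invariant_factor :: "int mat \<Rightarrow> nat \<Rightarrow> nat" where
  "invariant_factor M k = (SOME d. is_smith_diagonal M d) k"

text \<open>The bound \<open>2 \<le> n\<close> is what makes the index \<open>n - 1\<close> of an invariant factor meaningful.\<close>

definition graph_family :: "nat \<Rightarrow> graph set" where
  "graph_family n = {G \<in> simple_graphs n. 2 \<le> n \<and> controllable n G \<and>
     invariant_factor (walk_matrix n G) (nat \<lceil>real n / 2\<rceil>) = 1 \<and>
     invariant_factor (walk_matrix n G) (n - 1) = 2}"

lemma finite_simple_graphs: "finite (simple_graphs n)"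
  by (rule finite_subset[of _ "Pow ({..<n} \<times> {..<n})"]) (auto simp: simple_graphs_def)

lemma equiv_graph_iso: "equiv (simple_graphs n) (graph_iso n)"
proof (rule equivI)
  show "graph_iso n \<subseteq> simple_graphs n \<times> simple_graphs n"
    by (auto simp: graph_iso_def)
  show "refl_on (simple_graphs n) (graph_iso n)"
    by (auto simp: refl_on_def graph_iso_def intro!: exI[of _ id])
  show "sym (graph_iso n)"
  proof (rule symI)
    fix G H assume "(G, H) \<in> graph_iso n"
    then obtain f where *: "G \<in> simple_graphs n" "H \<in> simple_graphs n"
      and f: "bij_betw f {..<n} {..<n}"
      and e: "\<And>i j. i < n \<Longrightarrow> j < n \<Longrightarrow> (i, j) \<in> G \<longleftrightarrow> (f i, f j) \<in> H"
      by (auto simp: graph_iso_def)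
    let ?g = "inv_into {..<n} f"
    have g: "bij_betw ?g {..<n} {..<n}" using f by (rule bij_betw_inv_into)
    have "?g i < n" "f (?g i) = i" if "i < n" for i
      using that g f by (auto simp: bij_betw_def bij_betw_inv_into_right[OF f])
    then have "\<forall>i<n. \<forall>j<n. (i, j) \<in> H \<longleftrightarrow> (?g i, ?g j) \<in> G" using e by simp
    with * g show "(H, G) \<in> graph_iso n" by (auto simp: graph_iso_def)
  qed
  show "trans (graph_iso n)"
  proof (rule transI)
    fix G H K assume "(G, H) \<in> graph_iso n" "(H, K) \<in> graph_iso n"
    then obtain f g where *: "G \<in> simple_graphs n" "K \<in> simple_graphs n"
      and fg: "bij_betw f {..<n} {..<n}" "bij_betw g {..<n} {..<n}"
      and e: "\<And>i j. i < n \<Longrightarrow> j < n \<Longrightarrow> (i, j) \<in> G \<longleftrightarrow> (f i, f j) \<in> H"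
      and e': "\<And>i j. i < n \<Longrightarrow> j < n \<Longrightarrow> (i, j) \<in> H \<longleftrightarrow> (g i, g j) \<in> K"
      by (auto simp: graph_iso_def)
    have b: "bij_betw (g \<circ> f) {..<n} {..<n}" using fg by (rule bij_betw_trans)
    have "f i < n" if "i < n" for i using that fg(1) by (auto simp: bij_betw_def)
    then have "\<forall>i<n. \<forall>j<n. (i, j) \<in> G \<longleftrightarrow> ((g \<circ> f) i, (g \<circ> f) j) \<in> K"
      using e e' by simp
    with * b show "(G, K) \<in> graph_iso n" unfolding graph_iso_def by blast
  qed
qed

lemma finite_mate_classes: "finite (mate_classes n G)"
  unfolding mate_classes_def quotient_def
  by (rule finite_UN_I) (auto intro: finite_subset[OF _ finite_simple_graphs[of n]])

end

theory Submission
  imports Defs "Jordan_Normal_Form.Column_Operations" "HOL-Number_Theory.Cong"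
begin

text \<open>
  Let \<open>A\<close>, \<open>B\<close> be the adjacency matrices of \<open>G\<close> and of a generalized cospectral graph. There is a
  rational orthogonal \<open>Q\<close> with \<open>Q e = e\<close> and \<open>A Q = Q B\<close>; its level \<open>l\<close> is the least denominator.
  Modulo 2 the characteristic polynomial is essentially a square \<open>\<theta>\<^sup>2\<close> with \<open>\<theta>(A) e\<close> even, so half of
  the columns of the walk matrix can be divided by 2. For \<open>G\<close> in the family, the resulting integer
  matrix \<open>X\<close> has invariant factors \<open>1, \<dots>, 1, d\<^sub>n / 2\<close>, and \<open>Q\<^sup>T X\<close> is integral. Hence \<open>l\<close> divides
  \<open>d\<^sub>n / 2\<close>, and \<open>l Q\<close> has rank one modulo \<open>l\<close> with a column space depending on \<open>G\<close> only.

  Two unimodular lattices \<open>Q \<int>\<^sup>n\<close> of the same level then coincide, so \<open>l\<close> determines the mate. Moreover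
  if an odd prime \<open>p\<close> has exponent \<open>k\<close> in \<open>d\<^sub>n\<close>, then \<open>p\<^sup>k\<close> does not divide \<open>l\<close>: otherwise \<open>l Q \<equiv> x y\<^sup>T\<close>
  with eigenvectors \<open>x\<close>, \<open>y\<close> of \<open>A\<close>, \<open>B\<close> modulo \<open>p\<^sup>k\<close> that are orthogonal to \<open>e\<close>, the adjugates of
  \<open>\<lambda> - A\<close> and \<open>\<lambda> - B\<close> are multiples of \<open>x x\<^sup>T\<close> and \<open>y y\<^sup>T\<close> and so kill \<open>e\<close>, and this makes the
  determinant of the walk matrix divisible by \<open>p\<^sup>k\<^sup>+\<^sup>1\<close>. The number of admissible levels is \<open>\<Prod> k\<^sub>j\<close>,
  and level 1 belongs to \<open>G\<close> itself.
\<close>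

text \<open>The spectra enter only through the common characteristic polynomial and the numbers
  \<open>e^T f(A) e\<close>, which agree for \<open>A\<close> and \<open>B\<close> for every
  polynomial \<open>f\<close>. Hence walk matrices written in any polynomial basis have equal Gram
  matrices. A basis of monic polynomials changes the walk matrix by a unimodular factor only, so the
  division by 2 and the later division by \<open>p^k\<close> can each be made in a basis of its own.

  The conditions on the invariant factors leave at most floor(n/2) - 1 factors 2 before the last
  one, while floor(n/2) columns can be halved. Comparing determinants, the halving must use up all
  of these and one factor 2 of \<open>d_n\<close>; in particular |det W| = 2^floor(n/2) * d_n / 2.
  So an odd prime has the same exponent in det W as in \<open>d_n\<close>, which is why divisibility
  of det W by \<open>p^(k+1)\<close> is absurd. For p = 2 the exponent already drops by one because
  the level divides \<open>d_n / 2\<close>. Every prime \<open>p_j\<close> thus leaves the exponents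
  0, ..., k_j - 1 for the level.\<close>

lemma mult_mat_entry:
  assumes "A \<in> carrier_mat m n" "B \<in> carrier_mat n l" "i < m" "j < l"
  shows "(A * B) $$ (i, j) = (\<Sum>k<n. A $$ (i, k) * B $$ (k, j))"
  using assms by (auto simp: scalar_prod_def atLeast0LessThan intro!: sum.cong)

lemma mult_mat_vec_entry:
  assumes "A \<in> carrier_mat m n" "v \<in> carrier_vec n" "i < m"
  shows "(A *\<^sub>v v) $ i = (\<Sum>k<n. A $$ (i, k) * v $ k)"
  using assms by (auto simp: scalar_prod_def atLeast0LessThan intro!: sum.cong)

subsection \<open>Smith normal form\<close>

text \<open>The determinant form is multiplicative and easy to check for elementary and block
  matrices; \<open>invertible_mat_iff_unimodular\<close> links it to the units of the matrix
  ring.\<close>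

definition unimodular :: "nat \<Rightarrow> int mat \<Rightarrow> bool" where
  "unimodular n U \<longleftrightarrow> U \<in> carrier_mat n n \<and> \<bar>det U\<bar> = 1"

lemma unimodular_carrier: "unimodular n U \<Longrightarrow> U \<in> carrier_mat n n"
  by (simp add: unimodular_def)

lemma unimodular_one: "unimodular n (1\<^sub>m n)"
  by (simp add: unimodular_def)

lemma unimodular_mult: "unimodular n U \<Longrightarrow> unimodular n V \<Longrightarrow> unimodular n (U * V)"
  by (auto simp: unimodular_def det_mult abs_mult)

lemma unimodular_inverse:
  assumes "unimodular n U"
  obtains U' where "unimodular n U'" "U * U' = 1\<^sub>m n" "U' * U = 1\<^sub>m n"
proof -
  have U: "U \<in> carrier_mat n n" and d: "det U * det U = 1"
    using assms abs_mult_self_eq[of "det U"] by (auto simp: unimodular_def)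
  note a = adj_mat[OF U]
  let ?W = "det U \<cdot>\<^sub>m adj_mat U"
  have W: "?W \<in> carrier_mat n n" using a by simp
  have 1: "U * ?W = 1\<^sub>m n"
    unfolding mult_smult_distrib[OF U a(1)] a(2) by (rule eq_matI) (use d in auto)
  have 2: "?W * U = 1\<^sub>m n"
    unfolding mult_smult_assoc_mat[OF a(1) U] a(3) by (rule eq_matI) (use d in auto)
  have "det U * det ?W = 1" using det_mult[OF U W] 1 by simp
  then have "unimodular n ?W" using W by (auto simp: unimodular_def zmult_eq_1_iff)
  with 1 2 that show thesis by blast
qed

lemma invertible_mat_iff_unimodular:
  assumes U: "U \<in> carrier_mat n n"
  shows "invertible_mat U \<longleftrightarrow> unimodular n U"
proof
  assume "invertible_mat U"
  then obtain B where B: "U * B = 1\<^sub>m n" "B * U = 1\<^sub>m (dim_row B)"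
    using U by (auto simp: invertible_mat_def inverts_mat_def)
  have "dim_col B = n" using arg_cong[OF B(1), of dim_col] by simp
  moreover have "dim_row B = n" using arg_cong[OF B(2), of dim_col] U by simp
  ultimately have Bc: "B \<in> carrier_mat n n" by auto
  have "det U * det B = 1" using det_mult[OF U Bc] B by simp
  then show "unimodular n U" using U by (auto simp: unimodular_def zmult_eq_1_iff)
next
  assume "unimodular n U"
  then obtain U' where "unimodular n U'" "U * U' = 1\<^sub>m n" "U' * U = 1\<^sub>m n"
    by (rule unimodular_inverse)
  then show "invertible_mat U" using U
    by (auto simp: invertible_mat_def inverts_mat_def unimodular_def intro!: exI[of _ U'])
qed

lemma unimodular_swaprows:
  assumes "k < n" "l < n"
  shows "unimodular n (swaprows_mat n k l)"
proof (cases "k = l")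
  case True
  then have "swaprows_mat n k l = (1\<^sub>m n :: int mat)" using assms by (auto simp: swaprows_mat_def)
  then show ?thesis using unimodular_one[of n] by (simp only:)
qed (use assms in \<open>simp add: unimodular_def det_swaprows_mat\<close>)

lemma unimodular_addrow: "k \<noteq> l \<Longrightarrow> k < n \<Longrightarrow> l < n \<Longrightarrow> unimodular n (addrow_mat n a k l)"
  by (auto simp: unimodular_def det_addrow_mat)

lemma unimodular_transpose: "unimodular n U \<Longrightarrow> unimodular n (transpose_mat U)"
  by (auto simp: unimodular_def det_transpose)

text \<open>One matrix subtracts multiples of column 0 from all other columns at once, so a whole
  row is reduced modulo the pivot in a single step. Its transpose does the same for rows.\<close>

lemma unimodular_clearing:
  fixes q :: "nat \<Rightarrow> int" and n :: nat
  defines "R \<equiv> mat n n (\<lambda>(i, j). if i = j then 1 else if i = 0 then - q j else 0)"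
  shows "unimodular n R"
    and "B \<in> carrier_mat n n \<Longrightarrow> i < n \<Longrightarrow> j < n \<Longrightarrow>
      (B * R) $$ (i, j) = B $$ (i, j) - (if j = 0 then 0 else B $$ (i, 0) * q j)"
proof -
  have R: "R \<in> carrier_mat n n" by (simp add: R_def)
  have "upper_triangular R" by (auto simp: R_def)
  then have "det R = prod_list (diag_mat R)" using R by (rule det_upper_triangular)
  also have "\<dots> = 1" by (simp add: prod_list_diag_prod R_def)
  finally show "unimodular n R" using R by (simp add: unimodular_def)
  assume B: "B \<in> carrier_mat n n" and ij: "i < n" "j < n"
  have "(B * R) $$ (i, j) = (\<Sum>k<n. B $$ (i, k) * R $$ (k, j))"
    by (rule mult_mat_entry[OF B R ij])
  also have "\<dots> = (\<Sum>k<n. (if k = j then B $$ (i, j) else 0) +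
      (if k = 0 then (if j = 0 then 0 else - B $$ (i, 0) * q j) else 0))"
    using ij by (intro sum.cong) (auto simp: R_def)
  also have "\<dots> = B $$ (i, j) - (if j = 0 then 0 else B $$ (i, 0) * q j)"
    using ij by (simp add: sum.distrib)
  finally show "(B * R) $$ (i, j) = B $$ (i, j) - (if j = 0 then 0 else B $$ (i, 0) * q j)" .
qed

definition mat_equiv :: "nat \<Rightarrow> int mat \<Rightarrow> int mat set" where
  "mat_equiv n M = {U * M * V | U V. unimodular n U \<and> unimodular n V}"

lemma mat_equiv_carrier:
  "M \<in> carrier_mat n n \<Longrightarrow> N \<in> mat_equiv n M \<Longrightarrow> N \<in> carrier_mat n n"
  by (auto simp: mat_equiv_def unimodular_def)

lemma mat_equiv_refl: "M \<in> carrier_mat n n \<Longrightarrow> M \<in> mat_equiv n M"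
  unfolding mat_equiv_def using unimodular_one[of n]
  by (intro CollectI exI[of _ "1\<^sub>m n"]) auto

lemma mat_equiv_trans:
  assumes M: "M \<in> carrier_mat n n" and "N \<in> mat_equiv n M" and "K \<in> mat_equiv n N"
  shows "K \<in> mat_equiv n M"
proof -
  from assms obtain U V U' V' where u: "unimodular n U" "unimodular n V" "unimodular n U'" "unimodular n V'"
    and K: "K = U' * (U * M * V) * V'" by (auto simp: mat_equiv_def)
  have "K = (U' * U) * M * (V * V')"
    unfolding K using u[THEN unimodular_carrier] M
    by (simp add: assoc_mult_mat[of _ n n _ n _ n])
  then show ?thesis unfolding mat_equiv_def using u unimodular_mult by blast
qed

lemma mat_equiv_left:
  assumes "M \<in> carrier_mat n n" "N \<in> mat_equiv n M" "unimodular n U"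
  shows "U * N \<in> mat_equiv n M"
proof (rule mat_equiv_trans[OF assms(1,2)])
  show "U * N \<in> mat_equiv n N" unfolding mat_equiv_def
    using assms mat_equiv_carrier[OF assms(1,2)] unimodular_one[of n] unimodular_carrier[OF assms(3)]
    by (intro CollectI exI[of _ U] exI[of _ "1\<^sub>m n"]) auto
qed

lemma mat_equiv_right:
  assumes "M \<in> carrier_mat n n" "N \<in> mat_equiv n M" "unimodular n V"
  shows "N * V \<in> mat_equiv n M"
proof (rule mat_equiv_trans[OF assms(1,2)])
  show "N * V \<in> mat_equiv n N" unfolding mat_equiv_def
    using assms mat_equiv_carrier[OF assms(1,2)] unimodular_one[of n]
    by (intro CollectI exI[of _ "1\<^sub>m n"] exI[of _ V]) auto
qed

text \<open>Instead of running the Euclidean algorithm, take the smallest absolute value of a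
  nonzero entry over all equivalent matrices. Any nonzero remainder on division by it would be a
  smaller entry.\<close>

lemma mat_equiv_minimal_pivot:
  assumes M: "M \<in> carrier_mat (Suc n) (Suc n)" and M0: "M $$ (a, b) \<noteq> 0" "a \<le> n" "b \<le> n"
  obtains X g where "X \<in> mat_equiv (Suc n) M" "g > 0" "X $$ (0, 0) = g"
    "\<And>i. 0 < i \<Longrightarrow> i \<le> n \<Longrightarrow> X $$ (i, 0) = 0" "\<And>j. 0 < j \<Longrightarrow> j \<le> n \<Longrightarrow> X $$ (0, j) = 0"
    "\<And>i j. i \<le> n \<Longrightarrow> j \<le> n \<Longrightarrow> g dvd X $$ (i, j)"
proof -
  let ?n = "Suc n"
  let ?E = "mat_equiv ?n M"
  note carr = mat_equiv_carrier[OF M]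
  let ?P = "\<lambda>k. k > 0 \<and> (\<exists>N i j. N \<in> ?E \<and> i \<le> n \<and> j \<le> n \<and> \<bar>N $$ (i, j)\<bar> = int k)"
  have "?P (nat \<bar>M $$ (a, b)\<bar>)" using M0 mat_equiv_refl[OF M] by auto
  then have P: "?P (LEAST k. ?P k)" by (rule LeastI)
  define k where "k = (LEAST k. ?P k)"
  have min: "k \<le> l" if "N \<in> ?E" "i \<le> n" "j \<le> n" "\<bar>N $$ (i, j)\<bar> = int l" "l > 0" for N i j l
    unfolding k_def by (rule Least_le) (use that in blast)
  from P obtain N0 i0 j0 where k: "k > 0" and N0: "N0 \<in> ?E" "i0 \<le> n" "j0 \<le> n" "\<bar>N0 $$ (i0, j0)\<bar> = int k"
    unfolding k_def[symmetric] by blast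
  define N1 where "N1 = swaprows_mat ?n 0 i0 * N0 * swaprows_mat ?n 0 j0"
  have N1: "N1 \<in> ?E" unfolding N1_def
    using N0 by (intro mat_equiv_right[OF M] mat_equiv_left[OF M] unimodular_swaprows) auto
  have c0: "N0 \<in> carrier_mat ?n ?n" using carr N0 by simp
  have "N1 = swapcols 0 j0 (swaprows 0 i0 N0)"
    unfolding N1_def using c0 N0 
    by (subst swaprows_mat[OF c0, symmetric], simp, simp, subst swapcols_mat[of _ ?n ?n]) auto
  then have "N1 $$ (0, 0) = N0 $$ (i0, j0)" using c0 N0 by auto
  define N where "N = (if N1 $$ (0, 0) > 0 then N1 else - 1\<^sub>m ?n * N1)"
  have u: "unimodular ?n (- 1\<^sub>m ?n)"
  proof -
    have "- 1\<^sub>m ?n = (-1 :: int) \<cdot>\<^sub>m 1\<^sub>m ?n" by (rule eq_matI) auto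
    then have "det (- 1\<^sub>m ?n :: int mat) = (-1) ^ ?n" by simp
    then show ?thesis by (simp add: unimodular_def abs_mult power_abs)
  qed
  have N: "N \<in> ?E" unfolding N_def using N1 mat_equiv_left[OF M N1 u] by auto
  have N00: "N $$ (0, 0) = int k"
    using N0(4) \<open>N1 $$ (0, 0) = N0 $$ (i0, j0)\<close> carr[OF N1] by (auto simp: N_def)
  \<comment> \<open>Minimality of \<open>k\<close> in usable form: a remainder modulo
    \<open>k\<close> that occurs as an entry of an equivalent matrix is 0.\<close>
  have rem: "B $$ (i, j) mod int k = 0"
    if "C \<in> ?E" "C $$ (i, j) = B $$ (i, j) mod int k" "i \<le> n" "j \<le> n" for B C i j
  proof (rule ccontr)
    assume "B $$ (i, j) mod int k \<noteq> 0"
    moreover have "0 \<le> B $$ (i, j) mod int k" "B $$ (i, j) mod int k < int k" using k by auto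
    moreover define r where "r = B $$ (i, j) mod int k"
    ultimately have r: "0 < r" "r < int k" by auto
    have "k \<le> nat r"
      by (rule min[OF that(1,3,4)]) (use r that(2) in \<open>auto simp: r_def\<close>)
    then show False using r by linarith
  qed
  let ?C = "\<lambda>q. mat ?n ?n (\<lambda>(i, j). if i = j then 1 else if i = 0 then - q j else (0::int))"
  have dvd_row: "int k dvd B $$ (0, j)" if B: "B \<in> ?E" "B $$ (0, 0) = int k" and j: "j \<le> n" for B j
  proof (cases "j = 0")
    case False
    let ?q = "\<lambda>j. B $$ (0, j) div int k"
    have "(B * ?C ?q) $$ (0, j) = B $$ (0, j) mod int k"
      using unimodular_clearing(2)[OF carr[OF B(1)], of 0 j ?q] j False B(2)
      by (simp only: minus_mult_div_eq_mod if_False zero_less_Suc less_Suc_eq_le)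
    from rem[OF mat_equiv_right[OF M B(1) unimodular_clearing(1)] this] j
    show ?thesis by (simp add: dvd_eq_mod_eq_0)
  qed (use B in simp)
  have tC: "(transpose_mat (?C q) * B) $$ (i, j) = B $$ (i, j) - (if i = 0 then 0 else B $$ (0, j) * q i)"
    if B: "B \<in> carrier_mat ?n ?n" and ij: "i \<le> n" "j \<le> n" for B q i j
  proof -
    have cB: "transpose_mat B \<in> carrier_mat ?n ?n" using B by simp
    have C: "?C q \<in> carrier_mat ?n ?n" by simp
    have "transpose_mat (?C q) * B = transpose_mat (transpose_mat B * ?C q)"
      using transpose_mult[OF cB C] B by simp
    then have "(transpose_mat (?C q) * B) $$ (i, j) = (transpose_mat B * ?C q) $$ (j, i)"
      using ij mult_carrier_mat[OF cB C] by (simp only: index_transpose_mat carrier_matD less_Suc_eq_le)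
    also have "\<dots> = transpose_mat B $$ (j, i) - (if i = 0 then 0 else transpose_mat B $$ (j, 0) * q i)"
      by (rule unimodular_clearing(2)[OF cB]) (use ij in auto)
    finally show ?thesis using ij B by simp
  qed
  have dvd_col: "int k dvd B $$ (i, 0)" if B: "B \<in> ?E" "B $$ (0, 0) = int k" and i: "i \<le> n" for B i
  proof (cases "i = 0")
    case False
    let ?q = "\<lambda>i. B $$ (i, 0) div int k"
    have "(transpose_mat (?C ?q) * B) $$ (i, 0) = B $$ (i, 0) mod int k"
      using tC[OF carr[OF B(1)] i, of 0 ?q] False B(2)
      by (simp only: minus_mult_div_eq_mod if_False le0 simp_thms)
    from rem[OF mat_equiv_left[OF M B(1) unimodular_transpose[OF unimodular_clearing(1)]] this] i
    show ?thesis by (simp add: dvd_eq_mod_eq_0)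
  qed (use B in simp)
  define qr where "qr = (\<lambda>j. N $$ (0, j) div int k)"
  define qc where "qc = (\<lambda>i. N $$ (i, 0) div int k)"
  define Y where "Y = N * ?C qr"
  have Y: "Y \<in> ?E" unfolding Y_def by (rule mat_equiv_right[OF M N unimodular_clearing(1)])
  have Yij: "Y $$ (i, j) = N $$ (i, j) - (if j = 0 then 0 else N $$ (i, 0) * qr j)"
    if "i \<le> n" "j \<le> n" for i j
    unfolding Y_def by (rule unimodular_clearing(2)[OF carr[OF N]]) (use that in auto)
  define X where "X = transpose_mat (?C qc) * Y"
  have X: "X \<in> ?E" unfolding X_def by (rule mat_equiv_left[OF M Y unimodular_transpose[OF unimodular_clearing(1)]])
  have Xij: "X $$ (i, j) = Y $$ (i, j) - (if i = 0 then 0 else Y $$ (0, j) * qc i)"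
    if "i \<le> n" "j \<le> n" for i j
    unfolding X_def by (rule tC[OF carr[OF Y] that])
  have X00: "X $$ (0, 0) = int k" using N00 by (simp add: Xij Yij)
  have X0j: "X $$ (0, j) = 0" if "0 < j" "j \<le> n" for j
    using that N00 dvd_row[OF N N00, of j] by (simp add: Xij Yij qr_def)
  have Xi0: "X $$ (i, 0) = 0" if "0 < i" "i \<le> n" for i
    using that N00 dvd_col[OF N N00, of i] by (simp add: Xij Yij qc_def)
  have Xd: "int k dvd X $$ (i, j)" if ij: "i \<le> n" "j \<le> n" for i j
  proof (cases "i = 0")
    case True
    then show ?thesis using dvd_row[OF X X00] ij by simp
  next
    case False
    \<comment> \<open>Adding row \<open>i\<close> to row 0 keeps the pivot, as column 0 vanishes
      below it, and brings the entry (i, j) into row 0, where \<open>dvd_row\<close>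
      applies.\<close>
    define Z where "Z = addrow_mat ?n 1 0 i * X"
    have Z: "Z \<in> ?E" unfolding Z_def using False ij
      by (intro mat_equiv_left[OF M X] unimodular_addrow) auto
    have "Z = addrow 1 0 i X" unfolding Z_def using addrow_mat[OF carr[OF X]] ij by simp
    then have Z0: "Z $$ (0, j') = X $$ (i, j') + X $$ (0, j')" if "j' \<le> n" for j'
      using that ij carr[OF X] by simp
    have "Z $$ (0, 0) = int k" using Z0[of 0] Xi0[of i] X00 False ij by simp
    from dvd_row[OF Z this ij(2)] show ?thesis using Z0[OF ij(2)] X0j[of j] X00 Xi0[of i] False ij
      by (cases "j = 0") auto
  qed
  show thesis by (rule that[OF X _ X00 Xi0 X0j Xd]) (use k in auto)
qed

text \<open>Split off the minimal pivot and recurse on the remaining block. The divisibility chain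
  holds because the pivot divides all entries of the block, hence all entries of any matrix
  equivalent to it.\<close>

lemma smith_normal_form_exists:
  assumes "M \<in> carrier_mat n n" "det M \<noteq> 0"
  shows "\<exists>U V d. unimodular n U \<and> unimodular n V \<and> U * M * V = mat_diag n (\<lambda>i. int (d i)) \<and>
    (\<forall>i<n. 0 < d i) \<and> (\<forall>i. Suc i < n \<longrightarrow> d i dvd d (Suc i))"
  using assms
proof (induction n arbitrary: M)
  case 0
  then have "1\<^sub>m 0 * M * 1\<^sub>m 0 = mat_diag 0 (\<lambda>i. int (0::nat))" by (intro eq_matI) (auto simp: mat_diag_def)
  then show ?case using unimodular_one[of 0] by (intro exI[of _ "1\<^sub>m 0"] exI[of _ "\<lambda>_. 0"]) auto
next
  case (Suc n)
  let ?n = "Suc n"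
  have "\<exists>a b. a \<le> n \<and> b \<le> n \<and> M $$ (a, b) \<noteq> 0"
  proof (rule ccontr)
    assume "\<not> ?thesis"
    then have "(\<Sum>j<?n. M $$ (0, j) * cofactor M 0 j) = 0" by (intro sum.neutral) auto
    then show False using laplace_expansion_row[OF Suc.prems(1), of 0] Suc.prems(2) by simp
  qed
  then obtain a b where ab: "M $$ (a, b) \<noteq> 0" "a \<le> n" "b \<le> n" by blast
  obtain X g where X: "X \<in> mat_equiv ?n M" and g: "g > 0" "X $$ (0, 0) = g"
    and col0: "\<And>i. 0 < i \<Longrightarrow> i \<le> n \<Longrightarrow> X $$ (i, 0) = 0" and row0: "\<And>j. 0 < j \<Longrightarrow> j \<le> n \<Longrightarrow> X $$ (0, j) = 0"
    and dvd: "\<And>i j. i \<le> n \<Longrightarrow> j \<le> n \<Longrightarrow> g dvd X $$ (i, j)"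
    by (rule mat_equiv_minimal_pivot[OF Suc.prems(1) ab], rule that) blast+
  obtain U V where U: "unimodular ?n U" and V: "unimodular ?n V" and XUV: "X = U * M * V"
    using X by (auto simp: mat_equiv_def)
  define M' where "M' = mat n n (\<lambda>(i, j). X $$ (Suc i, Suc j))"
  have M': "M' \<in> carrier_mat n n" by (simp add: M'_def)
  have cX: "X \<in> carrier_mat ?n ?n" using mat_equiv_carrier[OF Suc.prems(1) X] .
  let ?g = "mat 1 1 (\<lambda>_. g)"
  have XB: "X = four_block_mat ?g (0\<^sub>m 1 n) (0\<^sub>m n 1) M'"
    by (rule eq_matI) (use cX g row0 col0 in \<open>auto simp: M'_def\<close>)
  have "det X = det ?g * det M'" unfolding XB
    by (rule det_four_block_mat_lower_left_zero[of _ 1 _ n]) (use M' in auto)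
  moreover have "det X \<noteq> 0" unfolding XUV using U V Suc.prems
    by (auto simp: unimodular_def det_mult)
  ultimately have "det M' \<noteq> 0" by auto
  from Suc.IH[OF M' this] obtain U' V' d where U': "unimodular n U'" and V': "unimodular n V'"
    and D: "U' * M' * V' = mat_diag n (\<lambda>i. int (d i))" and d: "\<And>i. i < n \<Longrightarrow> 0 < d i"
    "\<And>i. Suc i < n \<Longrightarrow> d i dvd d (Suc i)" by blast
  note c' = unimodular_carrier[OF U'] unimodular_carrier[OF V']
  let ?B = "\<lambda>U. four_block_mat (1\<^sub>m 1) (0\<^sub>m 1 n) (0\<^sub>m n 1) U"
  have uB: "unimodular ?n (?B K)" if "unimodular n K" for K
  proof -
    have "det (?B K) = det (1\<^sub>m 1) * det K"
      by (rule det_four_block_mat_lower_left_zero[of _ 1 _ n]) (use that in \<open>auto simp: unimodular_def\<close>)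
    moreover have "?B K \<in> carrier_mat (1 + n) (1 + n)"
      by (rule four_block_carrier_mat) (use that in \<open>auto simp: unimodular_def\<close>)
    ultimately show ?thesis using that by (auto simp: unimodular_def)
  qed
  have gc: "?g \<in> carrier_mat 1 1" by simp
  have "?B U' * X = four_block_mat ?g (0\<^sub>m 1 n) (0\<^sub>m n 1) (U' * M')" unfolding XB
    by (subst mult_four_block_mat[of _ 1 1 _ n _ n _ _ 1 _ n]) (use c' M' in auto)
  then have "?B U' * X * ?B V' = four_block_mat ?g (0\<^sub>m 1 n) (0\<^sub>m n 1) (U' * M' * V')"
    by (simp only:) (subst mult_four_block_mat[of _ 1 1 _ n _ n _ _ 1 _ n], use c' M' in auto)
  also have "\<dots> = mat_diag ?n (\<lambda>i. int (case i of 0 \<Rightarrow> nat g | Suc i \<Rightarrow> d i))"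
    unfolding D by (rule eq_matI) (use g in \<open>auto simp: mat_diag_def split: nat.splits\<close>)
  finally have eq: "?B U' * X * ?B V' = mat_diag ?n (\<lambda>i. int (case i of 0 \<Rightarrow> nat g | Suc i \<Rightarrow> d i))" .
  have "(P * U) * M * (V * Q) = P * X * Q" if "P \<in> carrier_mat ?n ?n" "Q \<in> carrier_mat ?n ?n" for P Q
    unfolding XUV using that unimodular_carrier[OF U] unimodular_carrier[OF V] Suc.prems(1)
    by (simp add: assoc_mult_mat[of _ ?n ?n _ ?n _ ?n])
  from this[OF unimodular_carrier[OF uB[OF U']] unimodular_carrier[OF uB[OF V']]]
  have eq': "(?B U' * U) * M * (V * ?B V') = mat_diag ?n (\<lambda>i. int (case i of 0 \<Rightarrow> nat g | Suc i \<Rightarrow> d i))"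
    unfolding eq .
  have g0: "nat g dvd d 0" if "0 < n"
  proof -
    have "int (d 0) = (U' * M' * V') $$ (0, 0)" unfolding D using that by (simp add: mat_diag_def)
    also have "\<dots> = (\<Sum>j<n. (\<Sum>i<n. U' $$ (0, i) * M' $$ (i, j)) * V' $$ (j, 0))"
      using mult_mat_entry[OF mult_carrier_mat[OF c'(1) M'] c'(2) that that] mult_mat_entry[OF c'(1) M' that]
      by simp
    finally have "g dvd int (d 0)"
      by (simp only:) (intro dvd_sum dvd_mult2 dvd_mult, use dvd in \<open>auto simp: M'_def\<close>)
    then show ?thesis using g by (metis int_dvd_int_iff int_nat_eq order_less_imp_le)
  qed
  let ?d = "\<lambda>i. case i of 0 \<Rightarrow> nat g | Suc i \<Rightarrow> d i"
  have "\<forall>i<?n. 0 < ?d i" using g d(1) by (auto split: nat.splits)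
  moreover have "?d i dvd ?d (Suc i)" if "Suc i < ?n" for i
    using that g0 d(2) by (cases i) auto
  ultimately show ?case
    using eq' unimodular_mult[OF uB[OF U'] U] unimodular_mult[OF V uB[OF V']] by blast
qed

lemma is_smith_diagonal_iff:
  assumes "M \<in> carrier_mat n n"
  shows "is_smith_diagonal M d \<longleftrightarrow>
    (\<exists>U V. unimodular n U \<and> unimodular n V \<and> U * M * V = mat_diag n (\<lambda>i. int (d (Suc i)))) \<and>
    (\<forall>k\<in>{1..n}. 0 < d k) \<and> (\<forall>k\<in>{1..<n}. d k dvd d (Suc k))"
proof -
  have "invertible_mat U \<and> U \<in> carrier_mat n n \<longleftrightarrow> unimodular n U" for U
    using invertible_mat_iff_unimodular[of U n] unimodular_carrier[of n U] by blast
  then have "(U \<in> carrier_mat n n \<and> V \<in> carrier_mat n n \<and> invertible_mat U \<and> invertible_mat V \<and> Q)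
      \<longleftrightarrow> (unimodular n U \<and> unimodular n V \<and> Q)" for U V Q
    by blast
  moreover have "dim_row M = n" using assms by simp
  ultimately show ?thesis unfolding is_smith_diagonal_def Let_def by (simp only:)
qed

text \<open>Existence makes the \<open>SOME\<close> in \<open>invariant_factor\<close> satisfy its
  own property; all later arguments use this chosen diagonal.\<close>

lemma is_smith_diagonal_invariant_factor:
  assumes M: "M \<in> carrier_mat n n" "det M \<noteq> 0"
  shows "is_smith_diagonal M (invariant_factor M)"
proof -
  obtain U V d where "unimodular n U" "unimodular n V" "U * M * V = mat_diag n (\<lambda>i. int (d i))"
    "\<forall>i<n. 0 < d i" "\<forall>i. Suc i < n \<longrightarrow> d i dvd d (Suc i)"
    using smith_normal_form_exists[OF M] by blast
  moreover have "d (k - 1) dvd d k" if "1 \<le> k" "k < n" for k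
    using that calculation(5) by (cases k) auto
  ultimately have "is_smith_diagonal M (\<lambda>k. d (k - 1))"
    unfolding is_smith_diagonal_iff[OF M(1)] by auto
  then have "is_smith_diagonal M (SOME d. is_smith_diagonal M d)" by (rule someI[of "is_smith_diagonal M"])
  moreover have "invariant_factor M = (SOME d. is_smith_diagonal M d)"
    by (rule ext) (simp add: invariant_factor_def)
  ultimately show ?thesis by simp
qed

subsection \<open>Polynomials in a matrix\<close>

text \<open>Horner evaluation of \<open>p\<close> at \<open>A\<close>. The size of a matrix is not
  part of its type, so the identity takes its size from \<open>A\<close>.\<close>

definition mat_poly :: "'a :: comm_ring_1 mat \<Rightarrow> 'a poly \<Rightarrow> 'a mat" where
  "mat_poly A p = fold_coeffs (\<lambda>a M. a \<cdot>\<^sub>m 1\<^sub>m (dim_row A) + A * M) p (0\<^sub>m (dim_row A) (dim_row A))"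

lemma dim_mat_poly [simp]: "dim_row (mat_poly A p) = dim_row A" "dim_col (mat_poly A p) = dim_row A"
proof -
  have "dim_row (mat_poly A p) = dim_row A \<and> dim_col (mat_poly A p) = dim_row A"
    by (induction p) (auto simp: mat_poly_def)
  then show "dim_row (mat_poly A p) = dim_row A" "dim_col (mat_poly A p) = dim_row A" by auto
qed

context
  fixes n :: nat and A :: "'a :: comm_ring_1 mat"
  assumes A: "A \<in> carrier_mat n n"
begin

lemma mat_poly_0 [simp]: "mat_poly A 0 = 0\<^sub>m n n"
  using A by (simp add: mat_poly_def)

lemma mat_poly_pCons [simp]: "mat_poly A (pCons a p) = a \<cdot>\<^sub>m 1\<^sub>m n + A * mat_poly A p"
proof (cases "p = 0 \<and> a = 0")
  case True
  then show ?thesis using A by (auto simp: mat_poly_def)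
next
  case False
  then show ?thesis using A by (auto simp: mat_poly_def)
qed

lemma mat_poly_carrier [simp]: "mat_poly A p \<in> carrier_mat n n"
  by (induction p) (use A in auto)

lemma mat_poly_add: "mat_poly A (p + q) = mat_poly A p + mat_poly A q"
proof (induction p q rule: poly_induct2)
  case (pCons a p b q)
  note c = mult_carrier_mat[OF A mat_poly_carrier[of p]] mult_carrier_mat[OF A mat_poly_carrier[of q]]
  have "mat_poly A (pCons a p + pCons b q) =
      (a + b) \<cdot>\<^sub>m 1\<^sub>m n + (A * mat_poly A p + A * mat_poly A q)"
    using pCons mult_add_distrib_mat[OF A mat_poly_carrier mat_poly_carrier] by simp
  also have "\<dots> = mat_poly A (pCons a p) + mat_poly A (pCons b q)"
    by (rule eq_matI) (use c in \<open>auto simp: algebra_simps simp del: index_mult_mat\<close>)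
  finally show ?case .
qed simp

lemma mat_poly_smult: "mat_poly A (Polynomial.smult c p) = c \<cdot>\<^sub>m mat_poly A p"
proof (induction p)
  case (pCons a p)
  note c = mult_carrier_mat[OF A mat_poly_carrier[of p]]
  have "mat_poly A (Polynomial.smult c (pCons a p)) = (c * a) \<cdot>\<^sub>m 1\<^sub>m n + c \<cdot>\<^sub>m (A * mat_poly A p)"
    using pCons mult_smult_distrib[OF A mat_poly_carrier] by simp
  also have "\<dots> = c \<cdot>\<^sub>m mat_poly A (pCons a p)"
    by (rule eq_matI) (use c in \<open>auto simp: algebra_simps simp del: index_mult_mat\<close>)
  finally show ?case .
qed simp

end

text \<open>Besides commutation of \<open>A\<close> with its own polynomials
  (\<open>P = A = B\<close>), this carries walks of one graph to walks of the other when
  \<open>P\<close> is a transposed level matrix.\<close>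

lemma mat_poly_mult_intertwine:
  assumes A: "A \<in> carrier_mat n n" and B: "B \<in> carrier_mat n n" and P: "P \<in> carrier_mat n n"
    and comm: "A * P = P * B"
  shows "mat_poly A p * P = P * mat_poly B p"
proof (induction p)
  case 0
  then show ?case using assms by simp
next
  case (pCons a p)
  let ?f = "mat_poly A p" and ?g = "mat_poly B p"
  have f: "?f \<in> carrier_mat n n" and g: "?g \<in> carrier_mat n n" using A B by auto
  have "mat_poly A (pCons a p) * P = a \<cdot>\<^sub>m P + A * (?f * P)"
    using A P f by (simp add: add_mult_distrib_mat[of _ n n] mult_smult_assoc_mat[of _ n n _ n] assoc_mult_mat[of _ n n _ n _ n])
  also have "A * (?f * P) = P * (B * ?g)"
    unfolding pCons.IH using A B P f g comm assoc_mult_mat[OF A P g] assoc_mult_mat[OF P B g] by simp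
  also have "a \<cdot>\<^sub>m P + P * (B * ?g) = P * mat_poly B (pCons a p)"
    using B P mult_add_distrib_mat[OF P _ mult_carrier_mat[OF B g], of "a \<cdot>\<^sub>m 1\<^sub>m n"]
      mult_smult_distrib[OF P one_carrier_mat, of a] by simp
  finally show ?case .
qed

context
  fixes n :: nat and A :: "'a :: comm_ring_1 mat"
  assumes A: "A \<in> carrier_mat n n"
begin

lemma mat_poly_commute: "mat_poly A p * A = A * mat_poly A p"
  by (rule mat_poly_mult_intertwine[OF A A A]) simp

lemma mat_poly_mult: "mat_poly A (p * q) = mat_poly A p * mat_poly A q"
proof (induction p)
  case 0
  then show ?case using A by (simp add: left_mult_zero_mat[OF mat_poly_carrier[OF A]])
next
  case (pCons a p)
  have c: "mat_poly A r \<in> carrier_mat n n" for r using A by simp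
  have "mat_poly A (pCons a p * q) = a \<cdot>\<^sub>m mat_poly A q + A * (mat_poly A p * mat_poly A q)"
  proof -
    have "0 \<cdot>\<^sub>m 1\<^sub>m n = (0\<^sub>m n n :: 'a mat)" by (rule eq_matI) auto
    moreover have "A * (mat_poly A p * mat_poly A q) \<in> carrier_mat n n" using mult_carrier_mat[OF A mult_carrier_mat[OF c c]] .
    ultimately show ?thesis using A pCons by (simp add: mat_poly_add mat_poly_smult)
  qed
  also have "\<dots> = mat_poly A (pCons a p) * mat_poly A q"
    using A add_mult_distrib_mat[OF smult_carrier_mat[OF one_carrier_mat] mult_carrier_mat[OF A c] c, of a p q]
      mult_smult_assoc_mat[OF one_carrier_mat c, of a q] assoc_mult_mat[OF A c c, of p q] by simp
  finally show ?case .
qed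

lemma mat_poly_transpose:
  assumes sym: "transpose_mat A = A"
  shows "transpose_mat (mat_poly A p) = mat_poly A p"
proof (induction p)
  case (pCons a p)
  have c: "mat_poly A p \<in> carrier_mat n n" using A by simp
  have "transpose_mat (mat_poly A (pCons a p)) =
      transpose_mat (a \<cdot>\<^sub>m 1\<^sub>m n) + transpose_mat (mat_poly A p) * transpose_mat A"
    using A c transpose_mult[OF A c] transpose_add[of "a \<cdot>\<^sub>m 1\<^sub>m n" n n "A * mat_poly A p"] by simp
  also have "transpose_mat (a \<cdot>\<^sub>m 1\<^sub>m n) = a \<cdot>\<^sub>m 1\<^sub>m n" by (rule eq_matI) auto
  finally show ?case using A pCons sym mat_poly_commute by simp
qed (use A in simp)

lemma pow_mat_Suc_left: "A ^\<^sub>m Suc k = A * A ^\<^sub>m k"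
proof (induction k)
  case (Suc k)
  have c: "A ^\<^sub>m k \<in> carrier_mat n n" using A by simp
  have "A ^\<^sub>m Suc (Suc k) = (A * A ^\<^sub>m k) * A" using Suc by simp
  then show ?case using assoc_mult_mat[OF A c A] by simp
qed (use A in simp)

lemma mat_poly_monom: "mat_poly A (monom 1 k) = A ^\<^sub>m k"
proof (induction k)
  case 0
  show ?case using A by (simp add: monom_0) (rule eq_matI, auto)
next
  case (Suc k)
  have "0 \<cdot>\<^sub>m 1\<^sub>m n = (0\<^sub>m n n :: 'a mat)" by (rule eq_matI) auto
  moreover have "A * A ^\<^sub>m k \<in> carrier_mat n n" using A by simp
  ultimately have "mat_poly A (monom 1 (Suc k)) = A * A ^\<^sub>m k"
    using A Suc by (simp add: monom_Suc)
  then show ?case unfolding pow_mat_Suc_left .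
qed

lemma mat_poly_mult_vec:
  assumes v: "v \<in> carrier_vec n" and "\<And>j. m \<le> j \<Longrightarrow> coeff p j = 0" and i: "i < n"
  shows "(mat_poly A p *\<^sub>v v) $ i = (\<Sum>j<m. coeff p j * (A ^\<^sub>m j *\<^sub>v v) $ i)"
  using assms(2) i
proof (induction p arbitrary: m i)
  case 0
  then show ?case using A v by (simp add: scalar_prod_def)
next
  case (pCons a p)
  have c: "mat_poly A p \<in> carrier_mat n n" using A by simp
  show ?case
  proof (cases m)
    case 0
    have "pCons a p = 0" using pCons.prems(1) 0 by (auto simp: poly_eq_iff)
    then show ?thesis using pCons.hyps by simp
  next
    case (Suc m')
    have IH: "(mat_poly A p *\<^sub>v v) $ l = (\<Sum>j<m'. coeff p j * (A ^\<^sub>m j *\<^sub>v v) $ l)" if "l < n" for l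
      by (rule pCons.IH) (use pCons.prems(1)[of "Suc _"] Suc that in auto)
    have "(a \<cdot>\<^sub>m 1\<^sub>m n) *\<^sub>v v = a \<cdot>\<^sub>v v" by (rule eq_vecI) (use v in auto)
    then have "mat_poly A (pCons a p) *\<^sub>v v = a \<cdot>\<^sub>v v + A *\<^sub>v (mat_poly A p *\<^sub>v v)"
      using A v c add_mult_distrib_mat_vec[of "a \<cdot>\<^sub>m 1\<^sub>m n" n n "A * mat_poly A p" v]
      by (simp add: assoc_mult_mat_vec[of _ n n _ n])
    then have "(mat_poly A (pCons a p) *\<^sub>v v) $ i = a * v $ i + (\<Sum>l<n. A $$ (i, l) * (mat_poly A p *\<^sub>v v) $ l)"
      using A v c pCons.prems(2) mult_mat_vec_entry[OF A mult_mat_vec_carrier[OF c v] pCons.prems(2)] by simp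
    also have "(\<Sum>l<n. A $$ (i, l) * (mat_poly A p *\<^sub>v v) $ l) =
        (\<Sum>l<n. \<Sum>j<m'. coeff p j * (A $$ (i, l) * (A ^\<^sub>m j *\<^sub>v v) $ l))"
      by (simp add: IH sum_distrib_left algebra_simps)
    also have "\<dots> = (\<Sum>j<m'. \<Sum>l<n. coeff p j * (A $$ (i, l) * (A ^\<^sub>m j *\<^sub>v v) $ l))"
      by (rule sum.swap)
    also have "\<dots> = (\<Sum>j<m'. coeff p j * (A ^\<^sub>m Suc j *\<^sub>v v) $ i)"
    proof (rule sum.cong[OF refl])
      fix j
      have Aj: "A ^\<^sub>m j \<in> carrier_mat n n" using A by simp
      have "A ^\<^sub>m Suc j *\<^sub>v v = A *\<^sub>v (A ^\<^sub>m j *\<^sub>v v)"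
        unfolding pow_mat_Suc_left by (rule assoc_mult_mat_vec[OF A Aj v])
      then show "(\<Sum>l<n. coeff p j * (A $$ (i, l) * (A ^\<^sub>m j *\<^sub>v v) $ l)) = coeff p j * (A ^\<^sub>m Suc j *\<^sub>v v) $ i"
        using mult_mat_vec_entry[OF A mult_mat_vec_carrier[OF Aj v] pCons.prems(2)]
        by (simp add: sum_distrib_left)
    qed
    also have "a * v $ i + (\<Sum>j<m'. coeff p j * (A ^\<^sub>m Suc j *\<^sub>v v) $ i) =
        (\<Sum>j<m. coeff (pCons a p) j * (A ^\<^sub>m j *\<^sub>v v) $ i)"
      using A v unfolding Suc sum.lessThan_Suc_shift by simp
    finally show ?thesis .
  qed
qed

end

section \<open>The adjugate of the characteristic matrix and the Cayley-Hamilton theorem\<close>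

text \<open>Compare coefficients of t^k in (t - A) adj(t - A) = \<phi>(t) I.\<close>

lemma coeff_adj_char_poly_matrix_rec:
  fixes A :: "'a :: comm_ring_1 mat"
  assumes A: "A \<in> carrier_mat n n" and rc: "r < n" "c < n"
  defines "X \<equiv> adj_mat (char_poly_matrix A)"
  shows "(\<Sum>l<n. A $$ (r, l) * coeff (X $$ (l, c)) k) + (if r = c then coeff (char_poly A) k else 0) =
    coeff (pCons 0 (X $$ (r, c))) k"
proof -
  let ?C = "char_poly_matrix A"
  have C: "?C \<in> carrier_mat n n" using A by simp
  note X = adj_mat[OF C, folded X_def]
  have "(?C * X) $$ (r, c) = (\<Sum>l<n. ?C $$ (r, l) * X $$ (l, c))"
    by (rule mult_mat_entry[OF C X(1) rc])
  also have "\<dots> = (\<Sum>l<n. (if l = r then pCons 0 (X $$ (r, c)) else 0) - Polynomial.smult (A $$ (r, l)) (X $$ (l, c)))"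
    using rc A by (intro sum.cong) (auto simp: char_poly_matrix_def algebra_simps)
  also have "\<dots> = pCons 0 (X $$ (r, c)) - (\<Sum>l<n. Polynomial.smult (A $$ (r, l)) (X $$ (l, c)))"
    using rc by (simp add: sum_subtractf)
  finally have "pCons 0 (X $$ (r, c)) - (\<Sum>l<n. Polynomial.smult (A $$ (r, l)) (X $$ (l, c))) =
      (if r = c then char_poly A else 0)"
    using X(2) rc by (auto simp: char_poly_def)
  then have "coeff (pCons 0 (X $$ (r, c))) k - (\<Sum>l<n. A $$ (r, l) * coeff (X $$ (l, c)) k) =
      (if r = c then coeff (char_poly A) k else 0)"
    by (auto simp: coeff_sum dest: arg_cong[of _ _ "\<lambda>p. coeff p k"])
  then show ?thesis by (simp add: algebra_simps)
qed

lemma poly_shift_Suc_pCons: "poly_shift k p = pCons (coeff p k) (poly_shift (Suc k) p)"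
  by (rule poly_eqI) (auto simp: coeff_poly_shift coeff_pCons split: nat.splits)

text \<open>Writing X_k for the coefficient of t^k in the adjugate, the recursion X_k = A X_(k+1) +
  \<phi>_(k+1) is Horner's rule for \<phi> with its lowest k + 1 coefficients removed.\<close>

lemma coeff_adj_char_poly_matrix:
  fixes A :: "'a :: comm_ring_1 mat"
  assumes A: "A \<in> carrier_mat n n" and rc: "r < n" "c < n"
  shows "coeff (adj_mat (char_poly_matrix A) $$ (r, c)) k =
    mat_poly A (poly_shift (Suc k) (char_poly A)) $$ (r, c)"
proof -
  let ?X = "adj_mat (char_poly_matrix A)" and ?\<phi> = "char_poly A"
  \<comment> \<open>A common degree bound for \<phi> and all entries of the adjugate; beyond it both
    sides vanish, and the induction descends from there.\<close>
  define N where "N = Max (insert (degree ?\<phi>) ((\<lambda>(i, j). degree (?X $$ (i, j))) ` ({..<n} \<times> {..<n})))"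
  have N: "degree ?\<phi> \<le> N" "\<And>i j. i < n \<Longrightarrow> j < n \<Longrightarrow> degree (?X $$ (i, j)) \<le> N"
    unfolding N_def by (auto intro!: Max_ge)
  have "\<forall>r<n. \<forall>c<n. coeff (?X $$ (r, c)) k = mat_poly A (poly_shift (Suc k) ?\<phi>) $$ (r, c)"
    if "k + d = Suc N" for d k
    using that
  proof (induction d arbitrary: k)
    case 0
    then have "poly_shift (Suc k) ?\<phi> = 0" using N(1) by (intro poly_eqI) (simp add: coeff_poly_shift coeff_eq_0)
    moreover have "coeff (?X $$ (r, c)) k = 0" if "r < n" "c < n" for r c
      using N(2)[OF that] 0 by (intro coeff_eq_0) auto
    ultimately show ?case using A by simp
  next
    case (Suc d)
    then have IH: "coeff (?X $$ (r, c)) (Suc k) = mat_poly A (poly_shift (Suc (Suc k)) ?\<phi>) $$ (r, c)"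
      if "r < n" "c < n" for r c using that by auto
    show ?case
    proof (intro allI impI)
      fix r c assume rc: "r < n" "c < n"
      have p: "mat_poly A (poly_shift (Suc (Suc k)) ?\<phi>) \<in> carrier_mat n n" using A by simp
      have "coeff (?X $$ (r, c)) k = (\<Sum>l<n. A $$ (r, l) * coeff (?X $$ (l, c)) (Suc k)) +
          (if r = c then coeff ?\<phi> (Suc k) else 0)"
        using coeff_adj_char_poly_matrix_rec[OF A rc, of "Suc k"] by simp
      also have "(\<Sum>l<n. A $$ (r, l) * coeff (?X $$ (l, c)) (Suc k)) =
          (A * mat_poly A (poly_shift (Suc (Suc k)) ?\<phi>)) $$ (r, c)"
        unfolding mult_mat_entry[OF A p rc] by (simp add: IH rc)
      finally show "coeff (?X $$ (r, c)) k = mat_poly A (poly_shift (Suc k) ?\<phi>) $$ (r, c)"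
        unfolding poly_shift_Suc_pCons[of "Suc k"] mat_poly_pCons[OF A]
        using A p rc by (simp del: index_mult_mat(1))
    qed
  qed
  from this[of k "Suc N - k"] show ?thesis
  proof (cases "k \<le> Suc N")
    case False
    then have "poly_shift (Suc k) ?\<phi> = 0" using N(1) by (intro poly_eqI) (simp add: coeff_poly_shift coeff_eq_0)
    moreover have "coeff (?X $$ (r, c)) k = 0"
      using N(2)[OF rc] False by (intro coeff_eq_0) auto
    ultimately show ?thesis using A rc by simp
  qed (use rc in auto)
qed

text \<open>The recursion at k = 0 says \<phi>_0 + A X_0 = 0, and by Horner's rule the left side is
  \<phi>(A).\<close>

theorem cayley_hamilton:
  fixes A :: "'a :: comm_ring_1 mat"
  assumes A: "A \<in> carrier_mat n n"
  shows "mat_poly A (char_poly A) = 0\<^sub>m n n"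
proof (rule eq_matI)
  let ?B = "mat_poly A (poly_shift (Suc 0) (char_poly A))"
  fix r c assume "r < dim_row (0\<^sub>m n n)" "c < dim_col (0\<^sub>m n n)"
  then have rc: "r < n" "c < n" by auto
  have B: "?B \<in> carrier_mat n n" using A by simp
  have "char_poly A = pCons (coeff (char_poly A) 0) (poly_shift (Suc 0) (char_poly A))"
    using poly_shift_Suc_pCons[of 0 "char_poly A"] by simp
  then have "mat_poly A (char_poly A) = coeff (char_poly A) 0 \<cdot>\<^sub>m 1\<^sub>m n + A * ?B"
    using mat_poly_pCons[OF A] by metis
  then have "mat_poly A (char_poly A) $$ (r, c) = (if r = c then coeff (char_poly A) 0 else 0) +
      (\<Sum>l<n. A $$ (r, l) * ?B $$ (l, c))"
    using mult_mat_entry[OF A B rc] A B rc by (simp del: index_mult_mat(1))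
  also have "\<dots> = 0"
    using coeff_adj_char_poly_matrix_rec[OF A rc, of 0] coeff_adj_char_poly_matrix[OF A _ rc(2), of _ 0]
    by (simp add: add.commute)
  finally show "mat_poly A (char_poly A) $$ (r, c) = 0\<^sub>m n n $$ (r, c)" using rc by simp
qed (use A in auto)

subsection \<open>Walk counts of generalized cospectral graphs\<close>

text \<open>Matrix determinant lemma, with the adjugate in place of the inverse. The bordered
  determinant of \<open>?P\<close> is computed twice: \<open>?P * ?Q\<close> shows that it is the
  left side, while \<open>?R * ?P\<close> clears the lower left block at the cost of a factor
  \<open>det M\<close>, which is then cancelled.\<close>

lemma det_rank_one_update:
  fixes M :: "'a :: idom mat"
  assumes M: "M \<in> carrier_mat n n" and u: "u \<in> carrier_mat n 1" and v: "v \<in> carrier_mat 1 n"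
    and d: "det M \<noteq> 0"
  shows "det (M + u * v) = det M + (v * adj_mat M * u) $$ (0, 0)"
proof -
  note a = adj_mat[OF M]
  let ?P = "four_block_mat M u (- v) (1\<^sub>m 1)"
  let ?Q = "four_block_mat (1\<^sub>m n) (0\<^sub>m n 1) v (1\<^sub>m 1)"
  let ?R = "four_block_mat (1\<^sub>m n) (0\<^sub>m n 1) (v * adj_mat M) (det M \<cdot>\<^sub>m 1\<^sub>m 1)"
  have P: "?P \<in> carrier_mat (n + 1) (n + 1)" and Q: "?Q \<in> carrier_mat (n + 1) (n + 1)"
    and R: "?R \<in> carrier_mat (n + 1) (n + 1)"
    using M by (auto intro!: four_block_carrier_mat)
  have uv: "u * v \<in> carrier_mat n n" using u v by simp
  have "?P * ?Q = four_block_mat (M + u * v) u (0\<^sub>m 1 n) (1\<^sub>m 1)"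
    by (subst mult_four_block_mat[of _ n n _ 1 _ 1 _ _ n _ 1]) (use M u v in auto)
  moreover have "det (four_block_mat (M + u * v) u (0\<^sub>m 1 n) (1\<^sub>m 1)) = det (M + u * v)"
    by (subst det_four_block_mat_lower_left_zero[of _ n _ 1]) (use M u v in auto)
  moreover have "det ?Q = 1"
    by (subst det_four_block_mat_upper_right_zero[of _ n _ 1]) (use v in auto)
  ultimately have 1: "det ?P = det (M + u * v)" using det_mult[OF P Q] by simp
  have va: "v * adj_mat M \<in> carrier_mat 1 n" using v a by simp
  have vm: "v * adj_mat M * M = det M \<cdot>\<^sub>m v"
    using assoc_mult_mat[OF v a(1) M] a(3) mult_smult_distrib[OF v, of "1\<^sub>m n" n "det M"] v by simp
  have "?R * ?P = four_block_mat M u (v * adj_mat M * M + det M \<cdot>\<^sub>m (- v)) (v * adj_mat M * u + det M \<cdot>\<^sub>m 1\<^sub>m 1)"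
    by (subst mult_four_block_mat[of _ n n _ 1 _ 1 _ _ n _ 1])
      (use M u v va in \<open>auto simp: mult_smult_assoc_mat[of _ 1 1 _ n]\<close>)
  also have "v * adj_mat M * M + det M \<cdot>\<^sub>m (- v) = 0\<^sub>m 1 n"
    unfolding vm by (rule eq_matI) (use v in auto)
  finally have "det (?R * ?P) = det M * det (v * adj_mat M * u + det M \<cdot>\<^sub>m 1\<^sub>m 1)"
    by (simp only:) (rule det_four_block_mat_lower_left_zero, use M u v va in auto)
  moreover have "det ?R = det M"
    by (subst det_four_block_mat_upper_right_zero[of _ n _ 1]) (use va in auto)
  moreover have "det (v * adj_mat M * u + det M \<cdot>\<^sub>m 1\<^sub>m 1) = (v * adj_mat M * u) $$ (0, 0) + det M"
    by (subst det_single) (use u va in auto)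
  ultimately have "det M * det ?P = det M * ((v * adj_mat M * u) $$ (0, 0) + det M)"
    using det_mult[OF R P] by (simp only:)
  then have "det ?P = (v * adj_mat M * u) $$ (0, 0) + det M" using d by (simp only: mult_cancel_left) simp
  then show ?thesis unfolding 1 by (simp only: add.commute)
qed

lemma sum_mat_lessThan: "A \<in> carrier_mat n m \<Longrightarrow> sum_mat A = (\<Sum>i<n. \<Sum>j<m. A $$ (i, j))"
  by (simp add: sum_mat_def sum.cartesian_product atLeast0LessThan)

lemma sum_mat_smult: "A \<in> carrier_mat n m \<Longrightarrow> sum_mat (c \<cdot>\<^sub>m A) = c * sum_mat (A :: 'a :: comm_ring_1 mat)"
  by (simp add: sum_mat_lessThan[of _ n m] sum_distrib_left)

text \<open>With J the all-ones matrix, t - (A - J) is the rank-one update of t - A by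
  \<open>e e^T\<close>. The added term is \<open>e^T adj(t - A) e\<close>, whose coefficients are
  walk counts.\<close>

lemma char_poly_minus_ones:
  fixes A :: "'a :: idom mat"
  assumes A: "A \<in> carrier_mat n n"
  shows "char_poly (A - mat n n (\<lambda>_. 1)) = char_poly A + sum_mat (adj_mat (char_poly_matrix A))"
proof -
  let ?u = "mat n 1 (\<lambda>_. 1 :: 'a poly)" and ?v = "mat 1 n (\<lambda>_. 1 :: 'a poly)"
  let ?M = "char_poly_matrix A"
  have M: "?M \<in> carrier_mat n n" using A by simp
  note a = adj_mat[OF M]
  have uv: "?u * ?v = mat n n (\<lambda>_. 1)" by (rule eq_matI) (auto simp: scalar_prod_def)
  have cm: "char_poly_matrix (A - mat n n (\<lambda>_. 1)) = ?M + ?u * ?v"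
    unfolding uv by (rule eq_matI) (use A in \<open>auto simp: char_poly_matrix_def one_pCons\<close>)
  have d: "det ?M \<noteq> 0" using degree_monic_char_poly[OF A] unfolding char_poly_def by auto
  have "(?v * adj_mat ?M * ?u) $$ (0, 0) = (\<Sum>j<n. (\<Sum>i<n. adj_mat ?M $$ (i, j)))"
    using mult_mat_entry[OF mult_carrier_mat[OF _ a(1)], of ?v 1 ?u 1 0 0] mult_mat_entry[OF _ a(1), of ?v 1 0]
    by simp
  also have "\<dots> = sum_mat (adj_mat ?M)" unfolding sum_mat_lessThan[OF a(1)] by (rule sum.swap)
  finally show ?thesis unfolding char_poly_def cm
    using det_rank_one_update[OF M _ _ d, of ?u ?v] by simp
qed

text \<open>\<open>sum_mat (mat_poly A f)\<close> is \<open>e^T f(A) e\<close>. The coefficients of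
  \<open>e^T adj(t - A) e\<close> give equality for the shifts of \<phi>, which are monic of every
  degree below n; from degree n on, multiples of \<phi> vanish at both matrices. Monic polynomials
  of all degrees span everything.\<close>

lemma sum_mat_mat_poly_eqI:
  fixes A B :: "'a :: idom mat"
  assumes A: "A \<in> carrier_mat n n" and B: "B \<in> carrier_mat n n"
    and cp: "char_poly A = char_poly B"
    and cp': "char_poly (A - mat n n (\<lambda>_. 1)) = char_poly (B - mat n n (\<lambda>_. 1))"
  shows "sum_mat (mat_poly A f) = sum_mat (mat_poly B f)"
proof -
  let ?\<phi> = "char_poly B"
  have deg: "degree ?\<phi> = n" "coeff ?\<phi> n = 1" using degree_monic_char_poly[OF B] by auto
  have adj: "coeff (sum_mat (adj_mat (char_poly_matrix C))) k = sum_mat (mat_poly C (poly_shift (Suc k) (char_poly C)))"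
    if C: "C \<in> carrier_mat n n" for C :: "'a mat" and k
  proof -
    have M: "char_poly_matrix C \<in> carrier_mat n n" using C by simp
    show ?thesis
      using C by (simp add: sum_mat_lessThan[OF adj_mat(1)[OF M]] sum_mat_lessThan[OF mat_poly_carrier[OF C]]
        coeff_sum coeff_adj_char_poly_matrix)
  qed
  have "sum_mat (adj_mat (char_poly_matrix A)) = sum_mat (adj_mat (char_poly_matrix B))"
    using cp' unfolding char_poly_minus_ones[OF A] char_poly_minus_ones[OF B] cp by simp
  then have sh: "sum_mat (mat_poly A (poly_shift (Suc k) ?\<phi>)) = sum_mat (mat_poly B (poly_shift (Suc k) ?\<phi>))" for k
    using adj[OF A, of k] adj[OF B, of k] cp by simp
  have monic: "\<exists>g. sum_mat (mat_poly A g) = sum_mat (mat_poly B g) \<and> coeff g d = 1 \<and> (\<forall>i>d. coeff g i = 0)" for d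
  proof (cases "d < n")
    case True
    \<comment> \<open>Shifting \<phi> by n - d leaves degree d and keeps the leading coefficient
      1.\<close>
    have "coeff (poly_shift (Suc (n - 1 - d)) ?\<phi>) d = 1" "\<forall>i>d. coeff (poly_shift (Suc (n - 1 - d)) ?\<phi>) i = 0"
      using True deg by (auto simp: coeff_poly_shift intro!: coeff_eq_0)
    then show ?thesis using sh by blast
  next
    case False
    let ?g = "?\<phi> * monom 1 (d - n)"
    have "mat_poly C (char_poly C * monom 1 (d - n)) = 0\<^sub>m n n" if "C \<in> carrier_mat n n" for C :: "'a mat"
      using that by (simp add: mat_poly_mult cayley_hamilton left_mult_zero_mat[OF mat_poly_carrier[OF that]])
    from this[OF A] this[OF B] cp have "sum_mat (mat_poly A ?g) = sum_mat (mat_poly B ?g)" by simp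
    moreover have "coeff ?g i = (if d - n \<le> i then coeff ?\<phi> (i - (d - n)) else 0)" for i
      by (simp add: mult.commute[of ?\<phi>] coeff_monom_mult)
    ultimately show ?thesis using False deg by (intro exI[of _ ?g]) (auto intro!: coeff_eq_0)
  qed
  have "sum_mat (mat_poly A f) = sum_mat (mat_poly B f)" if "\<forall>i\<ge>d. coeff f i = 0" for d f
    using that
  proof (induction d arbitrary: f)
    case 0
    then have "f = 0" by (simp add: poly_eq_iff)
    then show ?case using A B by simp
  next
    case (Suc d)
    obtain g where g: "sum_mat (mat_poly A g) = sum_mat (mat_poly B g)" "coeff g d = 1" "\<forall>i>d. coeff g i = 0"
      using monic by blast
    let ?c = "coeff f d" and ?h = "f - Polynomial.smult (coeff f d) g"
    have "coeff ?h i = 0" if "i \<ge> d" for i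
      using that Suc.prems g by (cases "i = d") auto
    then have h: "sum_mat (mat_poly A ?h) = sum_mat (mat_poly B ?h)" using Suc.IH by blast
    have "sum_mat (mat_poly C f) = sum_mat (mat_poly C ?h) + ?c * sum_mat (mat_poly C g)"
      if C: "C \<in> carrier_mat n n" for C :: "'a mat"
    proof -
      have "mat_poly C f = mat_poly C (?h + Polynomial.smult ?c g)" by simp
      also have "\<dots> = mat_poly C ?h + ?c \<cdot>\<^sub>m mat_poly C g"
        unfolding mat_poly_add[OF C] mat_poly_smult[OF C] ..
      finally show ?thesis
        using C sum_mat_add[of "mat_poly C ?h" n n "?c \<cdot>\<^sub>m mat_poly C g"] sum_mat_smult[of "mat_poly C g" n n ?c]
        by simp
    qed
    then show ?case using A B h g(1) by simp
  qed
  from this[of "Suc (degree f)" f] show ?thesis by (simp add: coeff_eq_0)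
qed

subsection \<open>Rational orthogonal matrices as primitive integer matrices\<close>

lemma smult_mat_cancel:
  fixes X Y :: "int mat"
  assumes "c \<cdot>\<^sub>m X = c \<cdot>\<^sub>m Y" "c \<noteq> 0" "X \<in> carrier_mat n m" "Y \<in> carrier_mat n m"
  shows "X = Y"
proof (rule eq_matI)
  fix i j assume ij: "i < dim_row Y" "j < dim_col Y"
  have "(c \<cdot>\<^sub>m X) $$ (i, j) = (c \<cdot>\<^sub>m Y) $$ (i, j)" using assms(1) by simp
  then have "c * X $$ (i, j) = c * Y $$ (i, j)" using assms(3,4) ij by simp
  then show "X $$ (i, j) = Y $$ (i, j)" using assms(2) by simp
qed (use assms in auto)

lemma mult_mat_left_cancel:
  fixes P :: "int mat"
  assumes eq: "P * X = P * Y" and P: "P \<in> carrier_mat n n" and d: "det P \<noteq> 0"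
    and X: "X \<in> carrier_mat n m" and Y: "Y \<in> carrier_mat n m"
  shows "X = Y"
proof -
  note a = adj_mat[OF P]
  have "det P \<cdot>\<^sub>m Z = adj_mat P * (P * Z)" if Z: "Z \<in> carrier_mat n m" for Z
    using assoc_mult_mat[OF a(1) P Z] a(3) mult_smult_assoc_mat[OF one_carrier_mat Z, of "det P"] Z by simp
  from this[OF X] this[OF Y] eq have "det P \<cdot>\<^sub>m X = det P \<cdot>\<^sub>m Y" by simp
  from smult_mat_cancel[OF this d X Y] show ?thesis .
qed

section \<open>Walk matrices in a polynomial basis\<close>

definition poly_walk :: "nat \<Rightarrow> int mat \<Rightarrow> (nat \<Rightarrow> int poly) \<Rightarrow> int mat" where
  "poly_walk n A b = mat n n (\<lambda>(i, j). (mat_poly A (b j) *\<^sub>v all_ones n) $ i)"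

lemma poly_walk_carrier [simp]: "poly_walk n A b \<in> carrier_mat n n"
  and dim_poly_walk [simp]: "dim_row (poly_walk n A b) = n" "dim_col (poly_walk n A b) = n"
  by (simp_all add: poly_walk_def)

lemma all_ones_carrier [simp]: "all_ones n \<in> carrier_vec n"
  by (simp add: all_ones_def)

lemma index_all_ones [simp]: "i < n \<Longrightarrow> all_ones n $ i = 1" "dim_vec (all_ones n) = n"
  by (simp_all add: all_ones_def)

lemma mult_all_ones_entry:
  "M \<in> carrier_mat n n \<Longrightarrow> i < n \<Longrightarrow> (M *\<^sub>v all_ones n) $ i = (\<Sum>j<n. M $$ (i, j))"
  by (subst mult_mat_vec_entry[of M n n]) auto

context
  fixes n :: nat and A :: "int mat"
  assumes A: "A \<in> carrier_mat n n"
begin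

lemma poly_walk_entry:
  "i < n \<Longrightarrow> j < n \<Longrightarrow> poly_walk n A b $$ (i, j) = (\<Sum>k<n. mat_poly A (b j) $$ (i, k))"
  using mult_all_ones_entry[of "mat_poly A (b j)" n i] A by (simp add: poly_walk_def)

text \<open>The coefficient matrix of a monic basis is unitriangular. Its determinant is 1 and not
  just a unit, so the determinant of the walk matrix is preserved including its sign.\<close>

lemma poly_walk_eq_mult_monic:
  assumes "\<And>j. j < n \<Longrightarrow> coeff (b j) j = 1" "\<And>i j. j < n \<Longrightarrow> j < i \<Longrightarrow> coeff (b j) i = 0"
  obtains T where "unimodular n T" "poly_walk n A b = poly_walk n A (monom 1) * T" "det T = 1"
proof -
  define T where "T = mat n n (\<lambda>(i, j). coeff (b j) i)"
  have T: "T \<in> carrier_mat n n" by (simp add: T_def)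
  have "upper_triangular T" using assms by (auto simp: T_def)
  then have "det T = prod_list (diag_mat T)" using T by (rule det_upper_triangular)
  then have dT: "det T = 1" using assms(1) by (simp add: prod_list_diag_prod T_def)
  have "poly_walk n A b = poly_walk n A (monom 1) * T"
  proof (rule eq_matI)
    fix i j assume "i < dim_row (poly_walk n A (monom 1) * T)" "j < dim_col (poly_walk n A (monom 1) * T)"
    then have ij: "i < n" "j < n" using T by auto
    have "poly_walk n A b $$ (i, j) = (mat_poly A (b j) *\<^sub>v all_ones n) $ i"
      using ij by (simp add: poly_walk_def)
    also have "\<dots> = (\<Sum>l<n. coeff (b j) l * (A ^\<^sub>m l *\<^sub>v all_ones n) $ i)"
      by (rule mat_poly_mult_vec[OF A _ _ ij(1)]) (use assms ij in auto)
    also have "\<dots> = (poly_walk n A (monom 1) * T) $$ (i, j)"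
      unfolding mult_mat_entry[OF poly_walk_carrier T ij]
      using ij A by (intro sum.cong) (auto simp: poly_walk_def T_def mat_poly_monom[OF A])
    finally show "poly_walk n A b $$ (i, j) = (poly_walk n A (monom 1) * T) $$ (i, j)" .
  qed (use T in auto)
  with that T dT show thesis by (auto simp: unimodular_def)
qed

lemma poly_walk_mult_left: "A * poly_walk n A b = poly_walk n A (\<lambda>j. pCons 0 (b j))"
proof (rule eq_matI)
  fix i j assume "i < dim_row (poly_walk n A (\<lambda>j. pCons 0 (b j)))" "j < dim_col (poly_walk n A (\<lambda>j. pCons 0 (b j)))"
  then have ij: "i < n" "j < n" by (auto simp: poly_walk_def)
  have B: "mat_poly A (b j) \<in> carrier_mat n n" using A by simp
  have "(A * poly_walk n A b) $$ (i, j) = (\<Sum>k<n. \<Sum>l<n. A $$ (i, k) * mat_poly A (b j) $$ (k, l))"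
    unfolding mult_mat_entry[OF A poly_walk_carrier ij] using ij
    by (simp add: poly_walk_entry sum_distrib_left)
  also have "\<dots> = (\<Sum>l<n. \<Sum>k<n. A $$ (i, k) * mat_poly A (b j) $$ (k, l))" by (rule sum.swap)
  also have "\<dots> = (\<Sum>l<n. mat_poly A (pCons 0 (b j)) $$ (i, l))"
    using A ij by (intro sum.cong) (auto simp: mult_mat_entry[OF A B ij(1)] simp del: index_mult_mat(1))
  also have "\<dots> = poly_walk n A (\<lambda>j. pCons 0 (b j)) $$ (i, j)" using ij by (simp add: poly_walk_entry)
  finally show "(A * poly_walk n A b) $$ (i, j) = poly_walk n A (\<lambda>j. pCons 0 (b j)) $$ (i, j)" .
qed (use A in \<open>auto simp: poly_walk_def\<close>)

text \<open>By symmetry of \<open>A\<close> the entries are \<open>e^T b_i(A) c_j(A) e\<close>, so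
  the Gram matrix depends on the walk counts alone and is the same for cospectral partners.\<close>

lemma poly_walk_gram:
  assumes sym: "transpose_mat A = A"
  shows "transpose_mat (poly_walk n A b) * poly_walk n A c = mat n n (\<lambda>(i, j). sum_mat (mat_poly A (b i * c j)))"
proof (rule eq_matI)
  fix i j assume "i < dim_row (mat n n (\<lambda>(i, j). sum_mat (mat_poly A (b i * c j))))"
    "j < dim_col (mat n n (\<lambda>(i, j). sum_mat (mat_poly A (b i * c j))))"
  then have ij: "i < n" "j < n" by auto
  let ?F = "mat_poly A (b i)" and ?G = "mat_poly A (c j)"
  have F: "?F \<in> carrier_mat n n" and G: "?G \<in> carrier_mat n n" using A by auto
  have Fsym: "?F $$ (k, l) = ?F $$ (l, k)" if "k < n" "l < n" for k l
    using arg_cong[OF mat_poly_transpose[OF A sym, of "b i"], of "\<lambda>M. M $$ (l, k)"] that A by simp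
  have "(transpose_mat (poly_walk n A b) * poly_walk n A c) $$ (i, j)
      = (\<Sum>k<n. poly_walk n A b $$ (k, i) * poly_walk n A c $$ (k, j))"
    using mult_mat_entry[of "transpose_mat (poly_walk n A b)" n n "poly_walk n A c" n i j] ij
    by (simp add: poly_walk_def)
  also have "\<dots> = (\<Sum>k<n. \<Sum>r<n. \<Sum>s<n. ?F $$ (r, k) * ?G $$ (k, s))"
    using ij Fsym by (simp add: poly_walk_entry sum_product)
  also have "\<dots> = (\<Sum>r<n. \<Sum>k<n. \<Sum>s<n. ?F $$ (r, k) * ?G $$ (k, s))" by (rule sum.swap)
  also have "\<dots> = (\<Sum>r<n. \<Sum>s<n. \<Sum>k<n. ?F $$ (r, k) * ?G $$ (k, s))"
    by (intro sum.cong refl sum.swap)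
  also have "\<dots> = (\<Sum>r<n. \<Sum>s<n. (?F * ?G) $$ (r, s))"
    by (intro sum.cong refl) (auto simp: mult_mat_entry[OF F G] simp del: index_mult_mat(1))
  also have "\<dots> = sum_mat (?F * ?G)" using sum_mat_lessThan[of "?F * ?G" n n] F G by simp
  also have "?F * ?G = mat_poly A (b i * c j)" by (simp add: mat_poly_mult[OF A])
  finally show "(transpose_mat (poly_walk n A b) * poly_walk n A c) $$ (i, j)
      = mat n n (\<lambda>(i, j). sum_mat (mat_poly A (b i * c j))) $$ (i, j)" using ij by simp
qed auto

end

text \<open>\<open>P\<close> is \<open>l Q\<close> for the rational orthogonal matrix \<open>Q\<close> of level \<open>l\<close> with
  \<open>Q e = e\<close> and \<open>A Q = Q B\<close>.\<close>

definition level_matrix :: "nat \<Rightarrow> int mat \<Rightarrow> int mat \<Rightarrow> int \<Rightarrow> int mat \<Rightarrow> bool" where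
  "level_matrix n A B l P \<longleftrightarrow> P \<in> carrier_mat n n \<and> 0 < l \<and>
     transpose_mat P * P = (l * l) \<cdot>\<^sub>m 1\<^sub>m n \<and> P * transpose_mat P = (l * l) \<cdot>\<^sub>m 1\<^sub>m n \<and>
     A * P = P * B \<and> P *\<^sub>v all_ones n = l \<cdot>\<^sub>v all_ones n \<and> transpose_mat P *\<^sub>v all_ones n = l \<cdot>\<^sub>v all_ones n \<and>
     (\<forall>d. d dvd l \<longrightarrow> (\<forall>i<n. \<forall>j<n. d dvd P $$ (i, j)) \<longrightarrow> is_unit d)"

text \<open>For walk matrices W of \<open>A\<close> and V of \<open>B\<close> put Q = W V^{-1}.
  Equality of W^T W and V^T V makes Q orthogonal, equality of W^T A W and V^T B V gives A Q = Q B,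
  and Q e = e because e is the first column of both. \<open>P0\<close> is Q times det V.\<close>

lemma level_matrix_exists:
  assumes A: "A \<in> carrier_mat n n" and B: "B \<in> carrier_mat n n" and n: "0 < n"
    and symA: "transpose_mat A = A" and symB: "transpose_mat B = B"
    and eq: "\<And>f. sum_mat (mat_poly A f) = sum_mat (mat_poly B f)"
    and d: "det (poly_walk n A (monom 1)) \<noteq> 0"
  obtains l P where "level_matrix n A B l P"
proof -
  define W where "W = poly_walk n A (monom 1)"
  define V where "V = poly_walk n B (monom 1)"
  have W: "W \<in> carrier_mat n n" and V: "V \<in> carrier_mat n n" by (auto simp: W_def V_def)
  have Wt: "transpose_mat W \<in> carrier_mat n n" and Vt: "transpose_mat V \<in> carrier_mat n n" using W V by auto
  have G: "transpose_mat W * W = transpose_mat V * V"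
    by (simp add: W_def V_def poly_walk_gram[OF A symA] poly_walk_gram[OF B symB] eq)
  have GA: "transpose_mat W * (A * W) = transpose_mat V * (B * V)"
    by (simp add: W_def V_def poly_walk_mult_left[OF A] poly_walk_mult_left[OF B] poly_walk_gram[OF A symA] poly_walk_gram[OF B symB] eq)
  have "det W * det W = det V * det V"
    using arg_cong[OF G, of det] W V by (simp add: det_mult[of _ n] det_transpose[of _ n])
  with d have dV: "det V \<noteq> 0" by (auto simp: W_def)
  define \<delta> where "\<delta> = det V"
  define P0 where "P0 = W * adj_mat V"
  note a = adj_mat[OF V, folded \<delta>_def]
  have P0: "P0 \<in> carrier_mat n n" unfolding P0_def by (rule mult_carrier_mat[OF W a(1)])
  have P0t: "transpose_mat P0 \<in> carrier_mat n n" using P0 by simp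
  have at: "transpose_mat (adj_mat V) \<in> carrier_mat n n" using a by simp
  have \<delta>: "\<delta> \<noteq> 0" using dV by (simp add: \<delta>_def)
  have t1: "transpose_mat (\<delta> \<cdot>\<^sub>m 1\<^sub>m n) = \<delta> \<cdot>\<^sub>m 1\<^sub>m n" by (rule eq_matI) auto
  have P0P0: "transpose_mat P0 * P0 = (\<delta> * \<delta>) \<cdot>\<^sub>m 1\<^sub>m n"
  proof -
    have "transpose_mat P0 * P0 = transpose_mat (adj_mat V) * ((transpose_mat W * W) * adj_mat V)"
      unfolding P0_def transpose_mult[OF W a(1)] using W Wt a(1) at
      by (simp add: assoc_mult_mat[of _ n n _ n _ n])
    also have "\<dots> = transpose_mat (V * adj_mat V) * (V * adj_mat V)"
      unfolding G transpose_mult[OF V a(1)] using V Vt a(1) at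
      by (simp add: assoc_mult_mat[of _ n n _ n _ n])
    also have "\<dots> = (\<delta> * \<delta>) \<cdot>\<^sub>m 1\<^sub>m n"
      unfolding a(2) t1 by (rule eq_matI) (auto simp: mult_smult_distrib[of _ n n _ n] mult_smult_assoc_mat[of _ n n _ n])
    finally show ?thesis .
  qed
  have dP0: "det P0 \<noteq> 0"
    using arg_cong[OF P0P0, of det] \<delta> P0 by (auto simp: det_mult[of _ n])
  have P0P0': "P0 * transpose_mat P0 = (\<delta> * \<delta>) \<cdot>\<^sub>m 1\<^sub>m n"
  proof (rule mult_mat_left_cancel[of "transpose_mat P0"])
    have "transpose_mat P0 * (P0 * transpose_mat P0) = (transpose_mat P0 * P0) * transpose_mat P0"
      by (rule assoc_mult_mat[OF P0t P0 P0t, symmetric])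
    also have "\<dots> = transpose_mat P0 * ((\<delta> * \<delta>) \<cdot>\<^sub>m 1\<^sub>m n)"
      unfolding P0P0 using P0t
      by (simp add: mult_smult_distrib[OF P0t one_carrier_mat] mult_smult_assoc_mat[OF one_carrier_mat P0t])
    finally show "transpose_mat P0 * (P0 * transpose_mat P0) = transpose_mat P0 * ((\<delta> * \<delta>) \<cdot>\<^sub>m 1\<^sub>m n)" .
  qed (use P0 P0t dP0 in \<open>auto simp: det_transpose\<close>)
  have AP0: "A * P0 = P0 * B"
  proof (rule mult_mat_left_cancel[of "transpose_mat W"])
    have "transpose_mat W * (A * P0) = (transpose_mat W * (A * W)) * adj_mat V"
      unfolding P0_def using A W Wt a(1) by (simp add: assoc_mult_mat[of _ n n _ n _ n])
    also have "\<dots> = transpose_mat V * (B * (V * adj_mat V))"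
      unfolding GA using B V Vt a(1) by (simp add: assoc_mult_mat[of _ n n _ n _ n])
    also have "\<dots> = transpose_mat V * (V * adj_mat V) * B"
      unfolding a(2) using B Vt mult_carrier_mat[OF Vt B]
      by (simp add: mult_smult_distrib[of _ n n _ n] mult_smult_assoc_mat[of _ n n _ n])
    also have "\<dots> = (transpose_mat V * V) * adj_mat V * B"
      using B V Vt a(1) by (simp add: assoc_mult_mat[of _ n n _ n _ n])
    also have "\<dots> = transpose_mat W * (P0 * B)"
      unfolding G[symmetric] P0_def using B W Wt a(1) by (simp add: assoc_mult_mat[of _ n n _ n _ n])
    finally show "transpose_mat W * (A * P0) = transpose_mat W * (P0 * B)" .
  qed (use A B P0 W d in \<open>auto simp: det_transpose[OF W] W_def[symmetric]\<close>)
  have col0: "col (poly_walk n C (monom 1)) 0 = all_ones n" if C: "C \<in> carrier_mat n n" for C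
  proof -
    have "mat_poly C (monom 1 0) = 1\<^sub>m n" using C by (subst mat_poly_monom[OF C]) simp
    then show ?thesis using n by (intro eq_vecI) (auto simp: poly_walk_def)
  qed
  have P0V: "P0 * V = \<delta> \<cdot>\<^sub>m W"
    unfolding P0_def assoc_mult_mat[OF W a(1) V] a(3) using W by (simp add: mult_smult_distrib[OF W one_carrier_mat])
  have P0e: "P0 *\<^sub>v all_ones n = \<delta> \<cdot>\<^sub>v all_ones n"
  proof -
    have "P0 *\<^sub>v all_ones n = col (P0 * V) 0"
      using n col_mult2[OF P0 V n] col0[OF B] V by (simp add: V_def[symmetric])
    also have "\<dots> = \<delta> \<cdot>\<^sub>v all_ones n" unfolding P0V using n col0[OF A] W by (simp add: W_def[symmetric])
    finally show ?thesis .
  qed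
  \<comment> \<open>Dividing by the gcd of \<open>\<delta>\<close> and all entries makes the pair of
    denominator and matrix primitive.\<close>
  define g where "g = Gcd (insert \<delta> {P0 $$ (i, j) | i j. i < n \<and> j < n})"
  have gd: "g dvd \<delta>" "\<And>i j. i < n \<Longrightarrow> j < n \<Longrightarrow> g dvd P0 $$ (i, j)"
  proof -
    show "g dvd \<delta>" unfolding g_def by (rule Gcd_dvd) simp
    show "g dvd P0 $$ (i, j)" if "i < n" "j < n" for i j
      unfolding g_def by (rule Gcd_dvd) (use that in blast)
  qed
  have g0: "g \<noteq> 0" using gd(1) \<delta> by auto
  \<comment> \<open>The determinant \<open>\<delta>\<close> may be negative; giving \<open>c\<close>
    its sign makes \<open>l\<close> positive.\<close>
  define c where "c = g * sgn \<delta>"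
  define l where "l = \<delta> div c"
  define P where "P = mat n n (\<lambda>(i, j). P0 $$ (i, j) div c)"
  have c0: "c \<noteq> 0" using g0 \<delta> by (simp add: c_def sgn_if)
  have cd: "c dvd x \<longleftrightarrow> g dvd x" for x using \<delta> by (auto simp: c_def sgn_if)
  have l: "\<delta> = c * l" using gd cd by (simp add: l_def)
  have P: "P \<in> carrier_mat n n" by (simp add: P_def)
  have Pt: "transpose_mat P \<in> carrier_mat n n" using P by simp
  have P0c: "P0 = c \<cdot>\<^sub>m P" by (rule eq_matI) (use P0 gd cd in \<open>auto simp: P_def\<close>)
  have "0 \<le> g" unfolding g_def by (rule Gcd_int_greater_eq_0)
  with g0 have gpos: "0 < g" by simp
  have lpos: "0 < l"
  proof -
    have "c * \<delta> = g * \<bar>\<delta>\<bar>" by (simp add: c_def abs_sgn mult.assoc mult.commute[of "sgn \<delta>"])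
    also have "\<dots> > 0" using gpos \<delta> by simp
    finally have "0 < c * c * l" using l by (simp add: mult.assoc)
    moreover have "0 < c * c" using c0 by (simp add: zero_less_mult_iff) linarith
    ultimately show ?thesis by (rule zero_less_mult_pos)
  qed
  have tc: "transpose_mat (c \<cdot>\<^sub>m P) = c \<cdot>\<^sub>m transpose_mat P" by (rule eq_matI) (use P in auto)
  have scal: "(c * l * (c * l)) \<cdot>\<^sub>m (1\<^sub>m n :: int mat) = (c * c) \<cdot>\<^sub>m ((l * l) \<cdot>\<^sub>m 1\<^sub>m n)"
    by (rule eq_matI) auto
  have sm: "(c \<cdot>\<^sub>m X) * (c \<cdot>\<^sub>m Y) = (c * c) \<cdot>\<^sub>m (X * Y)" if "X \<in> carrier_mat n n" "Y \<in> carrier_mat n n" for X Y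
  proof -
    have "(c \<cdot>\<^sub>m X) * (c \<cdot>\<^sub>m Y) = c \<cdot>\<^sub>m (c \<cdot>\<^sub>m (X * Y))"
      using that by (simp add: mult_smult_distrib[of _ n n _ n] mult_smult_assoc_mat[of _ n n _ n])
    also have "\<dots> = (c * c) \<cdot>\<^sub>m (X * Y)" by (rule eq_matI) auto
    finally show ?thesis .
  qed
  have cc: "c * c \<noteq> 0" using c0 by simp
  have 1: "transpose_mat P * P = (l * l) \<cdot>\<^sub>m 1\<^sub>m n"
  proof (rule smult_mat_cancel[OF _ cc])
    show "(c * c) \<cdot>\<^sub>m (transpose_mat P * P) = (c * c) \<cdot>\<^sub>m ((l * l) \<cdot>\<^sub>m 1\<^sub>m n)"
      using P0P0 unfolding P0c tc sm[OF Pt P] l scal .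
  qed (use P Pt in auto)
  have 2: "P * transpose_mat P = (l * l) \<cdot>\<^sub>m 1\<^sub>m n"
  proof (rule smult_mat_cancel[OF _ cc])
    show "(c * c) \<cdot>\<^sub>m (P * transpose_mat P) = (c * c) \<cdot>\<^sub>m ((l * l) \<cdot>\<^sub>m 1\<^sub>m n)"
      using P0P0' unfolding P0c tc sm[OF P Pt] l scal .
  qed (use P Pt in auto)
  have 3: "A * P = P * B"
  proof (rule smult_mat_cancel[OF _ c0])
    show "c \<cdot>\<^sub>m (A * P) = c \<cdot>\<^sub>m (P * B)"
      using AP0 unfolding P0c mult_smult_distrib[OF A P] mult_smult_assoc_mat[OF P B] .
  qed (use P A B in auto)
  have 4: "P *\<^sub>v all_ones n = l \<cdot>\<^sub>v all_ones n"
  proof (rule eq_vecI)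
    fix i assume "i < dim_vec (l \<cdot>\<^sub>v all_ones n)"
    then have i: "i < n" by simp
    have "c * (\<Sum>j<n. P $$ (i, j)) = (P0 *\<^sub>v all_ones n) $ i"
      unfolding mult_all_ones_entry[OF P0 i] unfolding P0c using P i by (simp add: sum_distrib_left)
    also have "\<dots> = c * l" unfolding P0e using i l by simp
    finally show "(P *\<^sub>v all_ones n) $ i = (l \<cdot>\<^sub>v all_ones n) $ i"
      using c0 i by (simp add: mult_all_ones_entry[OF P i] del: index_mult_mat_vec)
  qed (use P in auto)
  have 5: "transpose_mat P *\<^sub>v all_ones n = l \<cdot>\<^sub>v all_ones n"
  proof (rule eq_vecI)
    fix i assume "i < dim_vec (l \<cdot>\<^sub>v all_ones n)"
    then have i: "i < n" by simp
    have "transpose_mat P *\<^sub>v (P *\<^sub>v all_ones n) = ((l * l) \<cdot>\<^sub>m 1\<^sub>m n) *\<^sub>v all_ones n"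
      using assoc_mult_mat_vec[OF Pt P all_ones_carrier] unfolding 1 by simp
    also have "\<dots> = (l * l) \<cdot>\<^sub>v all_ones n" by (rule eq_vecI) auto
    finally have "(transpose_mat P *\<^sub>v (l \<cdot>\<^sub>v all_ones n)) $ i = l * l" using i unfolding 4 by simp
    then have "l * (transpose_mat P *\<^sub>v all_ones n) $ i = l * l"
      using i Pt mult_mat_vec_entry[OF Pt _ i, of "l \<cdot>\<^sub>v all_ones n"] mult_all_ones_entry[OF Pt i]
      by (simp add: sum_distrib_left mult.commute del: index_mult_mat_vec)
    then show "(transpose_mat P *\<^sub>v all_ones n) $ i = (l \<cdot>\<^sub>v all_ones n) $ i" using lpos i by simp
  qed (use P in auto)
  have 6: "is_unit x" if x: "x dvd l" "\<forall>i<n. \<forall>j<n. x dvd P $$ (i, j)" for x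
  proof -
    have "c * x dvd \<delta>" unfolding l using x(1) by (rule mult_dvd_mono[OF dvd_refl])
    moreover have "c * x dvd P0 $$ (i, j)" if "i < n" "j < n" for i j
      unfolding P0c using x(2) that P by (auto intro: mult_dvd_mono)
    ultimately have "c * x dvd g" unfolding g_def by (intro Gcd_greatest) auto
    then have "c * x dvd c * 1" using cd[of c] by (metis dvd_trans dvd_refl mult_1_right)
    then show ?thesis using c0 by (simp only: dvd_mult_cancel_left) simp
  qed
  show thesis
    by (rule that[of l P]) (use P lpos 1 2 3 4 5 6 in \<open>simp add: level_matrix_def\<close>)
qed

subsection \<open>From generalized spectra to characteristic polynomials\<close>

lemma adjacency_matrix_carrier [simp]: "adjacency_matrix n G \<in> carrier_mat n n"
  by (simp add: adjacency_matrix_def)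

lemma char_poly_eqI_Spec:
  assumes "Spec n G = Spec n H"
  shows "char_poly (adjacency_matrix n G) = char_poly (adjacency_matrix n H)"
proof -
  let ?c = "\<lambda>G. char_poly (map_mat of_int (adjacency_matrix n G)) :: complex poly"
  have "?c K = (\<Prod>a\<in>#Spec n K. [:- a, 1:])" for K
  proof -
    have m: "(map_mat of_int (adjacency_matrix n K) :: complex mat) \<in> carrier_mat n n" by simp
    have "lead_coeff (?c K) = 1" using degree_monic_char_poly[OF m] by simp
    then show ?thesis unfolding Spec_def using complex_poly_decompose_multiset[of "?c K"] by simp
  qed
  then have "?c G = ?c H" using assms by simp
  then have "map_poly complex_of_int (char_poly (adjacency_matrix n G)) =
      map_poly complex_of_int (char_poly (adjacency_matrix n H))"
    by (simp add: of_int_hom.char_poly_hom[OF adjacency_matrix_carrier])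
  then show ?thesis by (auto simp: poly_eq_iff coeff_map_poly)
qed

lemma poly_char_poly_eq_det:
  fixes M :: "int mat"
  assumes M: "M \<in> carrier_mat n n"
  shows "poly (char_poly M) k = det (k \<cdot>\<^sub>m 1\<^sub>m n - M)"
  unfolding char_poly_def
  by (rule poly_det_cong[of _ n]) (use M in \<open>auto simp: char_poly_matrix_def\<close>)

text \<open>Meant for the adjacency matrix C of the complement: A - J = - I - C, so the spectrum of
  the complement determines the characteristic polynomial of A - J.\<close>

lemma char_poly_minus_one_minus:
  fixes M :: "int mat"
  assumes M: "M \<in> carrier_mat n n"
  shows "poly (char_poly (- 1\<^sub>m n - M)) k = (-1) ^ n * poly (char_poly M) (- k - 1)"
proof -
  have N: "- 1\<^sub>m n - M \<in> carrier_mat n n" using M by auto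
  have "k \<cdot>\<^sub>m 1\<^sub>m n - (- 1\<^sub>m n - M) = (-1) \<cdot>\<^sub>m ((- k - 1) \<cdot>\<^sub>m 1\<^sub>m n - M)"
    by (rule eq_matI) (use M in auto)
  then have "poly (char_poly (- 1\<^sub>m n - M)) k = det ((-1) \<cdot>\<^sub>m ((- k - 1) \<cdot>\<^sub>m 1\<^sub>m n - M))"
    by (simp only: poly_char_poly_eq_det[OF N])
  then show ?thesis using M by (simp add: poly_char_poly_eq_det[OF M])
qed

lemma generalized_cospectral_sum_mat_eq:
  assumes G: "G \<in> simple_graphs n" and H: "H \<in> simple_graphs n" and cos: "generalized_cospectral n G H"
  shows "char_poly (adjacency_matrix n G) = char_poly (adjacency_matrix n H)"
    and "sum_mat (mat_poly (adjacency_matrix n G) f) = sum_mat (mat_poly (adjacency_matrix n H) f)"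
proof -
  let ?A = "adjacency_matrix n" and ?C = "\<lambda>G. adjacency_matrix n (complement n G)"
  have cp: "char_poly (?A G) = char_poly (?A H)" and cc: "char_poly (?C G) = char_poly (?C H)"
    using cos by (auto simp: generalized_cospectral_def generalized_spectrum_def intro: char_poly_eqI_Spec)
  show "char_poly (?A G) = char_poly (?A H)" by (rule cp)
  have compl: "?A K - mat n n (\<lambda>_. 1) = - 1\<^sub>m n - ?C K" if "K \<in> simple_graphs n" for K
  proof (rule eq_matI)
    fix i j assume "i < dim_row (- 1\<^sub>m n - ?C K)" "j < dim_col (- 1\<^sub>m n - ?C K)"
    then have ij: "i < n" "j < n" by (auto simp: adjacency_matrix_def)
    have "(i, i) \<notin> K" using that by (auto simp: simple_graphs_def irrefl_def)
    then show "(?A K - mat n n (\<lambda>_. 1)) $$ (i, j) = (- 1\<^sub>m n - ?C K) $$ (i, j)"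
      using ij by (auto simp: adjacency_matrix_def complement_def)
  qed (auto simp: adjacency_matrix_def)
  have "char_poly (?A G - mat n n (\<lambda>_. 1)) = char_poly (?A H - mat n n (\<lambda>_. 1))"
    unfolding compl[OF G] compl[OF H]
    by (rule poly_ext) (simp add: char_poly_minus_one_minus[OF adjacency_matrix_carrier] cc)
  then show "sum_mat (mat_poly (?A G) f) = sum_mat (mat_poly (?A H) f)"
    by (rule sum_mat_mat_poly_eqI[OF adjacency_matrix_carrier adjacency_matrix_carrier cp])
qed

lemma walk_matrix_eq_poly_walk: "walk_matrix n G = poly_walk n (adjacency_matrix n G) (monom 1)"
  by (rule eq_matI)
    (auto simp: walk_matrix_def poly_walk_def mat_poly_monom[OF adjacency_matrix_carrier] mat_of_cols_def)

lemma adjacency_matrix_symmetric: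
  "G \<in> simple_graphs n \<Longrightarrow> transpose_mat (adjacency_matrix n G) = adjacency_matrix n G"
  by (rule eq_matI) (auto simp: adjacency_matrix_def simple_graphs_def dest: symD)

subsection \<open>The characteristic polynomial of an adjacency matrix modulo 2\<close>

lemma dvd_prod_diff:
  fixes f g :: "'b \<Rightarrow> 'a :: comm_ring_1"
  assumes "\<And>i. i \<in> S \<Longrightarrow> c dvd f i - g i"
  shows "c dvd prod f S - prod g S"
  using assms
proof (induction S rule: infinite_finite_induct)
  case (insert x S)
  have "prod f (insert x S) - prod g (insert x S) = (f x - g x) * prod f S + g x * (prod f S - prod g S)"
    using insert.hyps by (simp add: algebra_simps)
  then show ?case using insert by simp
qed auto

lemma dvd_det_diff:
  fixes M N :: "'a :: comm_ring_1 mat"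
  assumes M: "M \<in> carrier_mat n n" and N: "N \<in> carrier_mat n n"
    and "\<And>i j. i < n \<Longrightarrow> j < n \<Longrightarrow> c dvd M $$ (i, j) - N $$ (i, j)"
  shows "c dvd det M - det N"
  unfolding det_def'[OF M] det_def'[OF N] sum_subtractf[symmetric] right_diff_distrib[symmetric]
proof (intro dvd_sum dvd_mult dvd_prod_diff)
  fix p i assume "p \<in> {p. p permutes {0..<n}}" "i \<in> {0..<n}"
  then have "p i < n" "i < n" by (auto simp: permutes_in_image[of p "{0..<n}"] dest: permutes_in_image[of _ _ i])
  then show "c dvd M $$ (i, p i) - N $$ (i, p i)" using assms(3) by simp
qed

text \<open>Modulo 2 the matrix may be replaced by a skew-symmetric one, whose characteristic polynomial
  satisfies \<open>\<phi>(-t) = (-1)^n \<phi>(t)\<close>.\<close>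

lemma even_coeff_char_poly:
  fixes A :: "int mat"
  assumes A: "A \<in> carrier_mat n n" and sym: "transpose_mat A = A"
    and diag: "\<And>i. i < n \<Longrightarrow> A $$ (i, i) = 0" and odd: "odd (n + i)"
  shows "even (coeff (char_poly A) i)"
proof -
  define S where "S = mat n n (\<lambda>(i, j). if i < j then A $$ (i, j) else - A $$ (i, j))"
  have S: "S \<in> carrier_mat n n" by (simp add: S_def)
  have mS: "- S \<in> carrier_mat n n" using S by simp
  have symA: "A $$ (r, c) = A $$ (c, r)" if "r < n" "c < n" for r c
    using arg_cong[OF sym, of "\<lambda>M. M $$ (r, c)"] that A by simp
  have "transpose_mat S = - S"
    by (rule eq_matI) (use symA diag in \<open>auto simp: S_def not_less_iff_gr_or_eq\<close>)
  then have *: "char_poly S = char_poly (- S)" using char_poly_transpose_mat[OF S] by simp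
  have "char_poly S = Polynomial.smult ((-1) ^ n) (pcompose (char_poly S) [:0, -1:])"
  proof (rule poly_ext)
    fix k :: int
    have "k \<cdot>\<^sub>m 1\<^sub>m n - (- S) = (-1) \<cdot>\<^sub>m ((- k) \<cdot>\<^sub>m 1\<^sub>m n - S)"
      by (rule eq_matI) (use S in auto)
    then have "poly (char_poly (- S)) k = (-1) ^ n * poly (char_poly S) (- k)"
      unfolding poly_char_poly_eq_det[OF S] poly_char_poly_eq_det[OF mS] using S by simp
    then show "poly (char_poly S) k = poly (Polynomial.smult ((-1) ^ n) (pcompose (char_poly S) [:0, -1:])) k"
      unfolding * [symmetric] by (simp add: poly_pcompose)
  qed
  then have "coeff (char_poly S) i = (-1) ^ n * ((-1) ^ i * coeff (char_poly S) i)"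
    by (metis coeff_smult coeff_pcompose_linear)
  then have "coeff (char_poly S) i = (-1) ^ (n + i) * coeff (char_poly S) i"
    by (simp only: power_add mult.assoc)
  then have 0: "coeff (char_poly S) i = 0" using odd by simp
  have "[:2:] dvd char_poly A - char_poly S" unfolding char_poly_def
  proof (rule dvd_det_diff)
    fix r c assume rc: "r < n" "c < n"
    have "char_poly_matrix A $$ (r, c) - char_poly_matrix S $$ (r, c) = [:S $$ (r, c) - A $$ (r, c):]"
      using rc A S by (simp add: char_poly_matrix_def)
    moreover have "even (S $$ (r, c) - A $$ (r, c))" using rc by (simp add: S_def)
    ultimately show "[:2:] dvd char_poly_matrix A $$ (r, c) - char_poly_matrix S $$ (r, c)"
      by (simp add: const_poly_dvd)
  qed (use A S in auto)
  then have "even (coeff (char_poly A - char_poly S) i)" by (simp add: const_poly_dvd_iff)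
  then show ?thesis using 0 by simp
qed

text \<open>Modulo 2 squaring is additive and a^2 = a for constants, so a polynomial in t^2 is the
  square of the polynomial with the same coefficients. The induction removes two coefficients at a
  time and keeps the error as an explicit \<open>q\<close>.\<close>

lemma square_root_mod_2:
  fixes p :: "int poly"
  assumes "\<And>i. odd i \<Longrightarrow> even (coeff p i)"
  obtains \<theta> q where "\<theta> * \<theta> = p + Polynomial.smult 2 q" "\<And>j. coeff \<theta> j = coeff p (2 * j)"
proof -
  have "\<exists>\<theta> q. \<theta> * \<theta> = p + Polynomial.smult 2 q \<and> (\<forall>j. coeff \<theta> j = coeff p (2 * j))"
    if "\<forall>i\<ge>2 * d. coeff p i = 0" "\<forall>i. odd i \<longrightarrow> even (coeff p i)" for d and p :: "int poly"
    using that
  proof (induction d arbitrary: p)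
    case 0
    then have "p = 0" by (simp add: poly_eq_iff)
    then show ?case by (intro exI[of _ 0]) simp
  next
    case (Suc d)
    define r where "r = poly_shift 2 p"
    have r: "\<forall>i\<ge>2 * d. coeff r i = 0" "\<forall>i. odd i \<longrightarrow> even (coeff r i)"
      using Suc.prems by (auto simp: r_def coeff_poly_shift)
    obtain \<theta> q where IH: "\<theta> * \<theta> = r + Polynomial.smult 2 q" "\<forall>j. coeff \<theta> j = coeff r (2 * j)"
      using Suc.IH[OF r] by blast
    define a where "a = coeff p 0"
    obtain b where b: "coeff p 1 = 2 * b" using Suc.prems(2) by (metis dvdE odd_one)
    have "even (a * a - a)" by auto
    then obtain c where c: "a * a = a + 2 * c" by (metis add_diff_cancel_left' diff_add_cancel dvdE add.commute)
    have p: "p = pCons a (pCons (2 * b) r)"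
      by (rule poly_eqI) (use b in \<open>auto simp: a_def r_def coeff_poly_shift coeff_pCons split: nat.splits\<close>)
    have "pCons a \<theta> * pCons a \<theta> = [:a * a:] + pCons 0 (Polynomial.smult (2 * a) \<theta>) + pCons 0 (pCons 0 (\<theta> * \<theta>))"
    proof -
      have "Polynomial.smult (2 * a) \<theta> = Polynomial.smult a \<theta> + Polynomial.smult a \<theta>"
        by (simp flip: smult_add_left)
      then show ?thesis by (simp add: mult_pCons_left mult_pCons_right)
    qed
    also have "\<dots> = p + Polynomial.smult 2 ([:c:] + pCons 0 (Polynomial.smult a \<theta> - [:b:]) + pCons 0 (pCons 0 q))"
      unfolding IH(1) p c
      by (rule poly_eqI) (simp add: coeff_pCons algebra_simps split: nat.splits)
    finally have "pCons a \<theta> * pCons a \<theta> = p + Polynomial.smult 2 ([:c:] + pCons 0 (Polynomial.smult a \<theta> - [:b:]) + pCons 0 (pCons 0 q))" .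
    moreover have "coeff (pCons a \<theta>) j = coeff p (2 * j)" for j
      using IH(2) by (cases j) (auto simp: a_def r_def coeff_poly_shift)
    ultimately show ?case by blast
  qed
  from this[of "Suc (degree p)" p] assms that show thesis by (auto simp: coeff_eq_0)
qed

text \<open>The diagonal entry of M^2 is a sum of squares of row entries, and each square has the
  parity of its root.\<close>

lemma even_row_sums_of_even_square:
  fixes M :: "int mat"
  assumes M: "M \<in> carrier_mat n n" and sym: "transpose_mat M = M"
    and sq: "M * M = 2 \<cdot>\<^sub>m K" and K: "K \<in> carrier_mat n n" and i: "i < n"
  shows "even (\<Sum>j<n. M $$ (i, j))"
proof -
  have symM: "M $$ (r, i) = M $$ (i, r)" if "r < n" for r
    using arg_cong[OF sym, of "\<lambda>M. M $$ (r, i)"] that M i by simp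
  have "(\<Sum>j<n. M $$ (i, j) * M $$ (j, i)) = 2 * K $$ (i, i)"
    using mult_mat_entry[OF M M i i] K i unfolding sq by simp
  then have "even (\<Sum>j<n. M $$ (i, j) * M $$ (i, j))" using symM by simp
  moreover have "even ((\<Sum>j<n. M $$ (i, j) * M $$ (i, j)) - (\<Sum>j<n. M $$ (i, j)))"
    unfolding sum_subtractf[symmetric] by (rule dvd_sum) auto
  ultimately show ?thesis by (metis dvd_diff_right_iff even_diff)
qed

definition hollow_symmetric :: "nat \<Rightarrow> int mat \<Rightarrow> bool" where
  "hollow_symmetric n A \<longleftrightarrow> A \<in> carrier_mat n n \<and> transpose_mat A = A \<and> (\<forall>i<n. A $$ (i, i) = 0)"

text \<open>By Cayley-Hamilton \<open>\<theta>(B)^2\<close> is even, so the row sums of the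
  symmetric matrix \<open>\<theta>(B)\<close> are even. Since \<open>\<theta>\<close> depends only
  on the characteristic polynomial, one choice serves both graphs.\<close>

lemma even_walk_poly_exists:
  assumes A: "hollow_symmetric n A"
  obtains \<theta> where "coeff \<theta> ((n + 1) div 2) = 1" "\<And>i. (n + 1) div 2 < i \<Longrightarrow> coeff \<theta> i = 0"
    "\<And>B i. hollow_symmetric n B \<Longrightarrow> char_poly B = char_poly A \<Longrightarrow> i < n \<Longrightarrow>
      even ((mat_poly B \<theta> *\<^sub>v all_ones n) $ i)"
proof -
  let ?\<phi> = "char_poly A"
  have Ac: "A \<in> carrier_mat n n" using A by (simp add: hollow_symmetric_def)
  \<comment> \<open>Modulo 2 the exponents in \<phi> have the parity of n. The extra factor t for
    odd n makes them even and gives \<open>\<theta>\<close> degree ceil(n/2).\<close>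
  define p where "p = monom 1 (n mod 2) * ?\<phi>"
  have cp: "coeff p i = (if n mod 2 \<le> i then coeff ?\<phi> (i - n mod 2) else 0)" for i
    by (simp add: p_def coeff_monom_mult)
  have "even (coeff p i)" if i: "odd i" for i
  proof -
    have "odd (n + (i - n mod 2))" if "n mod 2 \<le> i"
      using i that by (cases "even n") (auto simp: odd_iff_mod_2_eq_one)
    then have "even (coeff ?\<phi> (i - n mod 2))" if "n mod 2 \<le> i"
      using A that by (intro even_coeff_char_poly[OF Ac]) (auto simp: hollow_symmetric_def)
    then show ?thesis by (simp add: cp)
  qed
  then obtain \<theta> q where \<theta>: "\<theta> * \<theta> = p + Polynomial.smult 2 q" "\<And>j. coeff \<theta> j = coeff p (2 * j)"
    using square_root_mod_2 by blast
  have deg: "degree ?\<phi> = n" "coeff ?\<phi> n = 1" using degree_monic_char_poly[OF Ac] by auto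
  have "2 * ((n + 1) div 2) = n + n mod 2" by presburger
  then have 1: "coeff \<theta> ((n + 1) div 2) = 1" by (simp add: \<theta> cp deg)
  have 2: "coeff \<theta> i = 0" if "(n + 1) div 2 < i" for i
  proof -
    have "n < 2 * i - n mod 2" using that by presburger
    then show ?thesis by (simp add: \<theta>(2) cp deg coeff_eq_0)
  qed
  have 3: "even ((mat_poly B \<theta> *\<^sub>v all_ones n) $ i)"
    if B: "hollow_symmetric n B" and cB: "char_poly B = ?\<phi>" and i: "i < n" for B i
  proof -
    have Bc: "B \<in> carrier_mat n n" and sB: "transpose_mat B = B" using B by (auto simp: hollow_symmetric_def)
    have c: "mat_poly B r \<in> carrier_mat n n" for r using Bc by simp
    have "mat_poly B p = 0\<^sub>m n n"
      unfolding p_def mat_poly_mult[OF Bc] cB[symmetric] cayley_hamilton[OF Bc]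
      by (rule right_mult_zero_mat[OF c])
    then have "mat_poly B \<theta> * mat_poly B \<theta> = 2 \<cdot>\<^sub>m mat_poly B q"
      unfolding mat_poly_mult[OF Bc, symmetric] \<theta>(1) mat_poly_add[OF Bc] mat_poly_smult[OF Bc]
      using c[of q] by simp
    from even_row_sums_of_even_square[OF c mat_poly_transpose[OF Bc sB] this c i]
    show ?thesis using mult_all_ones_entry[OF c i] by simp
  qed
  show thesis using that[OF 1 2 3] .
qed

subsection \<open>The halved walk matrix\<close>

text \<open>For \<open>\<theta>\<close> monic of degree \<open>m\<close> this is a monic basis in
  which all elements from degree \<open>m\<close> on are multiples of \<open>\<theta>\<close>, so
  that their columns in the walk matrix are even.\<close>

definition half_basis :: "nat \<Rightarrow> int poly \<Rightarrow> nat \<Rightarrow> int poly" where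
  "half_basis m \<theta> j = (if j < m then monom 1 j else monom 1 (j - m) * \<theta>)"

text \<open>The matrix \<open>X\<close> of the overview. The integer division is exact once
  \<open>\<theta>(A) e\<close> is even.\<close>

definition half_walk :: "nat \<Rightarrow> int mat \<Rightarrow> nat \<Rightarrow> int poly \<Rightarrow> int mat" where
  "half_walk n A m \<theta> = mat n n (\<lambda>(i, j). poly_walk n A (half_basis m \<theta>) $$ (i, j) div (if j < m then 1 else 2))"

lemma half_walk_carrier [simp]: "half_walk n A m \<theta> \<in> carrier_mat n n"
  by (simp add: half_walk_def)

lemma half_walk_entry:
  assumes A: "A \<in> carrier_mat n n" and ev: "\<And>i. i < n \<Longrightarrow> even ((mat_poly A \<theta> *\<^sub>v all_ones n) $ i)"
    and ij: "i < n" "j < n"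
  shows "half_walk n A m \<theta> $$ (i, j) * (if j < m then 1 else 2) = poly_walk n A (half_basis m \<theta>) $$ (i, j)"
proof (cases "j < m")
  case False
  let ?M = "mat_poly A (monom 1 (j - m))" and ?v = "mat_poly A \<theta> *\<^sub>v all_ones n"
  have M: "?M \<in> carrier_mat n n" and v: "?v \<in> carrier_vec n" and T: "mat_poly A \<theta> \<in> carrier_mat n n"
    using A mult_mat_vec_carrier[OF mat_poly_carrier[OF A] all_ones_carrier] by auto
  have "poly_walk n A (half_basis m \<theta>) $$ (i, j) = (?M *\<^sub>v ?v) $ i"
    using ij False assoc_mult_mat_vec[OF M T all_ones_carrier]
    by (simp add: poly_walk_def half_basis_def mat_poly_mult[OF A])
  also have "\<dots> = (\<Sum>k<n. ?M $$ (i, k) * ?v $ k)" by (rule mult_mat_vec_entry[OF M v ij(1)])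
  finally have "even (poly_walk n A (half_basis m \<theta>) $$ (i, j))" using ev by (auto intro!: dvd_sum)
  then show ?thesis using False ij by (simp add: half_walk_def)
qed (use ij in \<open>simp add: half_walk_def\<close>)

lemma half_walk_mult_diag:
  assumes A: "A \<in> carrier_mat n n" and ev: "\<And>i. i < n \<Longrightarrow> even ((mat_poly A \<theta> *\<^sub>v all_ones n) $ i)"
  shows "half_walk n A m \<theta> * mat_diag n (\<lambda>j. if j < m then 1 else 2) = poly_walk n A (half_basis m \<theta>)"
  unfolding mat_diag_mult_right[OF half_walk_carrier]
  by (rule eq_matI) (use half_walk_entry[OF assms] in auto)

text \<open>Transposing A P = P B gives B P^T = P^T A, and P^T multiplies e by \<open>l\<close>.
  Hence Q^T maps f(A) e to f(B) e.\<close>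

lemma level_matrix_mult_walk:
  assumes A: "A \<in> carrier_mat n n" "transpose_mat A = A" and B: "B \<in> carrier_mat n n" "transpose_mat B = B"
    and P: "level_matrix n A B l P"
  shows "transpose_mat P *\<^sub>v (mat_poly A f *\<^sub>v all_ones n) = l \<cdot>\<^sub>v (mat_poly B f *\<^sub>v all_ones n)"
proof -
  have Pc: "P \<in> carrier_mat n n" and AP: "A * P = P * B"
    and Pe: "transpose_mat P *\<^sub>v all_ones n = l \<cdot>\<^sub>v all_ones n"
    using P by (auto simp: level_matrix_def)
  have Pt: "transpose_mat P \<in> carrier_mat n n" using Pc by simp
  have BP: "B * transpose_mat P = transpose_mat P * A"
    using arg_cong[OF AP, of transpose_mat] transpose_mult[OF A(1) Pc] transpose_mult[OF Pc B(1)] A(2) B(2) by simp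
  have F: "mat_poly A f \<in> carrier_mat n n" and G: "mat_poly B f \<in> carrier_mat n n" using A B by auto
  have "transpose_mat P *\<^sub>v (mat_poly A f *\<^sub>v all_ones n) = (transpose_mat P * mat_poly A f) *\<^sub>v all_ones n"
    by (rule assoc_mult_mat_vec[OF Pt F all_ones_carrier, symmetric])
  also have "\<dots> = mat_poly B f *\<^sub>v (transpose_mat P *\<^sub>v all_ones n)"
    unfolding mat_poly_mult_intertwine[OF B(1) A(1) Pt BP, symmetric]
    by (rule assoc_mult_mat_vec[OF G Pt all_ones_carrier])
  also have "\<dots> = l \<cdot>\<^sub>v (mat_poly B f *\<^sub>v all_ones n)"
    unfolding Pe by (rule eq_vecI) (use G in auto)
  finally show ?thesis .
qed

text \<open>Corresponding columns are divided by the same number for both graphs, so the relation of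
  the walk matrices survives the halving. This is the integrality of Q^T X.\<close>

lemma level_matrix_mult_half_walk:
  assumes A: "A \<in> carrier_mat n n" "transpose_mat A = A" and B: "B \<in> carrier_mat n n" "transpose_mat B = B"
    and evA: "\<And>i. i < n \<Longrightarrow> even ((mat_poly A \<theta> *\<^sub>v all_ones n) $ i)"
    and evB: "\<And>i. i < n \<Longrightarrow> even ((mat_poly B \<theta> *\<^sub>v all_ones n) $ i)"
    and P: "level_matrix n A B l P"
  shows "transpose_mat P * half_walk n A m \<theta> = l \<cdot>\<^sub>m half_walk n B m \<theta>"
proof -
  note * = level_matrix_mult_walk[OF A B P]
  have Pc: "P \<in> carrier_mat n n" using P by (auto simp: level_matrix_def)
  have Pt: "transpose_mat P \<in> carrier_mat n n" using Pc by simp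
  show "transpose_mat P * half_walk n A m \<theta> = l \<cdot>\<^sub>m half_walk n B m \<theta>"
  proof (rule eq_matI)
    fix i j assume "i < dim_row (l \<cdot>\<^sub>m half_walk n B m \<theta>)" "j < dim_col (l \<cdot>\<^sub>m half_walk n B m \<theta>)"
    then have ij: "i < n" "j < n" by (auto simp: half_walk_def)
    let ?c = "if j < m then 1 else (2::int)"
    have "(\<Sum>k<n. transpose_mat P $$ (i, k) * half_walk n A m \<theta> $$ (k, j)) * ?c =
        (\<Sum>k<n. transpose_mat P $$ (i, k) * poly_walk n A (half_basis m \<theta>) $$ (k, j))"
      unfolding sum_distrib_right mult.assoc
      by (intro sum.cong refl arg_cong2[of _ _ _ _ "(*)"] half_walk_entry[OF A(1) evA]) (use ij in auto)
    also have "\<dots> = (\<Sum>k<n. transpose_mat P $$ (i, k) * (mat_poly A (half_basis m \<theta> j) *\<^sub>v all_ones n) $ k)"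
      using ij by (simp add: poly_walk_def)
    also have "\<dots> = (l \<cdot>\<^sub>v (mat_poly B (half_basis m \<theta> j) *\<^sub>v all_ones n)) $ i"
      unfolding *[symmetric]
      by (rule mult_mat_vec_entry[OF Pt mult_mat_vec_carrier[OF mat_poly_carrier[OF A(1)] all_ones_carrier] ij(1), symmetric])
    also have "\<dots> = l * poly_walk n B (half_basis m \<theta>) $$ (i, j)" using ij B by (simp add: poly_walk_def)
    also have "\<dots> = l * half_walk n B m \<theta> $$ (i, j) * ?c"
      using half_walk_entry[OF B(1) evB ij, of m] by (simp only: mult.assoc)
    finally have "(\<Sum>k<n. transpose_mat P $$ (i, k) * half_walk n A m \<theta> $$ (k, j)) = l * half_walk n B m \<theta> $$ (i, j)"
      by (auto split: if_splits)
    then show "(transpose_mat P * half_walk n A m \<theta>) $$ (i, j) = (l \<cdot>\<^sub>m half_walk n B m \<theta>) $$ (i, j)"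
      using ij mult_mat_entry[OF Pt half_walk_carrier ij] by (simp add: half_walk_def)
  qed (use Pc in \<open>auto simp: half_walk_def\<close>)
qed

lemma det_mat_diag: "det (mat_diag n f) = (\<Prod>i<n. f i :: 'a :: comm_ring_1)"
proof -
  have "det (mat_diag n f) = prod_list (diag_mat (mat_diag n f))"
    by (rule det_upper_triangular[of _ n]) (auto simp: mat_diag_def)
  then show ?thesis by (simp add: prod_list_diag_prod mat_diag_def atLeast0LessThan)
qed

lemma dvd_chain_le:
  fixes d :: "nat \<Rightarrow> nat"
  assumes "\<forall>i. Suc i < n \<longrightarrow> d i dvd d (Suc i)" "i \<le> j" "j < n"
  shows "d i dvd d j"
  using assms(2,3)
proof (induction j)
  case (Suc j)
  then show ?case using assms(1) by (cases "i = Suc j") (auto intro: dvd_trans)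
qed simp

text \<open>With X^{-1} = V D^{-1} U, any common multiple of the diagonal of D clears the
  denominators of X^{-1}.\<close>

lemma right_inverse_of_smith:
  fixes c :: int
  assumes X: "X \<in> carrier_mat n n" and U: "unimodular n U" and V: "unimodular n V"
    and D: "U * X * V = mat_diag n f" and dvd: "\<And>i. i < n \<Longrightarrow> f i dvd c"
  obtains Z where "Z \<in> carrier_mat n n" "X * Z = c \<cdot>\<^sub>m 1\<^sub>m n"
proof -
  obtain U' where U': "unimodular n U'" "U' * U = 1\<^sub>m n" using unimodular_inverse[OF U] by blast
  note carr = unimodular_carrier[OF U] unimodular_carrier[OF V] unimodular_carrier[OF U'(1)]
  let ?E = "mat_diag n (\<lambda>i. c div f i)"
  have E: "?E \<in> carrier_mat n n" and F: "mat_diag n f \<in> carrier_mat n n" by auto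
  have XV: "X * V = U' * mat_diag n f"
  proof -
    have "X * V = (U' * U) * (X * V)" unfolding U'(2) using X carr by simp
    also have "\<dots> = U' * mat_diag n f"
      unfolding D[symmetric] using X carr by (simp add: assoc_mult_mat[of _ n n _ n _ n])
    finally show ?thesis .
  qed
  have FE: "mat_diag n f * ?E = c \<cdot>\<^sub>m 1\<^sub>m n"
    unfolding mat_diag_diag by (rule eq_matI) (use dvd in \<open>auto simp: mat_diag_def\<close>)
  have "X * (V * (?E * U)) = (X * V) * (?E * U)"
    by (rule assoc_mult_mat[OF X carr(2) mult_carrier_mat[OF E carr(1)], symmetric])
  also have "\<dots> = U' * ((mat_diag n f * ?E) * U)"
    unfolding XV assoc_mult_mat[OF F E carr(1)]
    by (rule assoc_mult_mat[OF carr(3) F mult_carrier_mat[OF E carr(1)]])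
  also have "\<dots> = c \<cdot>\<^sub>m 1\<^sub>m n"
    unfolding FE using carr U'(2) by (simp add: mult_smult_assoc_mat[OF one_carrier_mat carr(1)] mult_smult_distrib[OF carr(3,1)])
  finally have "X * (V * (?E * U)) = c \<cdot>\<^sub>m 1\<^sub>m n" .
  moreover have "V * (?E * U) \<in> carrier_mat n n"
    by (rule mult_carrier_mat[OF carr(2) mult_carrier_mat[OF E carr(1)]])
  ultimately show thesis using that by blast
qed

text \<open>Comparing determinants forces all but the last invariant factor of \<open>X\<close> to be 1.\<close>

lemma smith_normal_form_of_half:
  assumes W: "W \<in> carrier_mat n n" and dW: "det W \<noteq> 0" and smith: "is_smith_diagonal W d"
    and m: "0 < m" "m < n" and dm: "d m = 1" and dn1: "d (n - 1) = 2"
    and T: "unimodular n T" and X: "X \<in> carrier_mat n n"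
    and WT: "W * T = X * mat_diag n (\<lambda>j. if j < m then 1 else 2)"
  obtains U V \<delta> where "unimodular n U" "unimodular n V" "0 < \<delta>" "int (d n) = 2 * \<delta>"
    "U * X * V = mat_diag n (\<lambda>i. if i < n - 1 then 1 else \<delta>)" "\<bar>det W\<bar> = 2 ^ (n - m) * \<delta>"
proof -
  let ?J = "mat_diag n (\<lambda>j. if j < m then 1 else (2::int))"
  have Tc: "T \<in> carrier_mat n n" and dT: "\<bar>det T\<bar> = 1" using T by (auto simp: unimodular_def)
  have J: "?J \<in> carrier_mat n n" by simp
  have "(\<Prod>j<n. if j < m then 1 else (2::int)) = (\<Prod>j\<in>{m..<n}. 2)"
    by (rule prod.mono_neutral_cong_right) auto
  then have dJ: "det ?J = 2 ^ (n - m)" by (simp add: det_mat_diag)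
  have detWX: "\<bar>det W\<bar> = \<bar>det X\<bar> * 2 ^ (n - m)"
    using arg_cong[OF WT, of "\<lambda>M. \<bar>det M\<bar>"] dT dJ det_mult[OF W Tc] det_mult[OF X J]
    by (simp add: abs_mult)
  then have dX: "det X \<noteq> 0" using dW by auto
  obtain U1 V1 where U1: "unimodular n U1" and V1: "unimodular n V1"
    and D1: "U1 * W * V1 = mat_diag n (\<lambda>i. int (d (Suc i)))"
    and dpos: "\<forall>k\<in>{1..n}. 0 < d k" and ddvd: "\<forall>k\<in>{1..<n}. d k dvd d (Suc k)"
    using smith unfolding is_smith_diagonal_iff[OF W] by blast
  obtain U V c where U: "unimodular n U" and V: "unimodular n V"
    and D: "U * X * V = mat_diag n (\<lambda>i. int (c i))"
    and cpos: "\<forall>i<n. 0 < c i" and cdvd: "\<forall>i. Suc i < n \<longrightarrow> c i dvd c (Suc i)"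
    using smith_normal_form_exists[OF X dX] by blast
  have absdet: "\<bar>det M\<bar> = (\<Prod>i<n. int (f i))"
    if "M \<in> carrier_mat n n" "unimodular n L" "unimodular n R" "L * M * R = mat_diag n (\<lambda>i. int (f i))" for M L R f
  proof -
    have c: "L \<in> carrier_mat n n" "R \<in> carrier_mat n n" using that unimodular_carrier by auto
    have "\<bar>det (L * M * R)\<bar> = \<bar>det M\<bar>"
      using that c det_mult[OF mult_carrier_mat[OF c(1) that(1)] c(2)] det_mult[OF c(1) that(1)]
      by (simp add: unimodular_def abs_mult)
    then show ?thesis unfolding that(4) det_mat_diag by (simp flip: of_nat_prod)
  qed
  define \<gamma> where "\<gamma> = c (n - 1)"
  have \<gamma>pos: "0 < \<gamma>" using cpos m by (simp add: \<gamma>_def)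
  \<comment> \<open>The last invariant factor of W divides every c for which c W^{-1} is integral.
    From W T = X J follows W^{-1} = T J^{-1} X^{-1}; since \<open>?J'\<close> is 2 J^{-1} and
    \<open>Z\<close> is \<gamma> X^{-1}, the number c = 2 \<gamma> qualifies, with \<open>Y\<close>
    as c W^{-1}.\<close>
  have "d n dvd 2 * \<gamma>"
  proof -
    obtain Z where Z: "Z \<in> carrier_mat n n" "X * Z = int \<gamma> \<cdot>\<^sub>m 1\<^sub>m n"
      by (rule right_inverse_of_smith[OF X U V D, of "int \<gamma>"])
        (use dvd_chain_le[OF cdvd, of _ "n - 1"] m in \<open>auto simp: \<gamma>_def\<close>)
    let ?J' = "mat_diag n (\<lambda>j. if j < m then 2 else (1::int))"
    have J': "?J' \<in> carrier_mat n n" by simp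
    have JJ: "?J * ?J' = 2 \<cdot>\<^sub>m 1\<^sub>m n" unfolding mat_diag_diag by (rule eq_matI) (auto simp: mat_diag_def)
    define Y where "Y = T * (?J' * Z)"
    have Y: "Y \<in> carrier_mat n n" unfolding Y_def by (rule mult_carrier_mat[OF Tc mult_carrier_mat[OF J' Z(1)]])
    have "W * Y = (W * T) * (?J' * Z)"
      unfolding Y_def by (rule assoc_mult_mat[OF W Tc mult_carrier_mat[OF J' Z(1)], symmetric])
    also have "\<dots> = X * ((?J * ?J') * Z)"
      unfolding WT assoc_mult_mat[OF J J' Z(1)] by (rule assoc_mult_mat[OF X J mult_carrier_mat[OF J' Z(1)]])
    also have "\<dots> = 2 \<cdot>\<^sub>m (X * Z)"
      unfolding JJ using Z X by (simp add: mult_smult_assoc_mat[OF one_carrier_mat Z(1)] mult_smult_distrib[OF X Z(1)])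
    also have "\<dots> = (2 * int \<gamma>) \<cdot>\<^sub>m 1\<^sub>m n" unfolding Z(2) by (rule eq_matI) auto
    finally have WY: "W * Y = (2 * int \<gamma>) \<cdot>\<^sub>m 1\<^sub>m n" .
    obtain V' where V': "unimodular n V'" "V1 * V' = 1\<^sub>m n" using unimodular_inverse[OF V1] by blast
    obtain U' where U': "unimodular n U'" "U1 * U' = 1\<^sub>m n" using unimodular_inverse[OF U1] by blast
    note carr = unimodular_carrier[OF U1] unimodular_carrier[OF V1] unimodular_carrier[OF U'(1)] unimodular_carrier[OF V'(1)]
    let ?D = "mat_diag n (\<lambda>i. int (d (Suc i)))"
    define K where "K = V' * (Y * U')"
    have K: "K \<in> carrier_mat n n" using carr Y by (simp add: K_def)
    have "?D * K = (U1 * W) * ((V1 * V') * (Y * U'))"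
      unfolding D1[symmetric] K_def using carr Y W by (simp add: assoc_mult_mat[of _ n n _ n _ n])
    also have "\<dots> = U1 * ((W * Y) * U')"
      unfolding V'(2) using carr Y W by (simp add: assoc_mult_mat[of _ n n _ n _ n])
    also have "\<dots> = (2 * int \<gamma>) \<cdot>\<^sub>m 1\<^sub>m n"
      unfolding WY using carr U'(2) by (simp add: mult_smult_assoc_mat[OF one_carrier_mat carr(3)] mult_smult_distrib[OF carr(1,3)])
    finally have DK: "?D * K = (2 * int \<gamma>) \<cdot>\<^sub>m 1\<^sub>m n" .
    have "int (d n) * K $$ (n - 1, n - 1) = (?D * K) $$ (n - 1, n - 1)"
      unfolding mat_diag_mult_left[OF K] using m by simp
    also have "\<dots> = 2 * int \<gamma>" unfolding DK using m by simp
    finally have "int (d n) dvd int (2 * \<gamma>)" by (metis dvd_triv_left of_nat_mult of_nat_numeral)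
    then show ?thesis by (simp only: int_dvd_int_iff)
  qed
  then have le1: "d n \<le> 2 * \<gamma>" using \<gamma>pos by (intro dvd_imp_le) auto
  have ddvd': "\<forall>i. Suc i < n \<longrightarrow> d (Suc i) dvd d (Suc (Suc i))" using ddvd by auto
  have d2: "d (Suc i) \<le> 2" if "i < n - 1" for i
    using dvd_chain_le[OF ddvd', of i "n - 2"] that m dn1 by (auto simp: Suc_diff_Suc numeral_2_eq_2 intro: dvd_imp_le)
  have d1: "d (Suc i) = 1" if "i < m" for i
    using dvd_chain_le[OF ddvd', of i "m - 1"] that m dm by auto
  have n: "{..<n} = insert (n - 1) ({..<m} \<union> {m..<n - 1})" using m by auto
  \<comment> \<open>The function \<open>d\<close> counts from 1 and the diagonal from 0. The first
    \<open>m\<close> factors are 1 and the following n - 1 - m are at most 2.\<close>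
  have "(\<Prod>i<n. d (Suc i)) = d n * ((\<Prod>i<m. d (Suc i)) * (\<Prod>i\<in>{m..<n - 1}. d (Suc i)))"
    unfolding n using m by (subst prod.insert) (auto simp: prod.union_disjoint ivl_disj_int)
  also have "(\<Prod>i<m. d (Suc i)) = 1" using d1 by simp
  also have "(\<Prod>i\<in>{m..<n - 1}. d (Suc i)) \<le> (\<Prod>i\<in>{m..<n - 1}. 2)"
    by (rule prod_mono) (use d2 in auto)
  finally have "(\<Prod>i<n. d (Suc i)) \<le> d n * 2 ^ (n - 1 - m)" by simp
  moreover have "(\<Prod>i<n. d (Suc i)) = (\<Prod>i<n. c i) * 2 ^ (n - m)"
  proof -
    have "(\<Prod>i<n. int (d (Suc i))) = (\<Prod>i<n. int (c i)) * 2 ^ (n - m)"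
      using detWX absdet[OF W U1 V1 D1] absdet[OF X U V D] by simp
    then have "int (\<Prod>i<n. d (Suc i)) = int ((\<Prod>i<n. c i) * 2 ^ (n - m))" by simp
    then show ?thesis by (simp only: of_nat_eq_iff)
  qed
  moreover have "n - m = Suc (n - 1 - m)" using m by auto
  \<comment> \<open>Together with \<open>le1\<close> this squeezes 2 * prod c <= d n <= 2 *
    \<gamma>. As \<gamma> is itself one of the factors of the product, all the others are 1.\<close>
  ultimately have le2: "2 * (\<Prod>i<n. c i) \<le> d n" by (simp add: mult.assoc mult.left_commute)
  have prodc: "(\<Prod>i<n. c i) = \<gamma> * (\<Prod>i<n - 1. c i)"
    unfolding \<gamma>_def using m prod.lessThan_Suc[of c "n - 1"] by (simp add: mult.commute)
  have "\<gamma> * (\<Prod>i<n - 1. c i) \<le> \<gamma> * 1" using le1 le2 unfolding prodc by linarith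
  then have "(\<Prod>i<n - 1. c i) \<le> 1" using \<gamma>pos by (simp only: mult_le_cancel1)
  moreover have "0 < (\<Prod>i<n - 1. c i)" using cpos by (intro prod_pos) auto
  ultimately have prod1: "(\<Prod>i<n - 1. c i) = 1" by linarith
  have c1: "c i = 1" if "i < n - 1" for i
    using prod1 dvd_prodI[of "{..<n - 1}" i c] that by simp
  have dn: "d n = 2 * \<gamma>" using le1 le2 prodc prod1 by simp
  have "mat_diag n (\<lambda>i. int (c i)) = mat_diag n (\<lambda>i. if i < n - 1 then 1 else int \<gamma>)"
    by (rule eq_matI) (use c1 in \<open>auto simp: mat_diag_def \<gamma>_def not_less le_less_Suc_eq
      intro!: arg_cong[of _ _ c]\<close>)
  moreover have "\<bar>det W\<bar> = 2 ^ (n - m) * int \<gamma>"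
    using detWX absdet[OF X U V D] prodc prod1 by (simp flip: of_nat_prod)
  ultimately show thesis using that[OF U V, of "int \<gamma>"] D \<gamma>pos dn by simp
qed

subsection \<open>Levels\<close>

text \<open>The kernel of \<open>X\<^sup>T\<close> modulo \<open>l\<close> is cyclic, generated by the last row of \<open>U\<close>.\<close>

lemma level_matrix_rank_one:
  assumes X: "X \<in> carrier_mat n n" and U: "unimodular n U" and V: "unimodular n V" and n: "0 < n"
    and D: "U * X * V = mat_diag n (\<lambda>i. if i < n - 1 then 1 else \<delta>)"
    and P: "P \<in> carrier_mat n n" and Y: "Y \<in> carrier_mat n n" and eq: "transpose_mat P * X = l \<cdot>\<^sub>m Y"
  obtains y where "\<And>i j. i < n \<Longrightarrow> j < n \<Longrightarrow> [P $$ (i, j) = U $$ (n - 1, i) * y j] (mod l)"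
proof -
  obtain U' where U': "unimodular n U'" "U' * U = 1\<^sub>m n" using unimodular_inverse[OF U] by blast
  let ?D = "mat_diag n (\<lambda>i. if i < n - 1 then 1 else \<delta>)"
  have Pt: "transpose_mat P \<in> carrier_mat n n" using P by simp
  note carr = unimodular_carrier[OF U] unimodular_carrier[OF V] unimodular_carrier[OF U'(1)]
  \<comment> \<open>In the basis given by \<open>U\<close> the relation becomes R D = l Y V. All
    diagonal entries but the last are 1, so only the last column of \<open>R\<close> survives modulo
    \<open>l\<close>, and P^T = R U has rank one.\<close>
  define R where "R = transpose_mat P * U'"
  have R: "R \<in> carrier_mat n n" using Pt carr by (simp add: R_def)
  have "R * ?D = transpose_mat P * ((U' * U) * (X * V))"
    unfolding D[symmetric] R_def using Pt carr X by (simp add: assoc_mult_mat[of _ n n _ n _ n])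
  also have "\<dots> = (transpose_mat P * X) * V"
    unfolding U'(2) using Pt carr X by (simp add: assoc_mult_mat[of _ n n _ n _ n])
  also have "\<dots> = l \<cdot>\<^sub>m (Y * V)" unfolding eq by (rule mult_smult_assoc_mat[OF Y carr(2)])
  finally have RD: "R * ?D = l \<cdot>\<^sub>m (Y * V)" .
  have Rdvd: "l dvd R $$ (i, j)" if ij: "i < n" "j < n - 1" for i j
  proof -
    have "R $$ (i, j) = (R * ?D) $$ (i, j)" unfolding mat_diag_mult_right[OF R] using ij by simp
    also have "\<dots> = l * (Y * V) $$ (i, j)" unfolding RD using ij Y carr by (simp del: index_mult_mat(1))
    finally show ?thesis by simp
  qed
  have PRU: "transpose_mat P = R * U"
    unfolding R_def using assoc_mult_mat[OF Pt carr(3,1)] U'(2) Pt by simp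
  have "[P $$ (i, j) = U $$ (n - 1, i) * R $$ (j, n - 1)] (mod l)" if ij: "i < n" "j < n" for i j
  proof -
    have "P $$ (i, j) = transpose_mat P $$ (j, i)" using P ij by simp
    also have "\<dots> = (\<Sum>k<n. R $$ (j, k) * U $$ (k, i))"
      unfolding PRU by (rule mult_mat_entry[OF R carr(1) ij(2,1)])
    also have "\<dots> = R $$ (j, n - 1) * U $$ (n - 1, i) + (\<Sum>k<n - 1. R $$ (j, k) * U $$ (k, i))"
      using n sum.lessThan_Suc[of "\<lambda>k. R $$ (j, k) * U $$ (k, i)" "n - 1"] by simp
    finally have "P $$ (i, j) - U $$ (n - 1, i) * R $$ (j, n - 1) = (\<Sum>k<n - 1. R $$ (j, k) * U $$ (k, i))"
      by (simp add: mult.commute)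
    moreover have "l dvd (\<Sum>k<n - 1. R $$ (j, k) * U $$ (k, i))"
      using Rdvd ij by (intro dvd_sum dvd_mult2) auto
    ultimately show ?thesis by (simp add: cong_iff_dvd_diff)
  qed
  then show thesis by (rule that)
qed

text \<open>Since \<delta> X^{-1} is integral, \<open>l\<close> divides \<delta> times each entry of
  \<open>P\<close>. Then l / gcd(l, \<delta>) divides all entries, and primitivity makes it a
  unit.\<close>

lemma level_dvd:
  assumes X: "X \<in> carrier_mat n n" and Z: "Z \<in> carrier_mat n n" "X * Z = \<delta> \<cdot>\<^sub>m 1\<^sub>m n"
    and P: "level_matrix n A B l P" and Y: "Y \<in> carrier_mat n n" and eq: "transpose_mat P * X = l \<cdot>\<^sub>m Y"
  shows "l dvd \<delta>"
proof -
  have Pc: "P \<in> carrier_mat n n" and l: "0 < l"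
    and prim: "\<And>d. d dvd l \<Longrightarrow> (\<forall>i<n. \<forall>j<n. d dvd P $$ (i, j)) \<Longrightarrow> is_unit d"
    using P by (auto simp: level_matrix_def)
  have Pt: "transpose_mat P \<in> carrier_mat n n" using Pc by simp
  have "\<delta> \<cdot>\<^sub>m transpose_mat P = (transpose_mat P * X) * Z"
    using assoc_mult_mat[OF Pt X Z(1)] Z(2) mult_smult_distrib[OF Pt one_carrier_mat, of \<delta>] Pt by simp
  also have "\<dots> = l \<cdot>\<^sub>m (Y * Z)" unfolding eq by (rule mult_smult_assoc_mat[OF Y Z(1)])
  finally have e: "\<delta> \<cdot>\<^sub>m transpose_mat P = l \<cdot>\<^sub>m (Y * Z)" .
  have dvd: "l dvd \<delta> * P $$ (i, j)" if ij: "i < n" "j < n" for i j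
  proof -
    have "\<delta> * P $$ (i, j) = (\<delta> \<cdot>\<^sub>m transpose_mat P) $$ (j, i)" using Pc ij by simp
    also have "\<dots> = l * (Y * Z) $$ (j, i)" unfolding e using Y Z ij by (simp del: index_mult_mat(1))
    finally show ?thesis by simp
  qed
  obtain l' \<delta>' where g: "l = l' * gcd l \<delta>" "\<delta> = \<delta>' * gcd l \<delta>" "coprime l' \<delta>'"
    using gcd_coprime_exists[of l \<delta>] l by auto
  have g0: "gcd l \<delta> \<noteq> 0" using l by simp
  have "l' dvd P $$ (i, j)" if ij: "i < n" "j < n" for i j
  proof -
    have "l' * gcd l \<delta> dvd (\<delta>' * P $$ (i, j)) * gcd l \<delta>"
      using dvd[OF ij] g by (metis mult.assoc mult.commute)
    then have "l' dvd \<delta>' * P $$ (i, j)" using g0 by (simp only: dvd_mult_cancel_right) simp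
    then show ?thesis using g(3) by (simp add: coprime_dvd_mult_right_iff)
  qed
  moreover have "l' dvd l" using g(1) by (metis dvd_triv_left)
  ultimately have "is_unit l'" using prim by blast
  then have "l dvd gcd l \<delta>" using g(1) by (metis mult.commute mult_unit_dvd_iff dvd_refl)
  then show ?thesis by (rule dvd_trans) simp
qed

section \<open>Adjugates and eigenvectors modulo a prime power\<close>

text \<open>Replace row \<open>j\<close> of \<open>M\<close> by the \<open>k\<close>-th unit vector and multiply by the adjugate.\<close>

lemma adj_mat_kernel_cong:
  fixes M :: "int mat"
  assumes M: "M \<in> carrier_mat n n" and ker: "\<And>r. r < n \<Longrightarrow> [(\<Sum>c<n. M $$ (r, c) * x c) = 0] (mod q)"
    and ijk: "i < n" "j < n" "k < n"
  shows "[adj_mat M $$ (i, j) * x k = adj_mat M $$ (k, j) * x i] (mod q)"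
proof -
  define N where "N = mat n n (\<lambda>(r, c). if r = j then (if c = k then 1 else 0) else M $$ (r, c))"
  have N: "N \<in> carrier_mat n n" by (simp add: N_def)
  have "mat_delete N j c = mat_delete M j c" for c
    by (rule eq_matI) (use M ijk in \<open>auto simp: mat_delete_def N_def\<close>)
  then have cof: "cofactor N j c = cofactor M j c" for c by (simp add: cofactor_def)
  \<comment> \<open>Column \<open>j\<close> of the adjugate consists of cofactors along row
    \<open>j\<close>, which do not see the replaced row.\<close>
  have adjN: "adj_mat N $$ (c, j) = adj_mat M $$ (c, j)" if "c < n" for c
    using cof that ijk M N by (simp add: adj_mat_def)
  have "det N = (\<Sum>c<n. N $$ (j, c) * cofactor N j c)" by (rule laplace_expansion_row[OF N ijk(2)])
  also have "\<dots> = (\<Sum>c<n. if c = k then cofactor N j k else 0)"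
    using ijk by (intro sum.cong) (auto simp: N_def)
  also have "\<dots> = adj_mat M $$ (k, j)" using ijk cof M by (simp add: adj_mat_def)
  finally have detN: "det N = adj_mat M $$ (k, j)" .
  note a = adj_mat[OF N]
  have Nx: "(\<Sum>c<n. N $$ (r, c) * x c) = (if r = j then x k else (\<Sum>c<n. M $$ (r, c) * x c))" if "r < n" for r
  proof (cases "r = j")
    case True
    then have "(\<Sum>c<n. N $$ (r, c) * x c) = (\<Sum>c<n. if c = k then x k else 0)"
      using ijk by (intro sum.cong) (auto simp: N_def)
    then show ?thesis using True ijk by simp
  qed (use that in \<open>auto simp: N_def intro!: sum.cong\<close>)
  have "det N * x i = (\<Sum>c<n. (adj_mat N * N) $$ (i, c) * x c)"
  proof -
    have "(\<Sum>c<n. (adj_mat N * N) $$ (i, c) * x c) = (\<Sum>c<n. if c = i then det N * x i else 0)"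
      unfolding a(3) using ijk by (intro sum.cong) auto
    then show ?thesis using ijk by simp
  qed
  also have "\<dots> = (\<Sum>c<n. \<Sum>r<n. adj_mat N $$ (i, r) * (N $$ (r, c) * x c))"
    by (intro sum.cong refl) (auto simp: mult_mat_entry[OF a(1) N ijk(1)] sum_distrib_right mult.assoc simp del: index_mult_mat(1))
  also have "\<dots> = (\<Sum>r<n. \<Sum>c<n. adj_mat N $$ (i, r) * (N $$ (r, c) * x c))" by (rule sum.swap)
  also have "\<dots> = (\<Sum>r<n. adj_mat N $$ (i, r) * (if r = j then x k else (\<Sum>c<n. M $$ (r, c) * x c)))"
    by (simp add: sum_distrib_left[symmetric] Nx)
  finally have "det N * x i = (\<Sum>r<n. adj_mat N $$ (i, r) * (if r = j then x k else (\<Sum>c<n. M $$ (r, c) * x c)))" .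
  moreover have "[(\<Sum>r<n. adj_mat N $$ (i, r) * (if r = j then x k else (\<Sum>c<n. M $$ (r, c) * x c)))
      = (\<Sum>r<n. if r = j then adj_mat N $$ (i, j) * x k else 0)] (mod q)"
  proof (rule cong_sum)
    fix r assume "r \<in> {..<n}"
    then show "[adj_mat N $$ (i, r) * (if r = j then x k else (\<Sum>c<n. M $$ (r, c) * x c))
        = (if r = j then adj_mat N $$ (i, j) * x k else 0)] (mod q)"
      using cong_mult[OF cong_refl ker, of r] by auto
  qed
  moreover have "(\<Sum>r<n. if r = j then adj_mat N $$ (i, j) * x k else 0) = adj_mat M $$ (i, j) * x k"
    using ijk adjN by simp
  ultimately show ?thesis using detN by (simp add: cong_sym)
qed

text \<open>The kernel relation and symmetry make the adjugate proportional to x x^T modulo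
  \<open>q\<close>, where the unit \<open>x a\<close> replaces division. Its product with e is then
  a multiple of the sum of the \<open>x i\<close>.\<close>

lemma adj_mat_row_sum_cong_0:
  fixes M :: "int mat"
  assumes M: "M \<in> carrier_mat n n" and ker: "\<And>r. r < n \<Longrightarrow> [(\<Sum>c<n. M $$ (r, c) * x c) = 0] (mod q)"
    and sym: "\<And>i j. i < n \<Longrightarrow> j < n \<Longrightarrow> adj_mat M $$ (i, j) = adj_mat M $$ (j, i)"
    and x0: "[(\<Sum>i<n. x i) = 0] (mod q)" and a: "a < n" "coprime (x a) q" and i: "i < n"
  shows "q dvd (\<Sum>j<n. adj_mat M $$ (i, j))"
proof -
  let ?F = "adj_mat M"
  have id: "[?F $$ (i, j) * x k = ?F $$ (k, j) * x i] (mod q)" if "i < n" "j < n" "k < n" for i j k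
    by (rule adj_mat_kernel_cong[OF M ker that])
  have "[x a * (\<Sum>j<n. ?F $$ (a, j)) = ?F $$ (a, a) * (\<Sum>j<n. x j)] (mod q)"
    unfolding sum_distrib_left
  proof (rule cong_sum)
    fix j assume "j \<in> {..<n}"
    then show "[x a * ?F $$ (a, j) = ?F $$ (a, a) * x j] (mod q)"
      using id[of j a a] sym[of a j] a by (simp add: mult.commute)
  qed
  also have "[?F $$ (a, a) * (\<Sum>j<n. x j) = 0] (mod q)" using cong_mult[OF cong_refl x0] by simp
  finally have 1: "[(\<Sum>j<n. ?F $$ (a, j)) = 0] (mod q)"
    using a(2) by (metis cong_mult_lcancel mult_zero_right)
  have "[x a * (\<Sum>j<n. ?F $$ (i, j)) = x i * (\<Sum>j<n. ?F $$ (a, j))] (mod q)"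
    unfolding sum_distrib_left
    by (rule cong_sum) (use id[OF i _ a(1)] in \<open>auto simp: mult.commute\<close>)
  also have "[x i * (\<Sum>j<n. ?F $$ (a, j)) = 0] (mod q)" using cong_mult[OF cong_refl 1] by simp
  finally have "[(\<Sum>j<n. ?F $$ (i, j)) = 0] (mod q)"
    using a(2) by (metis cong_mult_lcancel mult_zero_right)
  then show ?thesis by (simp add: cong_0_iff)
qed

text \<open>With f the quotient of \<phi> - \<phi>(c) by t - c, Cayley-Hamilton gives (c - A) f(A) =
  \<phi>(c) I. The adjugate solves the same equation, and \<phi>(c) = det(c - A) is nonzero.\<close>

lemma adj_mat_eq_mat_poly:
  fixes A :: "int mat"
  assumes A: "A \<in> carrier_mat n n" and root: "poly (char_poly A) c \<noteq> 0"
  shows "adj_mat (c \<cdot>\<^sub>m 1\<^sub>m n - A) = mat_poly A (synthetic_div (char_poly A) c)"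
proof -
  let ?M = "c \<cdot>\<^sub>m 1\<^sub>m n - A" and ?f = "synthetic_div (char_poly A) c"
  have M: "?M \<in> carrier_mat n n" and F: "mat_poly A ?f \<in> carrier_mat n n" using A by auto
  note a = adj_mat[OF M]
  have z: "0 \<cdot>\<^sub>m 1\<^sub>m n = (0\<^sub>m n n :: int mat)" "1 \<cdot>\<^sub>m 1\<^sub>m n = (1\<^sub>m n :: int mat)" by (auto intro!: eq_matI)
  have "mat_poly A [:- c, 1:] = - ?M"
    by (rule eq_matI) (use A z right_mult_one_mat[OF A] right_mult_zero_mat[OF A] in \<open>auto simp del: index_mult_mat(1)\<close>)
  then have "- ?M * mat_poly A ?f + poly (char_poly A) c \<cdot>\<^sub>m 1\<^sub>m n = 0\<^sub>m n n"
    using arg_cong[OF synthetic_div_correct'[of c "char_poly A"], of "mat_poly A"]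
    unfolding mat_poly_add[OF A] mat_poly_mult[OF A] cayley_hamilton[OF A]
    using A right_mult_zero_mat[OF A] by simp
  then have "?M * mat_poly A ?f = poly (char_poly A) c \<cdot>\<^sub>m 1\<^sub>m n"
  proof -
    assume e: "- ?M * mat_poly A ?f + poly (char_poly A) c \<cdot>\<^sub>m 1\<^sub>m n = 0\<^sub>m n n"
    have MF: "?M * mat_poly A ?f \<in> carrier_mat n n" using mult_carrier_mat[OF M F] .
    show ?thesis
    proof (rule eq_matI)
      fix i j assume "i < dim_row (poly (char_poly A) c \<cdot>\<^sub>m 1\<^sub>m n)" "j < dim_col (poly (char_poly A) c \<cdot>\<^sub>m 1\<^sub>m n)"
      then have ij: "i < n" "j < n" by auto
      have "- ?M * mat_poly A ?f = - (?M * mat_poly A ?f)" using A by simp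
      then show "(?M * mat_poly A ?f) $$ (i, j) = (poly (char_poly A) c \<cdot>\<^sub>m 1\<^sub>m n) $$ (i, j)"
        using arg_cong[OF e, of "\<lambda>K. K $$ (i, j)"] ij MF A by (simp del: index_mult_mat(1) uminus_mult_left_mat)
    qed (use MF in auto)
  qed
  also have "\<dots> = ?M * adj_mat ?M" unfolding a(2) poly_char_poly_eq_det[OF A] ..
  finally show ?thesis
    using mult_mat_left_cancel[OF _ M _ a(1) F] root by (simp add: poly_char_poly_eq_det[OF A])
qed

text \<open>Multiplying x^T M by the adjugate gives det M times x^T; one coordinate prime to
  \<open>p\<close> is enough.\<close>

lemma dvd_det_of_left_kernel:
  fixes M :: "int mat"
  assumes M: "M \<in> carrier_mat n n" and ker: "\<And>j. j < n \<Longrightarrow> p dvd (\<Sum>i<n. x i * M $$ (i, j))"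
    and a: "a < n" "coprime (x a) p"
  shows "p dvd det M"
proof -
  note adj = adj_mat[OF M]
  have "(\<Sum>j<n. (\<Sum>i<n. x i * M $$ (i, j)) * adj_mat M $$ (j, a)) =
      (\<Sum>j<n. \<Sum>i<n. x i * (M $$ (i, j) * adj_mat M $$ (j, a)))"
    by (simp add: sum_distrib_right mult.assoc)
  also have "\<dots> = (\<Sum>i<n. \<Sum>j<n. x i * (M $$ (i, j) * adj_mat M $$ (j, a)))" by (rule sum.swap)
  also have "\<dots> = (\<Sum>i<n. x i * (M * adj_mat M) $$ (i, a))"
    by (intro sum.cong refl) (auto simp: mult_mat_entry[OF M adj(1) _ a(1)] sum_distrib_left simp del: index_mult_mat(1))
  also have "\<dots> = x a * det M"
    unfolding adj(2) using a by (simp add: if_distrib[of "\<lambda>t. _ * t"] cong: if_cong)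
  finally have "p dvd x a * det M" using ker by (metis (no_types, lifting) dvd_mult2 dvd_sum lessThan_iff)
  then show ?thesis using a(2) by (simp add: coprime_commute coprime_dvd_mult_right_iff)
qed

text \<open>The k + 1 factors of p have two sources. A column f(A) e divisible by p^k supplies k of
  them. After division by p^k the matrix is still singular modulo p, with left kernel vector x,
  because P^T maps it to \<open>l\<close> times its counterpart for \<open>B\<close>; this needs
  f(B) e to be divisible by p^k too, hence the eigenvector y.\<close>

lemma prime_power_level_dvd_det:
  fixes p :: int
  assumes A: "A \<in> carrier_mat n n" "transpose_mat A = A" and B: "B \<in> carrier_mat n n" "transpose_mat B = B"
    and cp: "char_poly A = char_poly B" and P: "level_matrix n A B l P"
    and rank: "\<And>i j. i < n \<Longrightarrow> j < n \<Longrightarrow> [P $$ (i, j) = x i * y j] (mod l)"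
    and p: "prime p" and k: "0 < k" and dvd: "p ^ k dvd l" and n: "0 < n"
  shows "p ^ Suc k dvd det (poly_walk n A (monom 1))"
proof -
  define q where "q = p ^ k"
  have q0: "0 < q" using p by (simp add: q_def prime_gt_0_int)
  have pq: "p dvd q" using k by (simp add: q_def)
  have pl: "p dvd l" using pq dvd unfolding q_def by (rule dvd_trans)
  have Pc: "P \<in> carrier_mat n n" and AP: "A * P = P * B"
    and Pe: "P *\<^sub>v all_ones n = l \<cdot>\<^sub>v all_ones n" and Pte: "transpose_mat P *\<^sub>v all_ones n = l \<cdot>\<^sub>v all_ones n"
    and prim: "\<And>d. d dvd l \<Longrightarrow> (\<forall>i<n. \<forall>j<n. d dvd P $$ (i, j)) \<Longrightarrow> is_unit d"
    using P by (auto simp: level_matrix_def)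
  have Pt: "transpose_mat P \<in> carrier_mat n n" using Pc by simp
  have rq: "[P $$ (i, j) = x i * y j] (mod q)" if "i < n" "j < n" for i j
    using cong_dvd_modulus[OF rank[OF that]] dvd by (simp add: q_def)
  have lq: "[l = 0] (mod q)" using dvd by (simp add: cong_0_iff q_def)
  \<comment> \<open>By primitivity some entry of \<open>P\<close> is prime to p, so
    \<open>x a\<close> and \<open>y b\<close> are units modulo p and modulo q.\<close>
  obtain a b where ab: "a < n" "b < n" "\<not> p dvd P $$ (a, b)"
    using prim[OF pl] p by (metis not_prime_unit)
  have "\<not> p dvd x a * y b"
    using ab cong_dvd_iff[OF cong_dvd_modulus[OF rank[OF ab(1,2)] pl]] by simp
  then have nd: "\<not> p dvd x a" "\<not> p dvd y b" by auto
  have cop: "coprime (x a) p" "coprime (y b) p" "coprime (x a) q" "coprime (y b) q"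
    using nd p by (auto simp: q_def coprime_commute prime_imp_coprime)
  define Ax where "Ax = (\<lambda>i. \<Sum>j<n. A $$ (i, j) * x j)"
  define By where "By = (\<lambda>i. \<Sum>j<n. B $$ (i, j) * y j)"
  have symB: "B $$ (i, j) = B $$ (j, i)" if "i < n" "j < n" for i j
    using arg_cong[OF B(2), of "\<lambda>M. M $$ (i, j)"] that B(1) by simp
  \<comment> \<open>Entry (i, j) of A P = P B modulo q. Fixing the unit \<open>y b\<close> separates
    the variables and yields one eigenvalue \<open>c0\<close> for both x and y.\<close>
  have AxBy: "[y j * Ax i = x i * By j] (mod q)" if ij: "i < n" "j < n" for i j
  proof -
    have "[y j * Ax i = (\<Sum>r<n. A $$ (i, r) * P $$ (r, j))] (mod q)"
      unfolding Ax_def sum_distrib_left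
    proof (rule cong_sum)
      fix r assume "r \<in> {..<n}"
      then show "[y j * (A $$ (i, r) * x r) = A $$ (i, r) * P $$ (r, j)] (mod q)"
        using cong_mult[OF cong_refl[of "A $$ (i, r)"] cong_sym[OF rq[of r j]]] ij by (simp add: algebra_simps)
    qed
    also have "(\<Sum>r<n. A $$ (i, r) * P $$ (r, j)) = (\<Sum>r<n. P $$ (i, r) * B $$ (r, j))"
      using mult_mat_entry[OF A(1) Pc ij] mult_mat_entry[OF Pc B(1) ij] AP by simp
    also have "[\<dots> = x i * By j] (mod q)"
      unfolding By_def sum_distrib_left
    proof (rule cong_sum)
      fix r assume "r \<in> {..<n}"
      then show "[P $$ (i, r) * B $$ (r, j) = x i * (B $$ (j, r) * y r)] (mod q)"
        using cong_mult[OF rq[of i r] cong_refl[of "B $$ (r, j)"]] ij symB[of r j] by (simp add: algebra_simps)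
    qed
    finally show ?thesis .
  qed
  obtain u where u: "[y b * u = 1] (mod q)" using cong_solve_coprime_int[OF cop(4)] by blast
  define c0 where "c0 = u * By b"
  have Axc0: "[Ax i = c0 * x i] (mod q)" if "i < n" for i
  proof -
    have "[y b * Ax i = x i * By b] (mod q)" using AxBy that ab by simp
    also have "[x i * By b = (y b * u) * (x i * By b)] (mod q)"
      using cong_mult[OF cong_sym[OF u] cong_refl[of "x i * By b"]] by simp
    finally have "[y b * Ax i = y b * (c0 * x i)] (mod q)" by (simp add: c0_def algebra_simps)
    then show ?thesis using cop(4) by (simp only: cong_mult_lcancel)
  qed
  have Byc0: "[By j = c0 * y j] (mod q)" if "j < n" for j
  proof -
    have "[x a * By j = y j * Ax a] (mod q)" using AxBy[OF ab(1) that] by (rule cong_sym)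
    also have "[y j * Ax a = y j * (c0 * x a)] (mod q)" by (rule cong_mult[OF cong_refl Axc0[OF ab(1)]])
    finally have "[x a * By j = x a * (c0 * y j)] (mod q)" by (simp add: algebra_simps)
    then show ?thesis using cop(3) by (simp only: cong_mult_lcancel)
  qed
  \<comment> \<open>Column \<open>b\<close> of \<open>P\<close> sums to \<open>l\<close>, which q
    divides; \<open>y b\<close> can be cancelled.\<close>
  have sumx: "[(\<Sum>i<n. x i) = 0] (mod q)"
  proof -
    have "[y b * (\<Sum>i<n. x i) = (\<Sum>i<n. P $$ (i, b))] (mod q)"
      unfolding sum_distrib_left
      by (rule cong_sum) (use cong_sym[OF rq[OF _ ab(2)]] in \<open>auto simp: mult.commute\<close>)
    also have "(\<Sum>i<n. P $$ (i, b)) = l"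
      using mult_all_ones_entry[OF Pt ab(2)] ab(2) Pc unfolding Pte by simp
    also note lq
    finally have "[y b * (\<Sum>i<n. x i) = y b * 0] (mod q)" by simp
    then show ?thesis using cop(4) by (simp only: cong_mult_lcancel)
  qed
  have sumy: "[(\<Sum>i<n. y i) = 0] (mod q)"
  proof -
    have "[x a * (\<Sum>j<n. y j) = (\<Sum>j<n. P $$ (a, j))] (mod q)"
      unfolding sum_distrib_left
      by (rule cong_sum) (use cong_sym[OF rq[OF ab(1)]] in auto)
    also have "(\<Sum>j<n. P $$ (a, j)) = l"
      using mult_all_ones_entry[OF Pc ab(1)] ab(1) unfolding Pe by simp
    also note lq
    finally have "[x a * (\<Sum>j<n. y j) = x a * 0] (mod q)" by simp
    then show ?thesis using cop(3) by (simp only: cong_mult_lcancel)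
  qed
  let ?\<phi> = "char_poly B"
  have deg: "degree ?\<phi> = n" "coeff ?\<phi> n = 1" using degree_monic_char_poly[OF B(1)] by auto
  \<comment> \<open>The eigenvalue modulo \<open>q\<close> is lifted to an integer that is not a root of the characteristic polynomial.\<close>
  obtain t :: nat where t: "poly ?\<phi> (c0 + q * int t) \<noteq> 0"
  proof -
    have "finite {z. poly ?\<phi> z = 0}" using deg by (intro poly_roots_finite) auto
    moreover have "infinite (range (\<lambda>t. c0 + q * int t))"
      using q0 by (intro range_inj_infinite) (auto simp: inj_on_def)
    ultimately have "\<not> range (\<lambda>t. c0 + q * int t) \<subseteq> {z. poly ?\<phi> z = 0}" using finite_subset by blast
    then show thesis using that by blast
  qed
  define c where "c = c0 + q * int t"
  have cc0: "[c0 = c] (mod q)" by (simp add: c_def cong_iff_dvd_diff)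
  define f where "f = synthetic_div ?\<phi> c"
  have degf: "degree f = n - 1" using degree_synthetic_div[of ?\<phi> c] deg by (simp add: f_def)
  have monf: "coeff f (n - 1) = 1"
  proof -
    have "coeff (?\<phi> + Polynomial.smult c f) n = coeff (pCons (poly ?\<phi> c) f) n"
      unfolding f_def synthetic_div_correct ..
    moreover have "coeff f n = 0" using degf n by (intro coeff_eq_0) auto
    ultimately show ?thesis using deg n by (cases n) auto
  qed
  have rows: "q dvd (mat_poly C f *\<^sub>v all_ones n) $ i"
    if C: "C \<in> carrier_mat n n" "transpose_mat C = C" and cpC: "char_poly C = ?\<phi>"
      and eig: "\<And>i. i < n \<Longrightarrow> [(\<Sum>j<n. C $$ (i, j) * z j) = c0 * z i] (mod q)"
      and z: "[(\<Sum>i<n. z i) = 0] (mod q)" "s < n" "coprime (z s) q" and i: "i < n" for C z s i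
  proof -
    let ?M = "c \<cdot>\<^sub>m 1\<^sub>m n - C"
    have M: "?M \<in> carrier_mat n n" using C by auto
    have F: "adj_mat ?M = mat_poly C f"
      unfolding f_def cpC[symmetric] by (rule adj_mat_eq_mat_poly[OF C(1)]) (use t cpC in \<open>simp add: c_def\<close>)
    have Fc: "mat_poly C f \<in> carrier_mat n n" using C by simp
    have "q dvd (\<Sum>j<n. adj_mat ?M $$ (i, j))"
    proof (rule adj_mat_row_sum_cong_0[OF M _ _ z i])
      fix r assume r: "r < n"
      have "(\<Sum>j<n. ?M $$ (r, j) * z j) = (\<Sum>j<n. (if j = r then c * z r else 0) - C $$ (r, j) * z j)"
        using r C by (intro sum.cong) (auto simp: algebra_simps)
      also have "\<dots> = c * z r - (\<Sum>j<n. C $$ (r, j) * z j)" using r by (simp add: sum_subtractf)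
      also have "[\<dots> = c * z r - c * z r] (mod q)"
      proof (rule cong_diff[OF cong_refl])
        show "[(\<Sum>j<n. C $$ (r, j) * z j) = c * z r] (mod q)"
          using cong_trans[OF eig[OF r] cong_mult[OF cc0 cong_refl]] .
      qed
      finally show "[(\<Sum>j<n. ?M $$ (r, j) * z j) = 0] (mod q)" by simp
    next
      fix r s assume "r < n" "s < n"
      then show "adj_mat ?M $$ (r, s) = adj_mat ?M $$ (s, r)"
        unfolding F using arg_cong[OF mat_poly_transpose[OF C, of f], of "\<lambda>M. M $$ (r, s)"] C(1) by simp
    qed
    then show ?thesis unfolding F mult_all_ones_entry[OF Fc i] .
  qed
  have rowsA: "q dvd (mat_poly A f *\<^sub>v all_ones n) $ i" if "i < n" for i
    by (rule rows[OF A cp _ sumx ab(1) cop(3) that]) (use Axc0 in \<open>simp add: Ax_def\<close>)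
  have rowsB: "q dvd (mat_poly B f *\<^sub>v all_ones n) $ i" if "i < n" for i
    by (rule rows[OF B refl _ sumy ab(2) cop(4) that]) (use Byc0 in \<open>simp add: By_def\<close>)
  \<comment> \<open>Only the top power is replaced. As f is monic of degree n - 1, the determinant
    does not change, while the last column becomes f(A) e; \<open>V\<close> below has this column
    divided by q.\<close>
  define \<beta> where "\<beta> = (\<lambda>j. if j < n - 1 then monom 1 j else f)"
  obtain T where T: "poly_walk n A \<beta> = poly_walk n A (monom 1) * T" "det T = 1" "unimodular n T"
  proof (rule poly_walk_eq_mult_monic[OF A(1), of \<beta>])
    fix j assume "j < n"
    then have "j = n - 1" if "\<not> j < n - 1" using that by auto
    then show "coeff (\<beta> j) j = 1" using monf by (auto simp: \<beta>_def)
  next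
    fix i j assume "j < n" "j < i"
    then show "coeff (\<beta> j) i = 0" using degf by (auto simp: \<beta>_def intro!: coeff_eq_0)
  qed
  then have detW: "det (poly_walk n A (monom 1)) = det (poly_walk n A \<beta>)"
    using det_mult[OF poly_walk_carrier unimodular_carrier[OF T(3)]] by simp
  define w where "w = (\<lambda>j. if j < n - 1 then 1 else q)"
  have w: "w j dvd (mat_poly C (\<beta> j) *\<^sub>v all_ones n) $ i" if "i < n" "C = A \<or> C = B" for C i j
    using rowsA rowsB that by (auto simp: w_def \<beta>_def)
  define V where "V = mat n n (\<lambda>(i, j). (mat_poly A (\<beta> j) *\<^sub>v all_ones n) $ i div w j)"
  have V: "V \<in> carrier_mat n n" by (simp add: V_def)
  have "poly_walk n A \<beta> = V * mat_diag n w"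
    unfolding mat_diag_mult_right[OF V]
    by (rule eq_matI) (use w in \<open>auto simp: V_def poly_walk_def\<close>)
  then have "det (poly_walk n A \<beta>) = det V * (\<Prod>j<n. w j)"
    using det_mult[OF V, of "mat_diag n w"] det_mat_diag[of n w] by simp
  also have "(\<Prod>j<n. w j) = q"
    using n prod.lessThan_Suc[of w "n - 1"] by (simp add: w_def)
  finally have detV: "det (poly_walk n A (monom 1)) = det V * q" using detW by simp
  \<comment> \<open>Row \<open>b\<close> of P^T V = l V', where V' is the integral counterpart of V
    for \<open>B\<close>, read modulo p: the left side is \<open>y b\<close> times x^T V, and p
    divides l.\<close>
  have "p dvd det V"
  proof (rule dvd_det_of_left_kernel[where x = x, OF V _ ab(1) cop(1)])
    fix j assume j: "j < n"
    have w0: "w j \<noteq> 0" using q0 by (simp add: w_def)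
    let ?v = "mat_poly A (\<beta> j) *\<^sub>v all_ones n" and ?v' = "mat_poly B (\<beta> j) *\<^sub>v all_ones n"
    have vc: "?v \<in> carrier_vec n" and vc': "?v' \<in> carrier_vec n"
      using A B mult_mat_vec_carrier[OF mat_poly_carrier all_ones_carrier] by blast+
    have "(\<Sum>i<n. P $$ (i, b) * V $$ (i, j)) * w j = (\<Sum>i<n. transpose_mat P $$ (b, i) * ?v $ i)"
      unfolding sum_distrib_right using w j ab(2) Pc by (intro sum.cong) (auto simp: V_def)
    also have "\<dots> = (transpose_mat P *\<^sub>v ?v) $ b" by (rule mult_mat_vec_entry[OF Pt vc ab(2), symmetric])
    also have "\<dots> = l * ?v' $ b" unfolding level_matrix_mult_walk[OF A B P]
      by (rule index_smult_vec(1)) (use ab(2) vc' in \<open>simp only: carrier_vecD\<close>)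
    also have "\<dots> = l * (?v' $ b div w j) * w j" using w[OF ab(2), of B j] by (simp add: mult.assoc)
    finally have "(\<Sum>i<n. P $$ (i, b) * V $$ (i, j)) = l * (?v' $ b div w j)" using w0 by simp
    then have "[(\<Sum>i<n. P $$ (i, b) * V $$ (i, j)) = 0] (mod p)" using pl by (simp add: cong_0_iff)
    moreover have "[y b * (\<Sum>i<n. x i * V $$ (i, j)) = (\<Sum>i<n. P $$ (i, b) * V $$ (i, j))] (mod p)"
      unfolding sum_distrib_left
    proof (rule cong_sum)
      fix i assume "i \<in> {..<n}"
      then have "[P $$ (i, b) = x i * y b] (mod p)"
        using cong_dvd_modulus[OF rank[OF _ ab(2)] pl] by simp
      then show "[y b * (x i * V $$ (i, j)) = P $$ (i, b) * V $$ (i, j)] (mod p)"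
        using cong_mult[OF cong_sym cong_refl, of "P $$ (i, b)" "x i * y b" p "V $$ (i, j)"]
        by (simp add: algebra_simps)
    qed
    ultimately have "[y b * (\<Sum>i<n. x i * V $$ (i, j)) = y b * 0] (mod p)" by (simp add: cong_def)
    then show "p dvd (\<Sum>i<n. x i * V $$ (i, j))"
      using cop(2) by (simp only: cong_mult_lcancel cong_0_iff)
  qed
  then show ?thesis unfolding detV q_def by (simp add: mult_dvd_mono)
qed

subsection \<open>A mate is determined by its level\<close>

definition inner :: "nat \<Rightarrow> (nat \<Rightarrow> int) \<Rightarrow> (nat \<Rightarrow> int) \<Rightarrow> int" where
  "inner n v w = (\<Sum>k<n. v k * w k)"

lemma inner_commute: "inner n v w = inner n w v"
  by (simp add: inner_def mult.commute)

lemma inner_add_scaled_left: "inner n (\<lambda>k. a * u k + b * v k) w = a * inner n u w + b * inner n v w"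
  by (simp add: inner_def sum.distrib sum_distrib_left algebra_simps)

lemma inner_add_scaled_right: "inner n w (\<lambda>k. a * u k + b * v k) = a * inner n w u + b * inner n w v"
  by (simp add: inner_commute[of n w] inner_add_scaled_left)

lemma even_inner_self_minus_sum: "even (inner n u u - (\<Sum>i<n. u i))"
  unfolding inner_def sum_subtractf[symmetric] by (rule dvd_sum) auto

lemma inner_mult_matrix:
  assumes P: "P \<in> carrier_mat n n" and PP: "transpose_mat P * P = (l * l) \<cdot>\<^sub>m 1\<^sub>m n"
  defines "r u \<equiv> \<lambda>k. \<Sum>j<n. P $$ (k, j) * u j"
  shows "i < n \<Longrightarrow> inner n (r u) (\<lambda>k. P $$ (k, i)) = l * l * u i"
    and "inner n (r u) (r v) = l * l * inner n u v"
proof -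
  have Pt: "transpose_mat P \<in> carrier_mat n n" using P by simp
  have col: "inner n (\<lambda>k. P $$ (k, j)) (\<lambda>k. P $$ (k, i)) = (if i = j then l * l else 0)" if "i < n" "j < n" for i j
    using mult_mat_entry[OF Pt P that(2,1)] that P unfolding PP by (auto simp: inner_def split: if_splits)
  have lin: "inner n (r u) w = (\<Sum>j<n. u j * inner n (\<lambda>k. P $$ (k, j)) w)" for u w
  proof -
    have "inner n (r u) w = (\<Sum>k<n. \<Sum>j<n. u j * (P $$ (k, j) * w k))"
      by (simp add: inner_def r_def sum_distrib_right sum_distrib_left algebra_simps)
    also have "\<dots> = (\<Sum>j<n. \<Sum>k<n. u j * (P $$ (k, j) * w k))" by (rule sum.swap)
    finally show ?thesis by (simp add: inner_def sum_distrib_left)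
  qed
  show 1: "inner n (r u) (\<lambda>k. P $$ (k, i)) = l * l * u i" if i: "i < n" for u i
  proof -
    have "inner n (r u) (\<lambda>k. P $$ (k, i)) = (\<Sum>j<n. if j = i then u i * (l * l) else 0)"
      unfolding lin
    proof (rule sum.cong[OF refl])
      fix j assume "j \<in> {..<n}"
      then have j: "j < n" by simp
      show "u j * inner n (\<lambda>k. P $$ (k, j)) (\<lambda>k. P $$ (k, i)) = (if j = i then u i * (l * l) else 0)"
        unfolding col[OF i j] by (cases "j = i") simp_all
    qed
    also have "\<dots> = l * l * u i" using i by simp
    finally show ?thesis .
  qed
  have "inner n (r u) (r v) = (\<Sum>j<n. v j * inner n (\<lambda>k. P $$ (k, j)) (r u))"
    unfolding inner_commute[of n "r u" "r v"] by (rule lin)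
  also have "\<dots> = (\<Sum>j<n. l * l * (u j * v j))"
  proof (rule sum.cong[OF refl])
    fix j assume "j \<in> {..<n}"
    then have "inner n (r u) (\<lambda>k. P $$ (k, j)) = l * l * u j" using 1 by blast
    then have "inner n (\<lambda>k. P $$ (k, j)) (r u) = l * l * u j" by (simp only: inner_commute)
    then show "v j * inner n (\<lambda>k. P $$ (k, j)) (r u) = l * l * (u j * v j)" by (simp only: mult_ac)
  qed
  finally show "inner n (r u) (r v) = l * l * inner n u v" by (simp add: inner_def sum_distrib_left)
qed

text \<open>\<open>l\<close> takes part as one more entry, so \<open>g\<close> is, up to sign, the
  gcd of \<open>l\<close> and all \<open>y j\<close>.\<close>

lemma bezout_sum:
  fixes y :: "nat \<Rightarrow> int"
  shows "\<exists>u v g. (\<Sum>j<n. y j * u j) + l * v = g \<and> g dvd l \<and> (\<forall>j<n. g dvd y j)"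
proof (induction n)
  case 0
  show ?case by (rule exI[of _ "\<lambda>_. 0"], rule exI[of _ 1], rule exI[of _ l]) auto
next
  case (Suc n)
  then obtain u v g where g: "(\<Sum>j<n. y j * u j) + l * v = g" "g dvd l" "\<forall>j<n. g dvd y j" by blast
  obtain a b where ab: "a * g + b * y n = gcd g (y n)" using bezout_int by blast
  let ?u = "\<lambda>j. if j = n then b else a * u j"
  have "(\<Sum>j<Suc n. y j * ?u j) + l * (a * v) = a * ((\<Sum>j<n. y j * u j) + l * v) + b * y n"
  proof -
    have "(\<Sum>j<n. y j * ?u j) = a * (\<Sum>j<n. y j * u j)"
      unfolding sum_distrib_left by (intro sum.cong) (auto simp: mult.left_commute)
    then show ?thesis by (simp add: distrib_left mult.left_commute mult.commute)
  qed
  also have "\<dots> = gcd g (y n)" unfolding g(1) ab ..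
  finally have "(\<Sum>j<Suc n. y j * ?u j) + l * (a * v) = gcd g (y n)" .
  moreover have "gcd g (y n) dvd l" using g(2) by (meson dvd_trans gcd_dvd1)
  moreover have "\<forall>j<Suc n. gcd g (y n) dvd y j" using g(3) by (auto simp: less_Suc_eq intro: dvd_trans[OF gcd_dvd1])
  ultimately show ?case
    by (intro exI[of _ ?u] exI[of _ "a * v"] exI[of _ "gcd g (y n)"] conjI)
qed

text \<open>Primitivity of \<open>P\<close> makes \<open>l\<close> and the \<open>y j\<close>
  jointly coprime, so a combination of the \<open>y j\<close> is 1 modulo \<open>l\<close>. The
  column space of \<open>P\<close> modulo \<open>l\<close> therefore contains x itself, whichever
  graph \<open>P\<close> belongs to.\<close>

lemma level_matrix_generator:
  assumes P: "level_matrix n A B l P"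
    and rank: "\<And>i j. i < n \<Longrightarrow> j < n \<Longrightarrow> [P $$ (i, j) = x i * y j] (mod l)"
  shows "\<exists>u. \<forall>i<n. [(\<Sum>j<n. P $$ (i, j) * u j) = x i] (mod l)"
proof -
  have prim: "\<And>d. d dvd l \<Longrightarrow> (\<forall>i<n. \<forall>j<n. d dvd P $$ (i, j)) \<Longrightarrow> is_unit d"
    using P by (auto simp: level_matrix_def)
  obtain u v g where g: "(\<Sum>j<n. y j * u j) + l * v = g" "g dvd l" "\<forall>j<n. g dvd y j"
    using bezout_sum[where n = n and y = y and l = l] by blast
  have "g dvd P $$ (i, j)" if "i < n" "j < n" for i j
    using cong_dvd_iff[OF cong_dvd_modulus[OF rank[OF that] g(2)]] g(3) that by simp
  then have "is_unit g" using prim g(2) by blast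
  \<comment> \<open>The sign of \<open>g\<close> is undetermined; scaling the coefficients by
    \<open>g\<close> turns the combination into 1, as g * g = 1.\<close>
  then have "g = 1 \<or> g = -1" by (simp add: zdvd1_eq) linarith
  then have gg: "g * g = 1" by auto
  have "[(\<Sum>j<n. y j * (g * u j)) = 1] (mod l)"
  proof -
    have "1 - (\<Sum>j<n. y j * (g * u j)) = g * (g - (\<Sum>j<n. y j * u j))"
      by (simp add: gg algebra_simps sum_distrib_left)
    also have "g - (\<Sum>j<n. y j * u j) = l * v" using g(1) by simp
    also have "g * (l * v) = l * (g * v)" by (rule mult.left_commute)
    finally have "l dvd 1 - (\<Sum>j<n. y j * (g * u j))" by (simp only: dvd_triv_left)
    then have "[1 = (\<Sum>j<n. y j * (g * u j))] (mod l)" by (simp only: cong_iff_dvd_diff)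
    then show ?thesis by (rule cong_sym)
  qed
  then have 1: "[x i * (\<Sum>j<n. y j * (g * u j)) = x i * 1] (mod l)" for i by (intro cong_mult cong_refl)
  have "[(\<Sum>j<n. P $$ (i, j) * (g * u j)) = x i] (mod l)" if i: "i < n" for i
  proof -
    have "[(\<Sum>j<n. P $$ (i, j) * (g * u j)) = x i * (\<Sum>j<n. y j * (g * u j))] (mod l)"
      unfolding sum_distrib_left
    proof (rule cong_sum)
      fix j assume "j \<in> {..<n}"
      then show "[P $$ (i, j) * (g * u j) = x i * (y j * (g * u j))] (mod l)"
        using cong_mult[OF rank[OF i, of j] cong_refl[of "g * u j"]] by (simp only: mult.assoc lessThan_iff)
    qed
    also note 1
    finally show ?thesis by simp
  qed
  then show ?thesis by (intro exI[of _ "\<lambda>j. g * u j"]) simp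
qed

text \<open>Local uniqueness at an odd prime only uses that norms are preserved; at 2 one also
  needs that \<open>e\<close> is a characteristic vector, i.e. \<open>z \<cdot> z \<equiv> e \<cdot> z (mod 2)\<close>, which is preserved
  because \<open>Q e = e\<close>. The argument below treats all primes at once.\<close>

lemma level_matrix_quotient_integral:
  assumes P: "level_matrix n A B l P" and R: "level_matrix n A C l R"
    and rankP: "\<And>i j. i < n \<Longrightarrow> j < n \<Longrightarrow> [P $$ (i, j) = x i * y j] (mod l)"
    and rankR: "\<And>i j. i < n \<Longrightarrow> j < n \<Longrightarrow> [R $$ (i, j) = x i * z j] (mod l)"
    and ij: "i < n" "j < n"
  shows "l * l dvd (transpose_mat P * R) $$ (i, j)"
proof -
  have Pc: "P \<in> carrier_mat n n" and Rc: "R \<in> carrier_mat n n" and l: "0 < l"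
    and PP: "transpose_mat P * P = (l * l) \<cdot>\<^sub>m 1\<^sub>m n" and RR: "transpose_mat R * R = (l * l) \<cdot>\<^sub>m 1\<^sub>m n"
    and Pe: "transpose_mat P *\<^sub>v all_ones n = l \<cdot>\<^sub>v all_ones n" and Re: "transpose_mat R *\<^sub>v all_ones n = l \<cdot>\<^sub>v all_ones n"
    using P R by (auto simp: level_matrix_def)
  obtain u where u: "\<And>i. i < n \<Longrightarrow> [(\<Sum>j<n. P $$ (i, j) * u j) = x i] (mod l)"
    using level_matrix_generator[OF P rankP] by blast
  obtain w where w: "\<And>i. i < n \<Longrightarrow> [(\<Sum>j<n. R $$ (i, j) * w j) = x i] (mod l)"
    using level_matrix_generator[OF R rankR] by blast
  define r where "r = (\<lambda>i. \<Sum>j<n. P $$ (i, j) * u j)"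
  define s where "s = (\<lambda>i. \<Sum>j<n. R $$ (i, j) * w j)"
  have rr: "inner n r r = l * l * inner n u u" and ss: "inner n s s = l * l * inner n w w"
    and ri: "inner n r (\<lambda>k. P $$ (k, i)) = l * l * u i" and sj: "inner n s (\<lambda>k. R $$ (k, j)) = l * l * w j"
    unfolding r_def s_def
    by (rule inner_mult_matrix[OF Pc PP] inner_mult_matrix[OF Rc RR] ij)+
  \<comment> \<open>Both r and s are congruent to x modulo \<open>l\<close>, so the lattice vectors
    r / l and s / l differ by the integer vector m.\<close>
  define m where "m = (\<lambda>i. (r i - s i) div l)"
  have s: "s i = 1 * r i + (- l) * m i" if "i < n" for i
  proof -
    have "l dvd r i - s i"
      using cong_trans[OF u[OF that] cong_sym[OF w[OF that]]] by (simp add: cong_iff_dvd_diff r_def s_def)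
    then show ?thesis by (simp add: m_def)
  qed
  have inner_s: "inner n s v = inner n r v - l * inner n m v" for v
  proof -
    have "inner n s v = inner n (\<lambda>i. 1 * r i + (- l) * m i) v" by (simp add: inner_def s)
    then show ?thesis unfolding inner_add_scaled_left by simp
  qed
  have sum_col: "(\<Sum>i<n. \<Sum>j<n. M $$ (i, j) * v j) = l * (\<Sum>j<n. v j)"
    if M: "M \<in> carrier_mat n n" and e: "transpose_mat M *\<^sub>v all_ones n = l \<cdot>\<^sub>v all_ones n" for M v
  proof -
    have Mt: "transpose_mat M \<in> carrier_mat n n" using M by simp
    have c: "(\<Sum>i<n. M $$ (i, j)) = l" if "j < n" for j
      using mult_all_ones_entry[OF Mt that] that M unfolding e by simp
    have "(\<Sum>i<n. \<Sum>j<n. M $$ (i, j) * v j) = (\<Sum>j<n. \<Sum>i<n. M $$ (i, j) * v j)" by (rule sum.swap)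
    also have "\<dots> = (\<Sum>j<n. l * v j)" by (intro sum.cong) (auto simp: c simp flip: sum_distrib_right)
    finally show ?thesis by (simp add: sum_distrib_left)
  qed
  have "(\<Sum>i<n. s i) = (\<Sum>i<n. r i - l * m i)" by (intro sum.cong) (auto simp: s)
  moreover have "(\<Sum>i<n. s i) = l * (\<Sum>i<n. w i)" unfolding s_def by (rule sum_col[OF Rc Re])
  moreover have "(\<Sum>i<n. r i) = l * (\<Sum>i<n. u i)" unfolding r_def by (rule sum_col[OF Pc Pe])
  ultimately have "l * (\<Sum>i<n. w i) = l * (\<Sum>i<n. u i) - l * (\<Sum>i<n. m i)"
    by (simp only: sum_subtractf sum_distrib_left)
  then have "l * (\<Sum>i<n. w i) = l * ((\<Sum>i<n. u i) - (\<Sum>i<n. m i))" by (simp add: algebra_simps)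
  then have sums: "(\<Sum>i<n. w i) = (\<Sum>i<n. u i) - (\<Sum>i<n. m i)" using l by simp
  have sr: "inner n r s = inner n r r - l * inner n r m"
    using inner_s[of r] inner_commute[of n s r] inner_commute[of n m r] by simp
  have ms: "inner n m s = inner n r m - l * inner n m m"
    using inner_s[of m] inner_commute[of n s m] by simp
  \<comment> \<open>Expanding the norm of s = r - l m shows that \<open>l\<close> divides 2 r.m;
    what remains is to remove the factor 2.\<close>
  have "l * l * inner n w w = l * l * inner n u u - 2 * l * inner n r m + l * l * inner n m m"
    unfolding ss[symmetric] rr[symmetric] inner_s[of s] sr ms by (simp add: algebra_simps)
  then have "l * (2 * inner n r m) = l * (l * (inner n u u - inner n w w + inner n m m))"
    by (simp add: algebra_simps)
  then have 2: "2 * inner n r m = l * (inner n u u - inner n w w + inner n m m)" using l by simp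
  \<comment> \<open>Each difference of norm and coordinate sum is even, and by \<open>sums\<close>
    the coordinate sums of u, w and m combine to an even number, so the bracket in \<open>2\<close>
    is even.\<close>
  have "even ((inner n u u - (\<Sum>i<n. u i)) - (inner n w w - (\<Sum>i<n. w i)) + (inner n m m - (\<Sum>i<n. m i)) + 2 * (\<Sum>i<n. m i))"
    by (intro dvd_add dvd_diff even_inner_self_minus_sum) simp
  then have "even (inner n u u - inner n w w + inner n m m)" unfolding sums by (simp add: algebra_simps)
  then obtain t where "inner n u u - inner n w w + inner n m m = 2 * t" by blast
  with 2 have rm: "inner n r m = l * t" by simp
  have rs: "inner n r s = l * l * (inner n u u - t)"
    unfolding sr rr rm by (simp add: algebra_simps)
  \<comment> \<open>Modulo \<open>l\<close> each column of \<open>P\<close> is a multiple of r and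
    each column of \<open>R\<close> a multiple of s. Expanding the inner product leaves r.s, l r.b,
    l s.a and l^2 a.b, so r.b and s.a must each supply one more factor \<open>l\<close>.\<close>
  define a where "a = (\<lambda>k. (P $$ (k, i) - y i * r k) div l)"
  have Pa: "P $$ (k, i) = y i * r k + l * a k" if "k < n" for k
  proof -
    have "[P $$ (k, i) = y i * r k] (mod l)"
      using cong_trans[OF rankP[OF that ij(1)] cong_mult[OF cong_sym[OF u[OF that]] cong_refl[of "y i"]]]
      by (simp add: r_def mult.commute)
    then show ?thesis by (simp add: a_def cong_iff_dvd_diff)
  qed
  define b where "b = (\<lambda>k. (R $$ (k, j) - z j * s k) div l)"
  have Rb: "R $$ (k, j) = z j * s k + l * b k" if "k < n" for k
  proof -
    have "[R $$ (k, j) = z j * s k] (mod l)"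
      using cong_trans[OF rankR[OF that ij(2)] cong_mult[OF cong_sym[OF w[OF that]] cong_refl[of "z j"]]]
      by (simp add: s_def mult.commute)
    then show ?thesis by (simp add: b_def cong_iff_dvd_diff)
  qed
  have innerP: "inner n v (\<lambda>k. P $$ (k, i)) = y i * inner n v r + l * inner n v a" for v
    unfolding inner_add_scaled_right[symmetric] by (simp add: inner_def Pa)
  have innerR: "inner n v (\<lambda>k. R $$ (k, j)) = z j * inner n v s + l * inner n v b" for v
    unfolding inner_add_scaled_right[symmetric] by (simp add: inner_def Rb)
  have "l * inner n r a = l * (l * (u i - y i * inner n u u))"
    using ri unfolding innerP rr by (simp add: algebra_simps)
  then have ra: "inner n r a = l * (u i - y i * inner n u u)" using l by simp
  have "l * inner n s b = l * (l * (w j - z j * inner n w w))"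
    using sj unfolding innerR ss by (simp add: algebra_simps)
  then have sb: "inner n s b = l * (w j - z j * inner n w w)" using l by simp
  have rb: "inner n r b = l * (w j - z j * inner n w w + inner n m b)"
    using inner_s[of b] sb by (simp add: algebra_simps)
  have sa: "inner n s a = l * (u i - y i * inner n u u - inner n m a)"
    unfolding inner_s ra by (simp add: algebra_simps)
  have "(transpose_mat P * R) $$ (i, j) = inner n (\<lambda>k. R $$ (k, j)) (\<lambda>k. P $$ (k, i))"
    using mult_mat_entry[of "transpose_mat P" n n R n i j] Pc Rc ij by (simp add: inner_def mult.commute)
  also have "\<dots> = y i * (z j * inner n r s + l * inner n r b) + l * (z j * inner n s a + l * inner n a b)"
    unfolding innerP inner_commute[of n "\<lambda>k. R $$ (k, j)" r] inner_commute[of n "\<lambda>k. R $$ (k, j)" a]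
      innerR inner_commute[of n a s] ..
  also have "\<dots> = l * l * (y i * (z j * (inner n u u - t) + (w j - z j * inner n w w + inner n m b))
      + (z j * (u i - y i * inner n u u - inner n m a) + inner n a b))"
    unfolding rs rb sa by (simp add: algebra_simps)
  finally show ?thesis by simp
qed

text \<open>Integers satisfy s <= s^2, with equality only for 0 and 1; equal sums force equality
  term by term. The prescribed sum excludes a single entry -1.\<close>

lemma sum_squares_eq_1_imp:
  fixes s :: "nat \<Rightarrow> int"
  assumes sq: "(\<Sum>j<n. s j * s j) = 1" and sum: "(\<Sum>j<n. s j) = 1"
  obtains c where "c < n" "\<And>j. j < n \<Longrightarrow> s j = (if j = c then 1 else 0)"
proof -
  have nonneg: "0 \<le> s j * s j - s j" for j
    by (cases "s j \<le> 0") (auto simp: mult_nonpos_nonpos mult_le_cancel_right1 intro: add_nonneg_nonneg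
        order_trans[OF _ zero_le_square])
  have "(\<Sum>j<n. s j * s j - s j) = 0" using sq sum by (simp add: sum_subtractf)
  then have "\<forall>j<n. s j * s j - s j = 0" using nonneg by (subst (asm) sum_nonneg_eq_0_iff) auto
  then have 01: "s j = 0 \<or> s j = 1" if "j < n" for j
    using that by (metis mult_cancel_right1 right_minus_eq mult.commute mult_cancel_left1)
  have "(\<Sum>j<n. s j) = (\<Sum>j\<in>{j. j < n \<and> s j = 1}. 1)"
    by (rule sum.mono_neutral_cong_right) (use 01 in auto)
  then have "card {j. j < n \<and> s j = 1} = 1" using sum by simp
  then obtain c where c: "{j. j < n \<and> s j = 1} = {c}" by (auto simp: card_1_singleton_iff)
  show thesis
  proof (rule that[of c])
    show "c < n" using c by blast
    show "s j = (if j = c then 1 else 0)" if "j < n" for j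
      using 01[OF that] c that by auto
  qed
qed

text \<open>With Q = P / l and Q' = R / l, the matrix \<open>S\<close> is Q^T Q'. It is integral by
  \<open>level_matrix_quotient_integral\<close>, orthogonal, and has row sums 1, hence is a
  permutation matrix; B S = S C makes the permutation an isomorphism.\<close>

lemma level_matrix_unique:
  assumes A: "A \<in> carrier_mat n n" and B: "B \<in> carrier_mat n n" and C: "C \<in> carrier_mat n n"
    and P: "level_matrix n A B l P" and R: "level_matrix n A C l R"
    and rankP: "\<And>i j. i < n \<Longrightarrow> j < n \<Longrightarrow> [P $$ (i, j) = x i * y j] (mod l)"
    and rankR: "\<And>i j. i < n \<Longrightarrow> j < n \<Longrightarrow> [R $$ (i, j) = x i * z j] (mod l)"
  obtains f where "bij_betw f {..<n} {..<n}" "\<And>i j. i < n \<Longrightarrow> j < n \<Longrightarrow> B $$ (i, j) = C $$ (f i, f j)"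
proof -
  have Pc: "P \<in> carrier_mat n n" and Rc: "R \<in> carrier_mat n n" and l: "0 < l"
    and PP: "transpose_mat P * P = (l * l) \<cdot>\<^sub>m 1\<^sub>m n" and RR: "R * transpose_mat R = (l * l) \<cdot>\<^sub>m 1\<^sub>m n"
    and AP: "A * P = P * B" and AR: "A * R = R * C"
    and PPt: "P * transpose_mat P = (l * l) \<cdot>\<^sub>m 1\<^sub>m n"
    and Pe: "transpose_mat P *\<^sub>v all_ones n = l \<cdot>\<^sub>v all_ones n" and Re: "R *\<^sub>v all_ones n = l \<cdot>\<^sub>v all_ones n"
    using P R by (auto simp: level_matrix_def)
  have Pt: "transpose_mat P \<in> carrier_mat n n" and Rt: "transpose_mat R \<in> carrier_mat n n" using Pc Rc by auto
  let ?l2 = "l * l"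
  have l2: "?l2 \<noteq> 0" using l by simp
  define S where "S = mat n n (\<lambda>(i, j). (transpose_mat P * R) $$ (i, j) div ?l2)"
  have S: "S \<in> carrier_mat n n" and St: "transpose_mat S \<in> carrier_mat n n" by (simp_all add: S_def)
  have PR: "transpose_mat P * R = ?l2 \<cdot>\<^sub>m S"
  proof (rule eq_matI)
    fix i j assume "i < dim_row (?l2 \<cdot>\<^sub>m S)" "j < dim_col (?l2 \<cdot>\<^sub>m S)"
    then have ij: "i < n" "j < n" using S by auto
    have "?l2 dvd (transpose_mat P * R) $$ (i, j)"
      by (rule level_matrix_quotient_integral[OF P R rankP rankR ij])
    then show "(transpose_mat P * R) $$ (i, j) = (?l2 \<cdot>\<^sub>m S) $$ (i, j)"
      using ij S by (simp add: S_def del: index_mult_mat(1))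
  qed (use Pc Rc S in auto)
  have R_eq: "R = P * S"
  proof (rule smult_mat_cancel[OF _ l2])
    have "?l2 \<cdot>\<^sub>m R = (P * transpose_mat P) * R"
      unfolding PPt using Rc by (simp add: mult_smult_assoc_mat[OF one_carrier_mat Rc])
    also have "\<dots> = P * (?l2 \<cdot>\<^sub>m S)" unfolding PR[symmetric] by (rule assoc_mult_mat[OF Pc Pt Rc])
    also have "\<dots> = ?l2 \<cdot>\<^sub>m (P * S)" by (rule mult_smult_distrib[OF Pc S])
    finally show "?l2 \<cdot>\<^sub>m R = ?l2 \<cdot>\<^sub>m (P * S)" .
  qed (use Rc Pc S in auto)
  have dP: "det P \<noteq> 0"
    using arg_cong[OF PPt, of det] det_mult[OF Pc Pt] l by auto
  have SS: "S * transpose_mat S = 1\<^sub>m n"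
  proof (rule mult_mat_left_cancel[OF _ Pc dP])
    have "P * (S * transpose_mat S) = R * transpose_mat S"
      unfolding R_eq by (rule assoc_mult_mat[OF Pc S St, symmetric])
    moreover have "R * transpose_mat S = P"
    proof (rule smult_mat_cancel[OF _ l2])
      have "?l2 \<cdot>\<^sub>m (R * transpose_mat S) = R * (?l2 \<cdot>\<^sub>m transpose_mat S)"
        by (rule mult_smult_distrib[OF Rc St, symmetric])
      also have "?l2 \<cdot>\<^sub>m transpose_mat S = transpose_mat (?l2 \<cdot>\<^sub>m S)" by (rule eq_matI) (use S in auto)
      also have "\<dots> = transpose_mat R * P"
        unfolding PR[symmetric] transpose_mult[OF Pt Rc] by simp
      also have "R * (transpose_mat R * P) = (R * transpose_mat R) * P"
        by (rule assoc_mult_mat[OF Rc Rt Pc, symmetric])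
      also have "\<dots> = ?l2 \<cdot>\<^sub>m P"
        unfolding RR using Pc by (simp add: mult_smult_assoc_mat[OF one_carrier_mat Pc])
      finally show "?l2 \<cdot>\<^sub>m (R * transpose_mat S) = ?l2 \<cdot>\<^sub>m P" .
    qed (use Rc St Pc in auto)
    ultimately show "P * (S * transpose_mat S) = P * 1\<^sub>m n" using Pc by simp
  qed (use S St in auto)
  have BS: "B * S = S * C"
  proof (rule mult_mat_left_cancel[OF _ Pc dP])
    have "P * (B * S) = A * (P * S)"
      using assoc_mult_mat[OF Pc B S] assoc_mult_mat[OF A Pc S] AP by simp
    also have "\<dots> = P * (S * C)"
      unfolding R_eq[symmetric] AR using assoc_mult_mat[OF Pc S C] R_eq by simp
    finally show "P * (B * S) = P * (S * C)" .
  qed (use B S C in auto)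
  have rows: "(\<Sum>j<n. S $$ (i, j) * S $$ (i', j)) = (if i = i' then 1 else 0)" if "i < n" "i' < n" for i i'
    using mult_mat_entry[OF S St that] S that unfolding SS by simp
  have rowsum: "(\<Sum>j<n. S $$ (i, j)) = 1" if i: "i < n" for i
  proof -
    have "transpose_mat P *\<^sub>v (R *\<^sub>v all_ones n) = (?l2 \<cdot>\<^sub>m S) *\<^sub>v all_ones n"
      unfolding PR[symmetric] by (rule assoc_mult_mat_vec[OF Pt Rc all_ones_carrier, symmetric])
    then have "(transpose_mat P *\<^sub>v (l \<cdot>\<^sub>v all_ones n)) $ i = ?l2 * (\<Sum>j<n. S $$ (i, j))"
      unfolding Re using mult_all_ones_entry[of "?l2 \<cdot>\<^sub>m S" n i] S i
      by (simp add: sum_distrib_left del: index_mult_mat_vec)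
    moreover have "(transpose_mat P *\<^sub>v (l \<cdot>\<^sub>v all_ones n)) $ i = l * (transpose_mat P *\<^sub>v all_ones n) $ i"
      using mult_mat_vec_entry[OF Pt _ i, of "l \<cdot>\<^sub>v all_ones n"] mult_all_ones_entry[OF Pt i]
      by (simp add: sum_distrib_left mult.commute del: index_mult_mat_vec)
    moreover have "(transpose_mat P *\<^sub>v all_ones n) $ i = l" unfolding Pe using i by simp
    ultimately have "?l2 * (\<Sum>j<n. S $$ (i, j)) = ?l2 * 1" by simp
    then show ?thesis using l2 by (simp only: mult_cancel_left) simp
  qed
  have "\<exists>c. c < n \<and> (\<forall>j<n. S $$ (i, j) = (if j = c then 1 else 0))" if i: "i < n" for i
  proof -
    have "(\<Sum>j<n. S $$ (i, j) * S $$ (i, j)) = 1" using rows[OF i i] by simp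
    then obtain c where "c < n" "\<And>j. j < n \<Longrightarrow> S $$ (i, j) = (if j = c then 1 else 0)"
      using sum_squares_eq_1_imp[where n = n and s = "\<lambda>j. S $$ (i, j)"] rowsum[OF i] by blast
    then show ?thesis by blast
  qed
  then obtain f where f: "\<And>i. i < n \<Longrightarrow> f i < n"
    "\<And>i j. i < n \<Longrightarrow> j < n \<Longrightarrow> S $$ (i, j) = (if j = f i then 1 else 0)"
    by metis
  have inj: "inj_on f {..<n}"
  proof (rule inj_onI)
    fix i i' assume "i \<in> {..<n}" "i' \<in> {..<n}" and eq: "f i = f i'"
    then have ii: "i < n" "i' < n" by auto
    have "(\<Sum>j<n. S $$ (i, j) * S $$ (i', j)) = (\<Sum>j<n. if j = f i then 1 else 0)"
      using f ii eq by (intro sum.cong) auto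
    then show "i = i'" using rows[OF ii] f(1)[OF ii(1)] by (auto split: if_splits)
  qed
  have "f ` {..<n} \<subseteq> {..<n}" using f(1) by auto
  with inj have bij: "bij_betw f {..<n} {..<n}" by (simp add: bij_betw_def endo_inj_surj)
  have "B $$ (i, j) = C $$ (f i, f j)" if ij: "i < n" "j < n" for i j
  proof -
    have "(B * S) $$ (i, f j) = (\<Sum>k<n. if k = j then B $$ (i, j) else 0)"
      unfolding mult_mat_entry[OF B S ij(1) f(1)[OF ij(2)]]
      using f ij inj by (intro sum.cong) (auto simp: inj_on_def)
    moreover have "(S * C) $$ (i, f j) = (\<Sum>k<n. if k = f i then C $$ (f i, f j) else 0)"
      unfolding mult_mat_entry[OF S C ij(1) f(1)[OF ij(2)]]
      using f ij by (intro sum.cong) auto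
    ultimately show ?thesis using BS ij f(1)[OF ij(1)] by simp
  qed
  with bij that show thesis by blast
qed

subsection \<open>Counting levels\<close>

context
  fixes m :: nat and p k :: "nat \<Rightarrow> nat"
  assumes p: "\<And>j. j \<in> {1..m} \<Longrightarrow> prime (p j)" and inj: "inj_on p {1..m}"
begin

lemma prime_power_Suc_not_dvd_prod:
  assumes j: "j \<in> {1..m}"
  shows "\<not> p j ^ Suc (k j) dvd (\<Prod>j=1..m. p j ^ k j)"
proof
  assume "p j ^ Suc (k j) dvd (\<Prod>j=1..m. p j ^ k j)"
  then have "p j ^ k j * p j dvd p j ^ k j * (\<Prod>i\<in>{1..m} - {j}. p i ^ k i)"
    unfolding prod.remove[OF finite_atLeastAtMost j] power_Suc2 .
  moreover have "0 < p j ^ k j" using prime_gt_0_nat[OF p[OF j]] by simp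
  ultimately have "p j dvd (\<Prod>i\<in>{1..m} - {j}. p i ^ k i)"
    by (rule dvd_mult_cancel)
  then have "\<exists>i\<in>{1..m} - {j}. p j dvd p i ^ k i"
    unfolding prime_dvd_prod_iff[OF finite_Diff[OF finite_atLeastAtMost] p[OF j]] .
  then obtain i where i: "i \<in> {1..m}" "i \<noteq> j" "p j dvd p i ^ k i" by blast
  have "p j = p i"
    by (rule primes_dvd_imp_eq[OF p[OF j] p[OF i(1)] prime_dvd_power[OF p[OF j] i(3)]])
  from inj_onD[OF inj this j i(1)] i(2) show False by blast
qed

text \<open>Such a divisor is determined by its exponents at the \<open>p j\<close>, and the
  exponent at \<open>p j\<close> takes one of the \<open>k j\<close> values below
  \<open>k j\<close>.\<close>

lemma card_restricted_divisors:
  defines "D \<equiv> {l. l dvd (\<Prod>j=1..m. p j ^ k j) \<and> (\<forall>j\<in>{1..m}. \<not> p j ^ k j dvd l)}"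
  shows "finite D" and "card D \<le> (\<Prod>j=1..m. k j)"
proof -
  define N where "N = (\<Prod>j=1..m. p j ^ k j)"
  have N: "0 < N" unfolding N_def using p by (intro prod_pos) (auto simp: prime_gt_0_nat)
  have "D \<subseteq> {l. l dvd N}" by (auto simp: D_def N_def)
  then show "finite D" by (rule finite_subset) (rule finite_divisors_nat[OF N])
  \<comment> \<open>Restriction to the index set makes the exponent vectors extensional, so they lie
    in a finite product of function values.\<close>
  define g where "g = (\<lambda>l. \<lambda>j\<in>{1..m}. multiplicity (p j) l)"
  have "inj_on g D"
  proof (rule inj_onI)
    fix l l' assume l: "l \<in> D" "l' \<in> D" and eq: "g l = g l'"
    have dvd: "l dvd N" "l' dvd N" using l by (auto simp: D_def N_def)
    have pos: "0 < l" "0 < l'" using dvd_pos_nat[OF N] dvd by blast+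
    show "l = l'"
    proof (rule multiplicity_eq_nat[OF pos])
      fix q :: nat assume q: "prime q"
      show "multiplicity q l = multiplicity q l'"
      proof (cases "q \<in> p ` {1..m}")
        case True
        then obtain j where "j \<in> {1..m}" "q = p j" by auto
        then show ?thesis using fun_cong[OF eq, of j] by (simp add: g_def)
      next
        case False
        have "\<not> q dvd N"
        proof
          assume "q dvd N"
          then have "\<exists>i\<in>{1..m}. q dvd p i ^ k i"
            unfolding N_def prime_dvd_prod_iff[OF finite_atLeastAtMost q] .
          then obtain i where i: "i \<in> {1..m}" "q dvd p i ^ k i" by blast
          have "q = p i" by (rule primes_dvd_imp_eq[OF q p[OF i(1)] prime_dvd_power[OF q i(2)]])
          then show False using False i by auto
        qed
        then have "\<not> q dvd l" "\<not> q dvd l'" using dvd_trans[OF _ dvd(1), of q] dvd_trans[OF _ dvd(2), of q] by auto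
        then show ?thesis by (simp add: not_dvd_imp_multiplicity_0)
      qed
    qed
  qed
  moreover have "g ` D \<subseteq> (\<Pi>\<^sub>E j\<in>{1..m}. {..<k j})"
  proof (rule image_subsetI, rule PiE_I)
    fix l j assume l: "l \<in> D" and j: "j \<in> {1..m}"
    have "\<not> p j ^ k j dvd l" using l j unfolding D_def by blast
    moreover have "l \<noteq> 0" using l N unfolding D_def N_def[symmetric] by auto
    moreover have "\<not> is_unit (p j)" using p[OF j] by (simp add: prime_nat_iff)
    ultimately have "multiplicity (p j) l < k j" by (intro multiplicity_lessI)
    then show "g l j \<in> {..<k j}" using j unfolding g_def by (simp only: restrict_apply if_True lessThan_iff)
  next
    fix l j assume "j \<notin> {1..m}"
    then show "g l j = undefined" unfolding g_def by (simp only: restrict_apply if_False)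
  qed
  moreover have "finite (\<Pi>\<^sub>E j\<in>{1..m}. {..<k j})" by (intro finite_PiE) simp_all
  ultimately have "card D \<le> card (\<Pi>\<^sub>E j\<in>{1..m}. {..<k j})" by (rule card_inj_on_le)
  then show "card D \<le> (\<Prod>j=1..m. k j)" by (simp add: card_PiE)
qed

end

section \<open>From the family to the bound on mates\<close>

lemma hollow_symmetric_adjacency_matrix:
  "G \<in> simple_graphs n \<Longrightarrow> hollow_symmetric n (adjacency_matrix n G)"
  using adjacency_matrix_symmetric[of G n]
  by (auto simp: hollow_symmetric_def adjacency_matrix_def simple_graphs_def irrefl_def)

text \<open>Both \<open>\<delta>\<close> and \<open>x\<close> come from the Smith form of the halved
  walk matrix of \<open>G\<close> alone and are fixed before \<open>H\<close>, \<open>l\<close> and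
  \<open>P\<close>. This uniformity allows different mates of one level to be compared.\<close>

lemma graph_family_levels:
  assumes G: "G \<in> graph_family n"
  defines "A \<equiv> adjacency_matrix n G"
  obtains \<delta> x where "0 < \<delta>" "int (invariant_factor (walk_matrix n G) n) = 2 * \<delta>"
    "\<bar>det (walk_matrix n G)\<bar> = 2 ^ (n div 2) * \<delta>"
    "\<And>H l P. H \<in> simple_graphs n \<Longrightarrow> generalized_cospectral n G H \<Longrightarrow>
      level_matrix n A (adjacency_matrix n H) l P \<Longrightarrow>
      l dvd \<delta> \<and> (\<exists>y. \<forall>i<n. \<forall>j<n. [P $$ (i, j) = x i * y j] (mod l))"
proof -
  define m where "m = (n + 1) div 2"
  let ?W = "walk_matrix n G" and ?d = "invariant_factor (walk_matrix n G)"
  have Gs: "G \<in> simple_graphs n" and n: "2 \<le> n" and dW: "det ?W \<noteq> 0"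
    and dn1: "?d (n - 1) = 2" and dm': "?d (nat \<lceil>real n / 2\<rceil>) = 1"
    using G by (auto simp: graph_family_def controllable_def)
  have "nat \<lceil>real n / 2\<rceil> = m" unfolding m_def by linarith
  with dm' have dm: "?d m = 1" by simp
  have m: "0 < m" "m < n" using n by (auto simp: m_def)
  have A: "hollow_symmetric n A" unfolding A_def by (rule hollow_symmetric_adjacency_matrix[OF Gs])
  have Ac: "A \<in> carrier_mat n n" and sA: "transpose_mat A = A" using A by (auto simp: hollow_symmetric_def)
  have W: "?W = poly_walk n A (monom 1)" unfolding A_def by (rule walk_matrix_eq_poly_walk)
  have Wc: "?W \<in> carrier_mat n n" unfolding W by simp
  obtain \<theta> where \<theta>: "coeff \<theta> m = 1" "\<And>i. m < i \<Longrightarrow> coeff \<theta> i = 0"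
    and ev: "\<And>B i. hollow_symmetric n B \<Longrightarrow> char_poly B = char_poly A \<Longrightarrow> i < n \<Longrightarrow>
      even ((mat_poly B \<theta> *\<^sub>v all_ones n) $ i)"
    using even_walk_poly_exists[OF A] unfolding m_def by blast
  let ?X = "half_walk n A m \<theta>"
  obtain T where T: "unimodular n T" "poly_walk n A (half_basis m \<theta>) = poly_walk n A (monom 1) * T"
  proof (rule poly_walk_eq_mult_monic[OF Ac, of "half_basis m \<theta>"])
    show "coeff (half_basis m \<theta> j) j = 1" if "j < n" for j
      using \<theta>(1) by (auto simp: half_basis_def coeff_monom_mult)
    show "coeff (half_basis m \<theta> j) i = 0" if "j < n" "j < i" for i j
      using \<theta>(2) that by (auto simp: half_basis_def coeff_monom_mult)
  qed
  have WT: "?W * T = ?X * mat_diag n (\<lambda>j. if j < m then 1 else 2)"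
    unfolding W T(2)[symmetric] by (rule half_walk_mult_diag[OF Ac ev[OF A refl], symmetric])
  obtain U V \<delta> where U: "unimodular n U" and V: "unimodular n V" and \<delta>: "0 < \<delta>" "int (?d n) = 2 * \<delta>"
    and D: "U * ?X * V = mat_diag n (\<lambda>i. if i < n - 1 then 1 else \<delta>)" and det: "\<bar>det ?W\<bar> = 2 ^ (n - m) * \<delta>"
    by (rule smith_normal_form_of_half[OF Wc dW is_smith_diagonal_invariant_factor[OF Wc dW] m dm dn1 T(1)
      half_walk_carrier WT])
  obtain Z where Z: "Z \<in> carrier_mat n n" "?X * Z = \<delta> \<cdot>\<^sub>m 1\<^sub>m n"
    by (rule right_inverse_of_smith[OF half_walk_carrier U V D, of \<delta>]) auto
  have "n - m = n div 2" unfolding m_def by presburger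
  with det have det': "\<bar>det ?W\<bar> = 2 ^ (n div 2) * \<delta>" by simp
  have lev: "l dvd \<delta> \<and> (\<exists>y. \<forall>i<n. \<forall>j<n. [P $$ (i, j) = U $$ (n - 1, i) * y j] (mod l))"
    if H: "H \<in> simple_graphs n" and cos: "generalized_cospectral n G H"
      and P: "level_matrix n A (adjacency_matrix n H) l P" for H l P
  proof -
    let ?B = "adjacency_matrix n H"
    have B: "hollow_symmetric n ?B" by (rule hollow_symmetric_adjacency_matrix[OF H])
    have Bc: "?B \<in> carrier_mat n n" and sB: "transpose_mat ?B = ?B" using B by (auto simp: hollow_symmetric_def)
    have cp: "char_poly ?B = char_poly A"
      unfolding A_def by (rule generalized_cospectral_sum_mat_eq(1)[OF Gs H cos, symmetric])
    have eq: "transpose_mat P * ?X = l \<cdot>\<^sub>m half_walk n ?B m \<theta>"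
      by (rule level_matrix_mult_half_walk[OF Ac sA Bc sB ev[OF A refl] ev[OF B cp] P])
    have Pc: "P \<in> carrier_mat n n" using P by (simp add: level_matrix_def)
    have n0: "0 < n" using n by simp
    obtain y where "\<And>i j. i < n \<Longrightarrow> j < n \<Longrightarrow> [P $$ (i, j) = U $$ (n - 1, i) * y j] (mod l)"
      using level_matrix_rank_one[OF half_walk_carrier U V n0 D Pc half_walk_carrier eq] by blast
    moreover have "l dvd \<delta>" by (rule level_dvd[OF half_walk_carrier Z P half_walk_carrier eq])
    ultimately show ?thesis by blast
  qed
  show thesis by (rule that[OF \<delta> det' lev])
qed

lemma level_matrix_one:
  assumes "A \<in> carrier_mat n n"
  shows "level_matrix n A A 1 (1\<^sub>m n)"
  using assms by (auto simp: level_matrix_def)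

theorem theorem1p2:
  fixes n m :: nat and G :: graph and p k :: "nat \<Rightarrow> nat"
  assumes "G \<in> graph_family n"
    and "\<And>j. j \<in> {1..m} \<Longrightarrow> prime (p j)"
    and "inj_on p {1..m}"
    and "\<And>j. j \<in> {1..m} \<Longrightarrow> 1 \<le> k j"
    and "invariant_factor (walk_matrix n G) n = (\<Prod>j=1..m. p j ^ k j)"
  shows "number_of_mates n G \<le> (\<Prod>j=1..m. k j) - 1"
proof -
  note p = assms(2) and inj = assms(3) and k = assms(4)
  define A where "A = adjacency_matrix n G"
  define N where "N = (\<Prod>j=1..m. p j ^ k j)"
  obtain \<delta> x where \<delta>: "0 < \<delta>" "int N = 2 * \<delta>" and det: "\<bar>det (walk_matrix n G)\<bar> = 2 ^ (n div 2) * \<delta>"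
    and lev: "\<And>H l P. H \<in> simple_graphs n \<Longrightarrow> generalized_cospectral n G H \<Longrightarrow>
      level_matrix n A (adjacency_matrix n H) l P \<Longrightarrow>
      l dvd \<delta> \<and> (\<exists>y. \<forall>i<n. \<forall>j<n. [P $$ (i, j) = x i * y j] (mod l))"
    using graph_family_levels[OF assms(1)] unfolding A_def N_def assms(5) by blast
  have G: "G \<in> simple_graphs n" and n: "0 < n" and dW: "det (walk_matrix n G) \<noteq> 0"
    using assms(1) by (auto simp: graph_family_def controllable_def)
  have Ac: "A \<in> carrier_mat n n" and sA: "transpose_mat A = A"
    unfolding A_def using adjacency_matrix_symmetric[OF G] by auto
  have W: "walk_matrix n G = poly_walk n A (monom 1)" unfolding A_def by (rule walk_matrix_eq_poly_walk)
  let ?cos = "\<lambda>H. H \<in> simple_graphs n \<and> generalized_cospectral n G H"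
  let ?B = "adjacency_matrix n"
  have ex: "\<exists>l P. level_matrix n A (?B H) l P" if "?cos H" for H
  proof -
    have H: "H \<in> simple_graphs n" and c: "generalized_cospectral n G H" using that by auto
    show ?thesis
      using level_matrix_exists[OF Ac adjacency_matrix_carrier n sA adjacency_matrix_symmetric[OF H]
        generalized_cospectral_sum_mat_eq(2)[OF G H c, folded A_def] dW[unfolded W]] by blast
  qed
  \<comment> \<open>One level is fixed for each graph; \<open>same\<close> then compares any two
    graphs to which the same number was assigned.\<close>
  define level where "level = (\<lambda>H. SOME l. \<exists>P. level_matrix n A (?B H) l P)"
  have level: "\<exists>P. level_matrix n A (?B H) (level H) P" if "?cos H" for H
    unfolding level_def using someI_ex[OF ex[OF that]] .
  have same: "(H, K) \<in> graph_iso n"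
    if H: "?cos H" and K: "?cos K" and P: "level_matrix n A (?B H) l P" and R: "level_matrix n A (?B K) l R"
    for H K l P R
  proof -
    obtain y where y: "\<And>i j. i < n \<Longrightarrow> j < n \<Longrightarrow> [P $$ (i, j) = x i * y j] (mod l)"
      using lev[OF _ _ P] H by blast
    obtain z where z: "\<And>i j. i < n \<Longrightarrow> j < n \<Longrightarrow> [R $$ (i, j) = x i * z j] (mod l)"
      using lev[OF _ _ R] K by blast
    obtain f where f: "bij_betw f {..<n} {..<n}" "\<And>i j. i < n \<Longrightarrow> j < n \<Longrightarrow> ?B H $$ (i, j) = ?B K $$ (f i, f j)"
      using level_matrix_unique[OF Ac adjacency_matrix_carrier adjacency_matrix_carrier P R y z] by blast
    have "f i < n" if "i < n" for i using f(1) that by (auto simp: bij_betw_def)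
    then have "(i, j) \<in> H \<longleftrightarrow> (f i, f j) \<in> K" if "i < n" "j < n" for i j
      using f(2)[OF that] that by (auto simp: adjacency_matrix_def split: if_splits)
    then show ?thesis using H K f(1) by (auto simp: graph_iso_def)
  qed
  have cosG: "?cos G" using G by (simp add: generalized_cospectral_def)
  have not_dvd: "\<not> int (p j ^ k j) dvd level H" if H: "?cos H" and j: "j \<in> {1..m}" for H j
  proof
    assume d: "int (p j ^ k j) dvd level H"
    obtain P where P: "level_matrix n A (?B H) (level H) P" using level[OF H] by blast
    obtain y where y: "\<And>i j. i < n \<Longrightarrow> j < n \<Longrightarrow> [P $$ (i, j) = x i * y j] (mod level H)"
      and l\<delta>: "level H dvd \<delta>" using lev[OF _ _ P] H by blast
    have nd: "\<not> p j ^ Suc (k j) dvd N"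
      unfolding N_def by (rule prime_power_Suc_not_dvd_prod[OF p inj j])
    have pj: "prime (int (p j))" using p[OF j] by simp
    \<comment> \<open>For p = 2 the extra factor is the 2 in N = 2 \<delta>. For odd p it comes from
      the determinant, which differs from \<delta> by a power of 2 up to sign.\<close>
    have "int (p j ^ Suc (k j)) dvd int N"
    proof (cases "p j = 2")
      case True
      have "2 * int (p j ^ k j) dvd 2 * \<delta>" using dvd_trans[OF d l\<delta>] by (rule mult_dvd_mono[OF dvd_refl])
      then show ?thesis unfolding \<delta>(2) using True by simp
    next
      case False
      have Hs: "H \<in> simple_graphs n" and c: "generalized_cospectral n G H" using H by auto
      have "int (p j) ^ Suc (k j) dvd det (walk_matrix n G)"
        unfolding W
        by (rule prime_power_level_dvd_det[OF Ac sA adjacency_matrix_carrier adjacency_matrix_symmetric[OF Hs]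
          generalized_cospectral_sum_mat_eq(1)[OF G Hs c, folded A_def] P y pj _ _ n])
          (use k[OF j] d in auto)
      then have "int (p j) ^ Suc (k j) dvd 2 ^ (n div 2) * \<delta>" unfolding det[symmetric] by simp
      moreover have "\<not> int (p j) dvd 2"
        using False p[OF j] by (metis int_dvd_int_iff of_nat_numeral primes_dvd_imp_eq two_is_prime_nat)
      then have "coprime (int (p j)) 2" using prime_imp_coprime[OF pj] by blast
      then have "coprime (int (p j) ^ Suc (k j)) (2 ^ (n div 2))" by (simp del: power_Suc)
      ultimately have "int (p j) ^ Suc (k j) dvd \<delta>" by (simp only: coprime_dvd_mult_right_iff)
      then show ?thesis unfolding \<delta>(2) by (simp del: power_Suc)
    qed
    with nd show False by (simp only: int_dvd_int_iff)
  qed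
  define D where "D = {l. l dvd N \<and> (\<forall>j\<in>{1..m}. \<not> p j ^ k j dvd l)}"
  have D: "finite D" "card D \<le> (\<Prod>j=1..m. k j)"
    unfolding D_def N_def by (rule card_restricted_divisors(1)[OF p inj], assumption)
      (rule card_restricted_divisors(2)[OF p inj], assumption)
  have levD: "nat (level H) \<in> D" "0 < level H" if H: "?cos H" for H
  proof -
    obtain P where P: "level_matrix n A (?B H) (level H) P" using level[OF H] by blast
    then show pos: "0 < level H" by (simp add: level_matrix_def)
    have "level H dvd int N" unfolding \<delta>(2) using lev[OF _ _ P] H by simp
    then have "nat (level H) dvd N" using pos by (simp add: nat_dvd_iff)
    moreover have "\<not> p j ^ k j dvd nat (level H)" if "j \<in> {1..m}" for j
      using not_dvd[OF H that] pos by (metis int_dvd_int_iff int_nat_eq order_less_imp_le)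
    ultimately show "nat (level H) \<in> D" by (simp add: D_def)
  qed
  \<comment> \<open>Level 1 is admissible but reserved for \<open>G\<close>; removing it from
    \<open>D\<close> produces the subtraction of 1 in the bound.\<close>
  have 1: "1 \<in> D"
  proof -
    have "p j ^ k j \<noteq> 1" if "j \<in> {1..m}" for j
      using p[OF that] k[OF that] by (auto simp: prime_nat_iff)
    then show ?thesis by (auto simp: D_def)
  qed
  let ?M = "{H \<in> simple_graphs n. generalized_cospectral n G H \<and> (G, H) \<notin> graph_iso n}"
  define rep where "rep = (\<lambda>c. SOME H. H \<in> ?M \<and> c = graph_iso n `` {H})"
  have rep: "rep c \<in> ?M \<and> c = graph_iso n `` {rep c}" if "c \<in> mate_classes n G" for c
    unfolding rep_def
  proof (rule someI_ex)
    show "\<exists>H. H \<in> ?M \<and> c = graph_iso n `` {H}"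
      using that unfolding mate_classes_def by (rule quotientE) blast
  qed
  have "inj_on (\<lambda>c. nat (level (rep c))) (mate_classes n G)"
  proof (rule inj_onI)
    fix c c' assume c: "c \<in> mate_classes n G" "c' \<in> mate_classes n G"
      and eq: "nat (level (rep c)) = nat (level (rep c'))"
    have cs: "?cos (rep c)" "?cos (rep c')" using rep[OF c(1)] rep[OF c(2)] by auto
    have leq: "level (rep c) = level (rep c')" using eq levD(2)[OF cs(1)] levD(2)[OF cs(2)] by simp
    obtain P R where "level_matrix n A (?B (rep c)) (level (rep c)) P" "level_matrix n A (?B (rep c')) (level (rep c)) R"
      using level[OF cs(1)] level[OF cs(2)] unfolding leq by blast
    then have "(rep c, rep c') \<in> graph_iso n" by (rule same[OF cs])
    then have "graph_iso n `` {rep c} = graph_iso n `` {rep c'}" by (rule equiv_class_eq[OF equiv_graph_iso])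
    then show "c = c'" using rep[OF c(1)] rep[OF c(2)] by simp
  qed
  moreover have "(\<lambda>c. nat (level (rep c))) ` mate_classes n G \<subseteq> D - {1}"
  proof
    fix l assume "l \<in> (\<lambda>c. nat (level (rep c))) ` mate_classes n G"
    then obtain c where c: "c \<in> mate_classes n G" "l = nat (level (rep c))" by auto
    have H: "?cos (rep c)" "(G, rep c) \<notin> graph_iso n" using rep[OF c(1)] by auto
    \<comment> \<open>The identity is a level matrix of level 1 from \<open>G\<close> to itself, so
      \<open>same\<close> would make a mate of level 1 isomorphic to \<open>G\<close>.\<close>
    have "level (rep c) \<noteq> 1"
    proof
      assume one: "level (rep c) = 1"
      obtain P where "level_matrix n A (?B (rep c)) 1 P" using level[OF H(1)] unfolding one by blast
      then have "(G, rep c) \<in> graph_iso n"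
        using same[OF cosG H(1)] level_matrix_one[OF Ac] unfolding A_def by blast
      then show False using H(2) by blast
    qed
    then show "l \<in> D - {1}" using levD[OF H(1)] c(2) by auto
  qed
  ultimately have "card (mate_classes n G) \<le> card (D - {1})"
    using D(1) by (intro card_inj_on_le) auto
  also have "\<dots> = card D - 1" using 1 D(1) by simp
  also have "\<dots> \<le> (\<Prod>j=1..m. k j) - 1" using D(2) by simp
  finally show ?thesis by (simp add: number_of_mates_def)
qed

end
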